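(* Let the sequence $\{(x_k,u_k)\}$ be generated by the method B-STEP-DCA described in the context and suppose that the following assumptions hold true: 1. the sequences of penalty parameters $\{c_k\}$ and optimality tolerances $\{\varepsilon_k\}$ are bounded; 2. $\sum_{k=0}^\infty\nu_k<+\infty$ and $\limsup_{k\to\infty}\varepsilon_k=\varepsilon_*$; 3. the sequence of controls $\{u_k\}$ is bounded in $L^\infty([0,T];\mathbb R^m)$; 4. the functions $G_i(x,u,t)$ and $H_i(x,u,t)$, $i\in\{1,\dots,n\}$, and $q_s(x,u,t)$, $s\in\mathcal M$, are differentiable in $(x,u)$ for a.e. $t\in[0,T]$ and their partial derivatives in $x$ and $u$ are Carathéodory mappings. Then any limit point $(x_*,u_* )\in X$ of the sequence $\{(x_k,u_k)\}$ in the Banach space $W^{1,1}([0,T];\mathbb R^n)\times L^1([0,T];\mathbb R^m)$ is a generalised $\varepsilon_*$-critical point of the problem $(\mathcal P)$. Furthermore, if $(x_*,u_* )$ is feasible for this problem, then it is an $\varepsilon_*$-critical point of the problem $(\mathcal P)$.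
   Context: Notation. $T>0$; $|\cdot|$ is the Euclidean norm; $\mathbb N=\{0,1,2,\dots\}$; $\|\cdot\|_s$ is the $L^s$ norm on $[0,T]$, and $\|(x,u)\|_2^2=\int_0^T(|x(t)|^2+|u(t)|^2)\,dt$; $W^{1,s}([0,T];\mathbb R^n)$ is the space of absolutely continuous $x$ with $\dot x\in L^s$, normed by $\|x\|_{1,s}=\|x\|_s+\|\dot x\|_s$. $X=W^{1,\infty}([0,T];\mathbb R^n)\times L^\infty([0,T];\mathbb R^m)$ with norm $\|x\|_{1,\infty}+\|u\|_\infty$; $Y=W^{1,1}([0,T];\mathbb R^n)\times L^1([0,T];\mathbb R^m)$ with norm $\|x\|_{1,1}+\|u\|_1$. $X_0\subseteq X$ is a convex set closed in $X$ with respect to the topology of $Y$. A limit point of a sequence is the limit of some subsequence. $\partial$ is the convex subdifferential, $\partial_{x,u}$ the one with respect to $(x,u)$. A point $z\in X_0$ is $\varepsilon$-optimal for minimising $f$ over $X_0$ if $f(z)\le\inf_{X_0}f+\varepsilon$. Problem $(\mathcal P)$: minimise $J(x,u)=\int_0^TF_0(x(t),u(t),t)\,dt+f_0(x(0),x(T))$ over $(x,u)\in X_0$ subject to $\dot x(t)=F(x(t),u(t),t)$ for a.e. $t$; $f_i(x(0),x(T))\le0$, $i\in\mathcal I=\{1,\dots,\ell_I\}$; $f_j(x(0),x(T))=0$, $j\in\mathcal E=\{\ell_I+1,\dots,\ell_E\}$; $\Xi_s(x(t),u(t),t)\le0$ for a.e. $t$, $s\in\mathcal M=\{1,\dots,\ell_M\}$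 (index sets may be empty). Here $F_0=G_0-H_0$, $F=G-H$ ($\mathbb R^n$-valued, components $F_i=G_i-H_i$, $i=1,\dots,n$), $f_i=g_i-h_i$ on $\mathbb R^{2n}$, $\Xi_s=p_s-q_s$, where $G_i,H_i$ ($0\le i\le n$), $p_s,q_s$ are real-valued functions of $(x,u,t)\in\mathbb R^n\times\mathbb R^m\times[0,T]$ convex in $(x,u)$, and $g_i,h_i$ are real-valued convex functions (possibly nonsmooth). Data assumptions. $G_i,H_i$ ($0\le i\le n$), $p_s,q_s$ are Carathéodory (continuous in $(x,u)$ for a.e. $t$, measurable in $t$); for every $(x,u)\in X$ the multifunctions $t\mapsto\partial_{x,u}G_i(x(t),u(t),t)$, and likewise for $H_i,p_s,q_s$, are measurable; for every $R>0$ there is $\gamma_R>0$ such that for a.e. $t$ and all $(x,u)$ with $|x|+|u|\le R$ the absolute values of all these functions at $(x,u,t)$, and the norms of all their subgradients in $(x,u)$ there, are at most $\gamma_R$. Penalty function. $\Phi_c=J+c\varphi$, $\varphi(x,u)=\sum_{i=1}^n\int_0^T|\dot x_i(t)-F_i(x(t),u(t),t)|\,dt+\sum_{i\in\mathcal I}\max\{0,f_i(x(0),x(T))\}+\sum_{j\in\mathcal E}|f_j(x(0),x(T))|+\sum_{s\in\mathcal M}\int_0^T\max\{0,\Xi_s(x(t),u(t),t)\}\,dt$. Convex majorants. A collection of subgradients at $(\bar x,\bar u)\in X$ is $V=(V_0,\dots,V_n,W_1,\dots,W_n,v_0,\dots,v_{\ell_E},w_{\ell_I+1},\dots,w_{\ell_E},z_1,\dots,z_{\ell_M})$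 with $V_i,W_i,z_s$ measurable on $[0,T]$ and, for a.e. $t$, $V_i(t)\in\partial_{x,u}H_i(\bar x(t),\bar u(t),t)$, $W_i(t)\in\partial_{x,u}G_i(\bar x(t),\bar u(t),t)$, $z_s(t)\in\partial_{x,u}q_s(\bar x(t),\bar u(t),t)$, $v_i\in\partial h_i(\bar x(0),\bar x(T))$, $w_j\in\partial g_j(\bar x(0),\bar x(T))$. With $\Delta(t)=(x(t)-\bar x(t),u(t)-\bar u(t))$, $\Delta_b=(x(0)-\bar x(0),x(T)-\bar x(T))$, put $\Gamma(x,u;\bar x,\bar u;V)=\sum_{i=1}^n\int_0^T\max\{\dot x_i+H_i(x,u,t)-G_i(\bar x,\bar u,t)-\langle W_i,\Delta\rangle,\,-\dot x_i+G_i(x,u,t)-H_i(\bar x,\bar u,t)-\langle V_i,\Delta\rangle\}\,dt+\sum_{i\in\mathcal I}\max\{0,g_i(x(0),x(T))-h_i(\bar x(0),\bar x(T))-\langle v_i,\Delta_b\rangle\}+\sum_{j\in\mathcal E}\max\{g_j(x(0),x(T))-h_j(\bar x(0),\bar x(T))-\langle v_j,\Delta_b\rangle,\,h_j(x(0),x(T))-g_j(\bar x(0),\bar x(T))-\langle w_j,\Delta_b\rangle\}+\sum_{s\in\mathcal M}\int_0^T\max\{0,p_s(x,u,t)-q_s(\bar x,\bar u,t)-\langle z_s,\Delta\rangle\}\,dt$ (functions under integrals evaluated at $t$), $\omega(x,u;V)=\int_0^T(G_0(x(t),u(t),t)-\langle V_0(t),(x(t),u(t))\rangle)\,dt+g_0(x(0),x(T))-\langle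 v_0,(x(0),x(T))\rangle$, and $Q_c(x,u;\bar x,\bar u;V)=\omega(x,u;V)+c\,\Gamma(x,u;\bar x,\bar u;V)$. Criticality. Let $\varepsilon\ge0$. A point $(x_*,u_* )\in X_0$ is a generalised $\varepsilon$-critical point of $(\mathcal P)$ for a given value $c>0$ of the penalty parameter if there is a collection of subgradients $V$ at $(x_*,u_* )$ such that $(x_*,u_* )$ is an $\varepsilon$-optimal solution of $\min_{(x,u)\in X_0}Q_c(x,u;x_*,u_*;V)$; when no value of the penalty parameter is named, this is understood to hold for some value $c>0$. A feasible point $(x_*,u_* )$ of $(\mathcal P)$ is $\varepsilon$-critical if there are a collection of subgradients $V$ at $(x_*,u_* )$ and $c_*>0$ such that for every $c\ge c_*$ the point $(x_*,u_* )$ is an $\varepsilon$-optimal solution of $\min_{(x,u)\in X_0}Q_c(x,u;x_*,u_*;V)$. Method B-STEP-DCA. Choose $(x_0,u_0)\in X_0$, $c_0>0$, $\eta_1,\eta_2,\zeta,\sigma\in(0,1)$, $\varepsilon_\varphi,\varepsilon_{feas}>0$, $\{\varepsilon_k\}\subset(0,\infty)$. For iteration $k=0,1,\dots$: pick a collection of subgradients $V_k$ at $(x_k,u_k)$; write $\Gamma_k(\cdot)=\Gamma(\cdot;x_k,u_k;V_k)$, $\omega_k(\cdot)=\omega(\cdot;V_k)$, $Q_{c,k}=\omega_k+c\Gamma_k$; $(x_k[c],u_k[c])$ denotes a computed $\varepsilon_k$-optimal solution of $\min_{X_0}Q_{c,k}$. Step 1: $c_+=c_k$; compute $(x_k[c_+],u_k[c_+])$;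 if $\Gamma_k(x_k[c_+],u_k[c_+])\le\varepsilon_\varphi$ go to Step 4, else to Step 2. Step 2: compute an $\varepsilon_k$-optimal solution $(\widehat x_k,\widehat u_k)$ of $\min_{X_0}\Gamma_k$. If $\Gamma_k(\widehat x_k,\widehat u_k)<\Gamma_k(x_k,u_k)$ go to Step 3. Otherwise, while $\Gamma_k(x_k[c_+],u_k[c_+])\le\Gamma_k(x_k,u_k)+\varepsilon_{feas}$ fails, increase $c_+$ and recompute $(x_k[c_+],u_k[c_+])$; then go to Step 4. Step 3: while $\Gamma_k(x_k[c_+],u_k[c_+])-\Gamma_k(x_k,u_k)\le\eta_1(\Gamma_k(\widehat x_k,\widehat u_k)-\Gamma_k(x_k,u_k))$ fails, increase $c_+$ and recompute; then go to Step 4. Step 4: put $c_{k+1}=c_+$; while $Q_{c_{k+1},k}(x_k[c_{k+1}],u_k[c_{k+1}])-Q_{c_{k+1},k}(x_k,u_k)\le c_{k+1}\eta_2(\Gamma_k(x_k[c_{k+1}],u_k[c_{k+1}])-\Gamma_k(x_k,u_k))$ fails, increase $c_{k+1}$ and recompute. Step 5: with $d_k=(x_k[c_{k+1}]-x_k,u_k[c_{k+1}]-u_k)$, choose $\nu_k>0$, $\overline\alpha_k\ge0$, find the smallest $j_k\in\mathbb N$ such that, for $\alpha_k=\zeta^{j_k}\overline\alpha_k$, $\Phi_{c_{k+1}}((x_k[c_{k+1}],u_k[c_{k+1}])+\alpha_kd_k)-\Phi_{c_{k+1}}(x_k[c_{k+1}],u_k[c_{k+1}])\le-\sigma\alpha_k^2\|d_k\|_2^2+\nu_k$;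 set $(x_{k+1},u_{k+1})=(x_k[c_{k+1}],u_k[c_{k+1}])+\alpha_kd_k$. (For the convergence analysis no stopping criterion is applied, so the sequence is infinite.) Standing assumptions on the method. All computed points $(x_k[c],u_k[c])$ satisfy $Q_{c,k}(x_k[c],u_k[c])\le Q_{c,k}(x_k,u_k)$. The trial step $\overline\alpha_k$ is such that $(x_k[c_{k+1}],u_k[c_{k+1}])+\zeta^j\overline\alpha_kd_k\in X_0$ for all $j\in\mathbb N$. $\Phi_{c_0}$ is bounded below on $X_0$. There is $\varkappa>0$ such that whenever $c_+$ or $c_{k+1}$ is increased in Steps 2, 3, 4, it is increased by at least $\varkappa$. *)

theory Defs
  imports "HOL-Analysis.Analysis" "HOL-Probability.Essential_Supremum"
begin

text \<open>
  Elements of \<open>W\<^sup>1\<^sup>,\<^sup>\<infinity> \<times> L\<^sup>\<infinity>\<close> are represented by pairs of functions on the real line, of which only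
  the restriction to \<open>[0,T]\<close> (for the control: up to null sets) matters.  All notions below are
  invariant under a change of representative; in particular a set that is closed in the sense of
  \<open>closed_in_X\<close> contains all representatives of its elements.
\<close>

type_synonym ('n, 'm) process = "(real \<Rightarrow> real^'n) \<times> (real \<Rightarrow> real^'m)"

abbreviation LT :: "real \<Rightarrow> real measure" where
  "LT T \<equiv> lebesgue_on {0..T}"

abbreviation integ :: "real \<Rightarrow> (real \<Rightarrow> real) \<Rightarrow> real" where
  "integ T f \<equiv> integral\<^sup>L (LT T) f"

text \<open>The usual epsilon-delta definition; the elements of a division \<open>D\<close> are finitely many
  nonempty compact intervals with pairwise disjoint interiors.\<close>

definition abs_cont_on :: "real \<Rightarrow> real \<Rightarrow> (real \<Rightarrow> 'a::real_normed_vector) \<Rightarrow> bool" where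
  "abs_cont_on a b x \<longleftrightarrow>
     (\<forall>e>0. \<exists>d>0. \<forall>D. D division_of \<Union>D \<and> \<Union>D \<subseteq> {a..b} \<and> (\<Sum>K\<in>D. Sup K - Inf K) < d \<longrightarrow>
        (\<Sum>K\<in>D. norm (x (Sup K) - x (Inf K))) < e)"

text \<open>Absolutely continuous functions are differentiable almost everywhere; on the remaining
  null set the value below is irrelevant.\<close>

definition ddt :: "real \<Rightarrow> (real \<Rightarrow> 'a::real_normed_vector) \<Rightarrow> real \<Rightarrow> 'a" where
  "ddt T x t = vector_derivative x (at t within {0..T})"

definition Linf_norm :: "real \<Rightarrow> (real \<Rightarrow> 'a::real_normed_vector) \<Rightarrow> ereal" where
  "Linf_norm T f = esssup (LT T) (\<lambda>t. ereal (norm (f t)))"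

definition in_Linf :: "real \<Rightarrow> (real \<Rightarrow> 'a::real_normed_vector) \<Rightarrow> bool" where
  "in_Linf T f \<longleftrightarrow> f \<in> borel_measurable (LT T) \<and> Linf_norm T f < \<infinity>"

definition X_space :: "real \<Rightarrow> ('n::finite, 'm::finite) process set" where
  "X_space T = {(x, u). abs_cont_on 0 T x \<and> in_Linf T (ddt T x) \<and> in_Linf T u}"

definition lincomb ::
  "real \<Rightarrow> ('n::finite, 'm::finite) process \<Rightarrow> real \<Rightarrow> ('n, 'm) process \<Rightarrow> ('n, 'm) process" where
  "lincomb a z b w = ((\<lambda>t. a *\<^sub>R fst z t + b *\<^sub>R fst w t), (\<lambda>t. a *\<^sub>R snd z t + b *\<^sub>R snd w t))"

definition Y_norm :: "real \<Rightarrow> ('n::finite, 'm::finite) process \<Rightarrow> real" where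
  "Y_norm T z = integ T (\<lambda>t. norm (fst z t)) + integ T (\<lambda>t. norm (ddt T (fst z) t))
     + integ T (\<lambda>t. norm (snd z t))"

definition Y_dist :: "real \<Rightarrow> ('n::finite, 'm::finite) process \<Rightarrow> ('n, 'm) process \<Rightarrow> real" where
  "Y_dist T z w = Y_norm T (lincomb 1 z (-1) w)"

definition L2_norm_sq :: "real \<Rightarrow> ('n::finite, 'm::finite) process \<Rightarrow> real" where
  "L2_norm_sq T z = integ T (\<lambda>t. (norm (fst z t))\<^sup>2 + (norm (snd z t))\<^sup>2)"

definition convex_processes :: "('n::finite, 'm::finite) process set \<Rightarrow> bool" where
  "convex_processes S \<longleftrightarrow>
     (\<forall>z\<in>S. \<forall>w\<in>S. \<forall>\<theta>. 0 \<le> \<theta> \<and> \<theta> \<le> 1 \<longrightarrow> lincomb (1 - \<theta>) z \<theta> w \<in> S)"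

definition closed_in_X :: "real \<Rightarrow> ('n::finite, 'm::finite) process set \<Rightarrow> bool" where
  "closed_in_X T S \<longleftrightarrow>
     (\<forall>z\<in>X_space T. (\<forall>e>0. \<exists>w\<in>S. Y_dist T w z < e) \<longrightarrow> z \<in> S)"

definition Y_limit_point ::
  "real \<Rightarrow> (nat \<Rightarrow> ('n::finite, 'm::finite) process) \<Rightarrow> ('n, 'm) process \<Rightarrow> bool" where
  "Y_limit_point T zs z \<longleftrightarrow>
     (\<exists>r. strict_mono (r :: nat \<Rightarrow> nat) \<and> (\<lambda>k. Y_dist T (zs (r k)) z) \<longlonglongrightarrow> 0)"

definition val :: "('n::finite, 'm::finite) process \<Rightarrow> real \<Rightarrow> (real^'n) \<times> (real^'m)" where
  "val z t = (fst z t, snd z t)"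

definition ends :: "real \<Rightarrow> ('n::finite, 'm::finite) process \<Rightarrow> (real^'n) \<times> (real^'n)" where
  "ends T z = (fst z 0, fst z T)"

definition subdiff :: "('a::real_inner \<Rightarrow> real) \<Rightarrow> 'a \<Rightarrow> 'a set" where
  "subdiff f z = {v. \<forall>y. f z + inner v (y - z) \<le> f y}"

definition eps_optimal :: "real \<Rightarrow> ('a \<Rightarrow> real) \<Rightarrow> 'a set \<Rightarrow> 'a \<Rightarrow> bool" where
  "eps_optimal \<epsilon> f S z \<longleftrightarrow> z \<in> S \<and> ereal (f z) \<le> (INF w\<in>S. ereal (f w)) + ereal \<epsilon>"

definition measurable_multifun :: "real \<Rightarrow> (real \<Rightarrow> 'a::topological_space set) \<Rightarrow> bool" where
  "measurable_multifun T \<Psi> \<longleftrightarrow>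
     (\<forall>U. open U \<longrightarrow> {t \<in> {0..T}. \<Psi> t \<inter> U \<noteq> {}} \<in> sets (LT T))"

definition caratheodory ::
  "real \<Rightarrow> ('a::topological_space \<Rightarrow> real \<Rightarrow> 'b::topological_space) \<Rightarrow> bool" where
  "caratheodory T f \<longleftrightarrow>
     (AE t in LT T. continuous_on UNIV (\<lambda>z. f z t)) \<and>
     (\<forall>z. (\<lambda>t. f z t) \<in> borel_measurable (LT T))"

text \<open>The existential is harmless: \<open>D\<close> is the gradient for almost every \<open>t\<close>, and Lebesgue
  measurability is not affected by null sets.\<close>

definition smooth_caratheodory ::
  "real \<Rightarrow> ('a::real_inner \<times> 'b::real_inner \<Rightarrow> real \<Rightarrow> real) \<Rightarrow> bool" where
  "smooth_caratheodory T f \<longleftrightarrow>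
     (\<exists>D. (AE t in LT T. \<forall>z. GDERIV (\<lambda>y. f y t) z :> D z t) \<and>
        caratheodory T (\<lambda>z t. fst (D z t)) \<and> caratheodory T (\<lambda>z t. snd (D z t)))"

type_synonym ('n, 'm) integrand = "(real^'n) \<times> (real^'m) \<Rightarrow> real \<Rightarrow> real"
type_synonym 'n endfun = "(real^'n) \<times> (real^'n) \<Rightarrow> real"

text \<open>The fields \<open>gf i\<close>, \<open>hf i\<close> are relevant for \<open>0 \<le> i \<le> lE\<close>, and \<open>pf s\<close>, \<open>qf s\<close> for
  \<open>1 \<le> s \<le> lM\<close>.\<close>

record ('n, 'm) ocp =
  hor :: real
  X0 :: "('n, 'm) process set"
  G0f :: "('n, 'm) integrand"
  H0f :: "('n, 'm) integrand"
  Gf :: "'n \<Rightarrow> ('n, 'm) integrand"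
  Hf :: "'n \<Rightarrow> ('n, 'm) integrand"
  lI :: nat
  lE :: nat
  gf :: "nat \<Rightarrow> 'n endfun"
  hf :: "nat \<Rightarrow> 'n endfun"
  lM :: nat
  pf :: "nat \<Rightarrow> ('n, 'm) integrand"
  qf :: "nat \<Rightarrow> ('n, 'm) integrand"

definition ineq_ix :: "('n::finite, 'm::finite) ocp \<Rightarrow> nat set" where
  "ineq_ix P = {1..lI P}"

definition eq_ix :: "('n::finite, 'm::finite) ocp \<Rightarrow> nat set" where
  "eq_ix P = {lI P + 1..lE P}"

definition mixed_ix :: "('n::finite, 'm::finite) ocp \<Rightarrow> nat set" where
  "mixed_ix P = {1..lM P}"

definition F0 :: "('n::finite, 'm::finite) ocp \<Rightarrow> ('n, 'm) integrand" where
  "F0 P a t = G0f P a t - H0f P a t"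

definition Fc :: "('n::finite, 'm::finite) ocp \<Rightarrow> 'n \<Rightarrow> ('n, 'm) integrand" where
  "Fc P i a t = Gf P i a t - Hf P i a t"

definition endf :: "('n::finite, 'm::finite) ocp \<Rightarrow> nat \<Rightarrow> 'n endfun" where
  "endf P i b = gf P i b - hf P i b"

definition Xi :: "('n::finite, 'm::finite) ocp \<Rightarrow> nat \<Rightarrow> ('n, 'm) integrand" where
  "Xi P s a t = pf P s a t - qf P s a t"

definition data_funs :: "('n::finite, 'm::finite) ocp \<Rightarrow> ('n, 'm) integrand set" where
  "data_funs P = {G0f P, H0f P} \<union> range (Gf P) \<union> range (Hf P)
     \<union> pf P ` mixed_ix P \<union> qf P ` mixed_ix P"

definition ocp_structure :: "('n::finite, 'm::finite) ocp \<Rightarrow> bool" where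
  "ocp_structure P \<longleftrightarrow>
     0 < hor P \<and> lI P \<le> lE P \<and>
     X0 P \<subseteq> X_space (hor P) \<and> convex_processes (X0 P) \<and> closed_in_X (hor P) (X0 P) \<and>
     (\<forall>f\<in>data_funs P. \<forall>t\<in>{0..hor P}. convex_on UNIV (\<lambda>a. f a t)) \<and>
     (\<forall>i\<le>lE P. convex_on UNIV (gf P i) \<and> convex_on UNIV (hf P i))"

definition data_assumptions :: "('n::finite, 'm::finite) ocp \<Rightarrow> bool" where
  "data_assumptions P \<longleftrightarrow>
     (\<forall>f\<in>data_funs P. caratheodory (hor P) f) \<and>
     (\<forall>f\<in>data_funs P. \<forall>z\<in>X_space (hor P).
        measurable_multifun (hor P) (\<lambda>t. subdiff (\<lambda>a. f a t) (val z t))) \<and>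
     (\<forall>R>0. \<exists>\<gamma>>0. AE t in LT (hor P). \<forall>x u. norm x + norm u \<le> R \<longrightarrow>
        (\<forall>f\<in>data_funs P. \<bar>f (x, u) t\<bar> \<le> \<gamma> \<and> (\<forall>v\<in>subdiff (\<lambda>a. f a t) (x, u). norm v \<le> \<gamma>)))"

definition feasible :: "('n::finite, 'm::finite) ocp \<Rightarrow> ('n, 'm) process \<Rightarrow> bool" where
  "feasible P z \<longleftrightarrow>
     z \<in> X0 P \<and>
     (AE t in LT (hor P). ddt (hor P) (fst z) t = (\<chi> i. Fc P i (val z t) t)) \<and>
     (\<forall>i\<in>ineq_ix P. endf P i (ends (hor P) z) \<le> 0) \<and>
     (\<forall>j\<in>eq_ix P. endf P j (ends (hor P) z) = 0) \<and>
     (\<forall>s\<in>mixed_ix P. AE t in LT (hor P). Xi P s (val z t) t \<le> 0)"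

definition Jfun :: "('n::finite, 'm::finite) ocp \<Rightarrow> ('n, 'm) process \<Rightarrow> real" where
  "Jfun P z = integ (hor P) (\<lambda>t. F0 P (val z t) t) + endf P 0 (ends (hor P) z)"

definition phi :: "('n::finite, 'm::finite) ocp \<Rightarrow> ('n, 'm) process \<Rightarrow> real" where
  "phi P z =
     (\<Sum>i\<in>UNIV. integ (hor P) (\<lambda>t. \<bar>ddt (hor P) (fst z) t $ i - Fc P i (val z t) t\<bar>))
     + (\<Sum>i\<in>ineq_ix P. max 0 (endf P i (ends (hor P) z)))
     + (\<Sum>j\<in>eq_ix P. \<bar>endf P j (ends (hor P) z)\<bar>)
     + (\<Sum>s\<in>mixed_ix P. integ (hor P) (\<lambda>t. max 0 (Xi P s (val z t) t)))"

definition Phi :: "('n::finite, 'm::finite) ocp \<Rightarrow> real \<Rightarrow> ('n, 'm) process \<Rightarrow> real" where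
  "Phi P c z = Jfun P z + c * phi P z"

record ('n, 'm) subgrads =
  sV0 :: "real \<Rightarrow> (real^'n) \<times> (real^'m)"
  sV :: "'n \<Rightarrow> real \<Rightarrow> (real^'n) \<times> (real^'m)"
  sW :: "'n \<Rightarrow> real \<Rightarrow> (real^'n) \<times> (real^'m)"
  sv :: "nat \<Rightarrow> (real^'n) \<times> (real^'n)"
  sw :: "nat \<Rightarrow> (real^'n) \<times> (real^'n)"
  sz :: "nat \<Rightarrow> real \<Rightarrow> (real^'n) \<times> (real^'m)"

definition subgrad_selection ::
  "('n::finite, 'm::finite) ocp \<Rightarrow> ('n, 'm) process \<Rightarrow> ('n, 'm) integrand
     \<Rightarrow> (real \<Rightarrow> (real^'n) \<times> (real^'m)) \<Rightarrow> bool" where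
  "subgrad_selection P zb f v \<longleftrightarrow>
     v \<in> borel_measurable (LT (hor P)) \<and>
     (AE t in LT (hor P). v t \<in> subdiff (\<lambda>a. f a t) (val zb t))"

definition subgrads_at ::
  "('n::finite, 'm::finite) ocp \<Rightarrow> ('n, 'm) process \<Rightarrow> ('n, 'm) subgrads \<Rightarrow> bool" where
  "subgrads_at P zb V \<longleftrightarrow>
     subgrad_selection P zb (H0f P) (sV0 V) \<and>
     (\<forall>i. subgrad_selection P zb (Hf P i) (sV V i)) \<and>
     (\<forall>i. subgrad_selection P zb (Gf P i) (sW V i)) \<and>
     (\<forall>s\<in>mixed_ix P. subgrad_selection P zb (qf P s) (sz V s)) \<and>
     (\<forall>i\<le>lE P. sv V i \<in> subdiff (hf P i) (ends (hor P) zb)) \<and>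
     (\<forall>j\<in>eq_ix P. sw V j \<in> subdiff (gf P j) (ends (hor P) zb))"

definition Gam ::
  "('n::finite, 'm::finite) ocp \<Rightarrow> ('n, 'm) process \<Rightarrow> ('n, 'm) process
     \<Rightarrow> ('n, 'm) subgrads \<Rightarrow> real" where
  "Gam P z zb V =
    (let T = hor P; \<Delta> = (\<lambda>t. val z t - val zb t); b = ends T z; bb = ends T zb; \<Delta>b = b - bb in
      (\<Sum>i\<in>UNIV. integ T (\<lambda>t. max
          (ddt T (fst z) t $ i + Hf P i (val z t) t - Gf P i (val zb t) t - inner (sW V i t) (\<Delta> t))
          (- (ddt T (fst z) t $ i) + Gf P i (val z t) t - Hf P i (val zb t) t - inner (sV V i t) (\<Delta> t))))
      + (\<Sum>i\<in>ineq_ix P. max 0 (gf P i b - hf P i bb - inner (sv V i) \<Delta>b))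
      + (\<Sum>j\<in>eq_ix P. max (gf P j b - hf P j bb - inner (sv V j) \<Delta>b)
                            (hf P j b - gf P j bb - inner (sw V j) \<Delta>b))
      + (\<Sum>s\<in>mixed_ix P. integ T (\<lambda>t.
          max 0 (pf P s (val z t) t - qf P s (val zb t) t - inner (sz V s t) (\<Delta> t)))))"

definition omega ::
  "('n::finite, 'm::finite) ocp \<Rightarrow> ('n, 'm) process \<Rightarrow> ('n, 'm) subgrads \<Rightarrow> real" where
  "omega P z V =
     integ (hor P) (\<lambda>t. G0f P (val z t) t - inner (sV0 V t) (val z t))
     + gf P 0 (ends (hor P) z) - inner (sv V 0) (ends (hor P) z)"

definition Qc ::
  "('n::finite, 'm::finite) ocp \<Rightarrow> real \<Rightarrow> ('n, 'm) process \<Rightarrow> ('n, 'm) process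
     \<Rightarrow> ('n, 'm) subgrads \<Rightarrow> real" where
  "Qc P c z zb V = omega P z V + c * Gam P z zb V"

definition gen_critical_for ::
  "('n::finite, 'm::finite) ocp \<Rightarrow> real \<Rightarrow> real \<Rightarrow> ('n, 'm) process \<Rightarrow> bool" where
  "gen_critical_for P \<epsilon> c z \<longleftrightarrow>
     z \<in> X0 P \<and> (\<exists>V. subgrads_at P z V \<and> eps_optimal \<epsilon> (\<lambda>w. Qc P c w z V) (X0 P) z)"

definition gen_critical ::
  "('n::finite, 'm::finite) ocp \<Rightarrow> real \<Rightarrow> ('n, 'm) process \<Rightarrow> bool" where
  "gen_critical P \<epsilon> z \<longleftrightarrow> (\<exists>c>0. gen_critical_for P \<epsilon> c z)"

definition critical ::
  "('n::finite, 'm::finite) ocp \<Rightarrow> real \<Rightarrow> ('n, 'm) process \<Rightarrow> bool" where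
  "critical P \<epsilon> z \<longleftrightarrow>
     feasible P z \<and>
     (\<exists>V c0. subgrads_at P z V \<and> c0 > 0 \<and>
        (\<forall>c\<ge>c0. eps_optimal \<epsilon> (\<lambda>w. Qc P c w z V) (X0 P) z))"

text \<open>
  A record of one infinite run of the method.  \<open>computed k c\<close> is the computed solution
  \<open>(x\<^sub>k[c], u\<^sub>k[c])\<close>; it is meaningful only for the values of \<open>c\<close> actually tried in iteration \<open>k\<close>.
  These are listed, in the order in which they are tried, in \<open>trials k\<close> (values of \<open>c\<^sub>+\<close> in
  Steps 1--3) and \<open>trials4 k\<close> (values of \<open>c\<^sub>k\<^sub>+\<^sub>1\<close> in Step 4); both lists include the starting value
  of the respective loop.  \<open>infeas_min k\<close> is the point computed in Step 2 (meaningful only if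
  Step 2 is entered).
\<close>

record ('n, 'm) dca_run =
  eta1 :: real
  eta2 :: real
  zeta :: real
  sigma :: real
  eps_phi :: real
  eps_feas :: real
  eps :: "nat \<Rightarrow> real"
  iterate :: "nat \<Rightarrow> ('n, 'm) process"
  pen :: "nat \<Rightarrow> real"
  subgr :: "nat \<Rightarrow> ('n, 'm) subgrads"
  computed :: "nat \<Rightarrow> real \<Rightarrow> ('n, 'm) process"
  infeas_min :: "nat \<Rightarrow> ('n, 'm) process"
  trials :: "nat \<Rightarrow> real list"
  trials4 :: "nat \<Rightarrow> real list"
  nu :: "nat \<Rightarrow> real"
  alpha_bar :: "nat \<Rightarrow> real"
  jexp :: "nat \<Rightarrow> nat"

text \<open>The loop ``while \<open>ok c\<close> fails, increase \<open>c\<close>'' started at \<open>c\<close> terminates after trying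
  exactly the values \<open>cs\<close>.\<close>

definition while_increase :: "(real \<Rightarrow> bool) \<Rightarrow> real \<Rightarrow> real list \<Rightarrow> bool" where
  "while_increase ok c cs \<longleftrightarrow>
     cs \<noteq> [] \<and> hd cs = c \<and> sorted_wrt (<) cs \<and>
     (\<forall>c'\<in>set (butlast cs). \<not> ok c') \<and> ok (last cs)"

definition increases_by :: "real \<Rightarrow> real list \<Rightarrow> bool" where
  "increases_by \<kappa> cs \<longleftrightarrow> (\<forall>i. Suc i < length cs \<longrightarrow> cs ! i + \<kappa> \<le> cs ! Suc i)"

definition Gam_k ::
  "('n::finite, 'm::finite) ocp \<Rightarrow> ('n, 'm) dca_run \<Rightarrow> nat \<Rightarrow> ('n, 'm) process \<Rightarrow> real" where
  "Gam_k P R k w = Gam P w (iterate R k) (subgr R k)"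

definition Q_k ::
  "('n::finite, 'm::finite) ocp \<Rightarrow> ('n, 'm) dca_run \<Rightarrow> nat \<Rightarrow> real \<Rightarrow> ('n, 'm) process \<Rightarrow> real" where
  "Q_k P R k c w = Qc P c w (iterate R k) (subgr R k)"

definition tried :: "('n::finite, 'm::finite) dca_run \<Rightarrow> nat \<Rightarrow> real set" where
  "tried R k = set (trials R k) \<union> set (trials4 R k)"

definition trial_point :: "('n::finite, 'm::finite) dca_run \<Rightarrow> nat \<Rightarrow> ('n, 'm) process" where
  "trial_point R k = computed R k (pen R (Suc k))"

text \<open>Iterates are compared as functions, which is no restriction: representatives of the
  computed points may be chosen freely.\<close>

definition dir :: "('n::finite, 'm::finite) dca_run \<Rightarrow> nat \<Rightarrow> ('n, 'm) process" where
  "dir R k = lincomb 1 (trial_point R k) (-1) (iterate R k)"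

definition line_point ::
  "('n::finite, 'm::finite) dca_run \<Rightarrow> nat \<Rightarrow> nat \<Rightarrow> ('n, 'm) process" where
  "line_point R k j = lincomb 1 (trial_point R k) (zeta R ^ j * alpha_bar R k) (dir R k)"

definition line_search_ok ::
  "('n::finite, 'm::finite) ocp \<Rightarrow> ('n, 'm) dca_run \<Rightarrow> nat \<Rightarrow> nat \<Rightarrow> bool" where
  "line_search_ok P R k j \<longleftrightarrow>
     Phi P (pen R (Suc k)) (line_point R k j) - Phi P (pen R (Suc k)) (trial_point R k)
       \<le> - sigma R * (zeta R ^ j * alpha_bar R k)\<^sup>2 * L2_norm_sq (hor P) (dir R k) + nu R k"

definition steps_1_to_3 ::
  "('n::finite, 'm::finite) ocp \<Rightarrow> ('n, 'm) dca_run \<Rightarrow> nat \<Rightarrow> bool" where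
  "steps_1_to_3 P R k \<longleftrightarrow>
    (let \<Gamma> = Gam_k P R k; z = iterate R k; y = computed R k; zh = infeas_min R k in
      if \<Gamma> (y (pen R k)) \<le> eps_phi R then trials R k = [pen R k]
      else eps_optimal (eps R k) \<Gamma> (X0 P) zh \<and>
        (if \<Gamma> zh < \<Gamma> z
         then while_increase (\<lambda>c. \<Gamma> (y c) - \<Gamma> z \<le> eta1 R * (\<Gamma> zh - \<Gamma> z)) (pen R k) (trials R k)
         else while_increase (\<lambda>c. \<Gamma> (y c) \<le> \<Gamma> z + eps_feas R) (pen R k) (trials R k)))"

definition step_4 ::
  "('n::finite, 'm::finite) ocp \<Rightarrow> ('n, 'm) dca_run \<Rightarrow> nat \<Rightarrow> bool" where
  "step_4 P R k \<longleftrightarrow>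
    (let \<Gamma> = Gam_k P R k; Q = Q_k P R k; z = iterate R k; y = computed R k in
      while_increase (\<lambda>c. Q c (y c) - Q c z \<le> c * eta2 R * (\<Gamma> (y c) - \<Gamma> z))
        (last (trials R k)) (trials4 R k)) \<and>
    pen R (Suc k) = last (trials4 R k)"

definition step_5 ::
  "('n::finite, 'm::finite) ocp \<Rightarrow> ('n, 'm) dca_run \<Rightarrow> nat \<Rightarrow> bool" where
  "step_5 P R k \<longleftrightarrow>
     0 < nu R k \<and> 0 \<le> alpha_bar R k \<and>
     line_search_ok P R k (jexp R k) \<and> (\<forall>j<jexp R k. \<not> line_search_ok P R k j) \<and>
     iterate R (Suc k) = line_point R k (jexp R k)"

definition B_STEP_DCA :: "('n::finite, 'm::finite) ocp \<Rightarrow> ('n, 'm) dca_run \<Rightarrow> bool" where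
  "B_STEP_DCA P R \<longleftrightarrow>
     iterate R 0 \<in> X0 P \<and> 0 < pen R 0 \<and>
     eta1 R \<in> {0<..<1} \<and> eta2 R \<in> {0<..<1} \<and> zeta R \<in> {0<..<1} \<and> sigma R \<in> {0<..<1} \<and>
     0 < eps_phi R \<and> 0 < eps_feas R \<and> (\<forall>k. 0 < eps R k) \<and>
     (\<forall>k. subgrads_at P (iterate R k) (subgr R k) \<and>
        (\<forall>c\<in>tried R k. eps_optimal (eps R k) (Q_k P R k c) (X0 P) (computed R k c)) \<and>
        steps_1_to_3 P R k \<and> step_4 P R k \<and> step_5 P R k)"

definition standing_assumptions ::
  "('n::finite, 'm::finite) ocp \<Rightarrow> ('n, 'm) dca_run \<Rightarrow> bool" where
  "standing_assumptions P R \<longleftrightarrow>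
     (\<forall>k. \<forall>c\<in>tried R k. Q_k P R k c (computed R k c) \<le> Q_k P R k c (iterate R k)) \<and>
     (\<forall>k j. line_point R k j \<in> X0 P) \<and>
     bdd_below (Phi P (pen R 0) ` X0 P) \<and>
     (\<exists>\<kappa>>0. \<forall>k. increases_by \<kappa> (trials R k) \<and> increases_by \<kappa> (trials4 R k))"

end

theory Submission
  imports Defs
begin

text \<open>
  Once the penalty parameter has become a constant \<open>c\<close>, the convex majorant satisfies
  \<open>\<Phi>\<^sub>c(w) - \<Phi>\<^sub>c(z\<^sub>k) \<le> Q\<^sub>k(w) - Q\<^sub>k(z\<^sub>k)\<close>, so \<open>\<Phi>\<^sub>c\<close> decreases along the iterates up to a summable
  error, and since it is bounded below, \<open>Q\<^sub>k(z\<^sub>k)\<close> exceeds \<open>inf Q\<^sub>k\<close> by at most \<open>\<epsilon>\<^sub>k + o(1)\<close>.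
  This inequality passes to the limit along a subsequence converging in \<open>Y\<close>: the gradients in \<open>\<Gamma>\<close>
  converge boundedly almost everywhere, the end-point subgradients converge by compactness, and the
  selections \<open>V\<^sub>0\<close> of the nonsmooth \<open>\<partial>H\<^sub>0\<close>, which enter linearly, need only converge weakly.
  If the limit is feasible, \<open>\<Gamma>\<close> vanishes there and is nonnegative elsewhere, so the optimality for \<open>c\<close>
  implies the one for every larger parameter.  Convergence in \<open>Y\<close> controls end points only through
  \<open>\<bar>x(t) - x(s)\<bar> \<le> \<integral>\<bar>x'\<bar>\<close>, which requires Lebesgue's theorem on absolutely continuous functions.
\<close>

section \<open>Absolutely continuous functions on an interval\<close>

text \<open>Weak convergence would not do for the gradients in \<Gamma>. They stand under a maximum,
  which is convex, so weak limits bound \<Gamma> only from below, while in the optimality inequality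
  \<Gamma> at the competitor \<open>w\<close> has to be bounded from above. V_0 is harmless because
  only its integral against the fixed function w - z matters, \<open>z\<close> being the limit, up
  to a pairing with z_k - z that vanishes by boundedness. The moving point z_k is the first argument
  of \<Gamma> only when it is the base point as well, and there \<Gamma> equals \<phi>. So the
  derivatives of the states, which converge in L^1 without a common essential bound, have to be
  treated in \<phi> alone. The bound on the controls turns their L^1 convergence into bounded
  convergence almost everywhere along a subsequence. Differentiability is studied through slopes
  over intervals that contain the point in their interior: Vitali's theorem then applies directly to
  the sets of exceptional points, and continuity recovers the one-sided difference
  quotients.\<close>

lemma abs_cont_onD:
  assumes "abs_cont_on a b f" and "e > 0"
  shows "\<exists>d>0. \<forall>D. D division_of \<Union>D \<longrightarrow> \<Union>D \<subseteq> {a..b} \<longrightarrow> (\<Sum>K\<in>D. Sup K - Inf K) < d \<longrightarrow>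
           (\<Sum>K\<in>D. norm (f (Sup K) - f (Inf K))) < e"
  using assms(1)[unfolded abs_cont_on_def imp_conjL, THEN spec, THEN mp, OF assms(2)] .

lemma division_of_Sup_Inf:
  fixes D :: "real set set"
  assumes "D division_of S" and "K \<in> D"
  shows "K = {Inf K..Sup K}" and "Inf K \<le> Sup K"
proof -
  obtain p q where "K = cbox p q" "K \<noteq> {}"
    using division_ofD(3,4)[OF assms] by blast
  then have "K = {p..q}" "p \<le> q"
    by auto
  then show "K = {Inf K..Sup K}" and "Inf K \<le> Sup K"
    by auto
qed

lemma abs_cont_on_bounded_linear:
  assumes f: "abs_cont_on a b f" and h: "bounded_linear h"
  shows "abs_cont_on a b (\<lambda>t. h (f t))"
  unfolding abs_cont_on_def
proof (intro allI impI)
  fix e :: real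
  assume "e > 0"
  obtain B where B: "B > 0" "\<And>x. norm (h x) \<le> norm x * B"
    using bounded_linear.pos_bounded[OF h] by blast
  have eB: "e / B > 0"
    using \<open>e > 0\<close> B by simp
  obtain d where d0: "d > 0"
    and d: "\<forall>D. D division_of \<Union>D \<longrightarrow> \<Union>D \<subseteq> {a..b} \<longrightarrow> (\<Sum>K\<in>D. Sup K - Inf K) < d \<longrightarrow>
       (\<Sum>K\<in>D. norm (f (Sup K) - f (Inf K))) < e / B"
    using abs_cont_onD[OF f eB] by blast
  have "(\<Sum>K\<in>D. norm (h (f (Sup K)) - h (f (Inf K)))) < e"
    if D: "D division_of \<Union>D" "\<Union>D \<subseteq> {a..b}" "(\<Sum>K\<in>D. Sup K - Inf K) < d" for D
  proof -
    have "(\<Sum>K\<in>D. norm (h (f (Sup K)) - h (f (Inf K)))) \<le> (\<Sum>K\<in>D. norm (f (Sup K) - f (Inf K)) * B)"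
      by (intro sum_mono) (metis B(2) bounded_linear.linear h linear_diff)
    also have "\<dots> = (\<Sum>K\<in>D. norm (f (Sup K) - f (Inf K))) * B"
      by (rule sum_distrib_right[symmetric])
    also have "\<dots> < e"
      using d[rule_format, OF D] B(1) by (simp only: pos_less_divide_eq)
    finally show ?thesis .
  qed
  with d0 show "\<exists>d>0. \<forall>D. D division_of \<Union>D \<and> \<Union>D \<subseteq> {a..b} \<and> (\<Sum>K\<in>D. Sup K - Inf K) < d \<longrightarrow>
        (\<Sum>K\<in>D. norm (h (f (Sup K)) - h (f (Inf K)))) < e"
    by blast
qed

lemma abs_cont_on_add:
  assumes f: "abs_cont_on a b f" and g: "abs_cont_on a b g"
  shows "abs_cont_on a b (\<lambda>t. f t + g t)"
  unfolding abs_cont_on_def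
proof (intro allI impI)
  fix e :: real
  assume "e > 0"
  then have e2: "e / 2 > 0"
    by simp
  obtain d where d0: "d > 0"
    and d: "\<forall>D. D division_of \<Union>D \<longrightarrow> \<Union>D \<subseteq> {a..b} \<longrightarrow> (\<Sum>K\<in>D. Sup K - Inf K) < d \<longrightarrow>
       (\<Sum>K\<in>D. norm (f (Sup K) - f (Inf K))) < e / 2"
    using abs_cont_onD[OF f e2] by blast
  obtain d' where d'0: "d' > 0"
    and d': "\<forall>D. D division_of \<Union>D \<longrightarrow> \<Union>D \<subseteq> {a..b} \<longrightarrow> (\<Sum>K\<in>D. Sup K - Inf K) < d' \<longrightarrow>
       (\<Sum>K\<in>D. norm (g (Sup K) - g (Inf K))) < e / 2"
    using abs_cont_onD[OF g e2] by blast
  have "(\<Sum>K\<in>D. norm (f (Sup K) + g (Sup K) - (f (Inf K) + g (Inf K)))) < e"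
    if D: "D division_of \<Union>D" "\<Union>D \<subseteq> {a..b}" "(\<Sum>K\<in>D. Sup K - Inf K) < min d d'" for D
  proof -
    have "(\<Sum>K\<in>D. norm (f (Sup K) + g (Sup K) - (f (Inf K) + g (Inf K))))
        \<le> (\<Sum>K\<in>D. norm (f (Sup K) - f (Inf K)) + norm (g (Sup K) - g (Inf K)))"
      by (intro sum_mono) (metis add_diff_add norm_triangle_ineq)
    also have "\<dots> < e"
      using d[rule_format, of D] d'[rule_format, of D] D by (simp add: sum.distrib)
    finally show ?thesis .
  qed
  then show "\<exists>d>0. \<forall>D. D division_of \<Union>D \<and> \<Union>D \<subseteq> {a..b} \<and> (\<Sum>K\<in>D. Sup K - Inf K) < d \<longrightarrow>
        (\<Sum>K\<in>D. norm (f (Sup K) + g (Sup K) - (f (Inf K) + g (Inf K)))) < e"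
    using d0 d'0 by (intro exI[of _ "min d d'"]) auto
qed

text \<open>Serves to tilt a function: adding a multiple of the identity shifts all slopes by a
  constant.\<close>

lemma abs_cont_on_ident: "abs_cont_on a b (\<lambda>t. t)"
  unfolding abs_cont_on_def
proof (intro allI impI)
  fix e :: real
  assume "e > 0"
  have "(\<Sum>K\<in>D. norm (Sup K - Inf K)) < e"
    if D: "D division_of \<Union>D" "(\<Sum>K\<in>D. Sup K - Inf K) < e" for D :: "real set set"
  proof -
    have "(\<Sum>K\<in>D. norm (Sup K - Inf K)) = (\<Sum>K\<in>D. Sup K - Inf K)"
      by (intro sum.cong) (use division_of_Sup_Inf[OF D(1)] in auto)
    with D(2) show ?thesis
      by simp
  qed
  with \<open>e > 0\<close> show "\<exists>d>0. \<forall>D. D division_of \<Union>D \<and> \<Union>D \<subseteq> {a..b} \<and> (\<Sum>K\<in>D. Sup K - Inf K) < d \<longrightarrow>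
        (\<Sum>K\<in>D. norm (Sup K - Inf K)) < e"
    by blast
qed

lemma abs_cont_on_imp_continuous_on:
  assumes f: "abs_cont_on a b f"
  shows "continuous_on {a..b} f"
  unfolding continuous_on_iff
proof (intro ballI allI impI)
  fix s e :: real
  assume s: "s \<in> {a..b}" and "e > 0"
  obtain d where d0: "d > 0"
    and d: "\<forall>D. D division_of \<Union>D \<longrightarrow> \<Union>D \<subseteq> {a..b} \<longrightarrow> (\<Sum>K\<in>D. Sup K - Inf K) < d \<longrightarrow>
       (\<Sum>K\<in>D. norm (f (Sup K) - f (Inf K))) < e"
    using abs_cont_onD[OF f \<open>e > 0\<close>] by blast
  have near: "norm (f q - f p) < e" if "p \<le> q" "q - p < d" "a \<le> p" "q \<le> b" for p q
  proof -
    have "{{p..q}} division_of \<Union>{{p..q}}"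
      using division_of_self[of p q] that by auto
    then show ?thesis
      using d[rule_format, of "{{p..q}}"] that by auto
  qed
  have "dist (f t) (f s) < e" if "t \<in> {a..b}" "dist t s < d" for t
    using near[of s t] near[of t s] that s
    by (cases "s \<le> t") (auto simp: dist_norm norm_minus_commute)
  with d0 show "\<exists>d>0. \<forall>t\<in>{a..b}. dist t s < d \<longrightarrow> dist (f t) (f s) < e"
    by blast
qed

section \<open>Sums over divisions\<close>

text \<open>Telescoping: increments between end points are additive when an interval is cut, which
  is the notion of an operative set function.\<close>

lemma additive_division_1:
  fixes f :: "real \<Rightarrow> 'a::real_normed_vector"
  assumes "a \<le> b" and "D division_of {a..b}"
  shows "(\<Sum>K\<in>D. f (Sup K) - f (Inf K)) = f b - f a"
proof -
  \<comment> \<open>An operative function is zero on boxes with empty interior. The end points of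
    the empty set are unspecified, so this case is set to 0 by hand.\<close>
  let ?f = "(\<lambda>K::real set. if K = {} then 0 else f(interval_upperbound K) - f(interval_lowerbound K))"
  interpret operative_real plus 0 ?f
    rewrites "comm_monoid_set.F (+) 0 = sum"
    by standard[1] (auto simp add: sum_def)
  have "(\<Sum>K\<in>D. ?f K) = ?f (cbox a b)"
    using division[of D a b] assms(2) by simp
  moreover have "(\<Sum>K\<in>D. ?f K) = (\<Sum>K\<in>D. f (Sup K) - f (Inf K))"
  proof (rule sum.cong[OF refl])
    fix K assume "K \<in> D"
    from division_of_Sup_Inf[OF assms(2) this] obtain p q where "K = {p..q}" "p \<le> q"
      by metis
    then show "?f K = f (Sup K) - f (Inf K)"
      by auto
  qed
  ultimately show ?thesis
    using assms(1) by simp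
qed

lemma sum_length_division:
  assumes "D division_of S"
  shows "(\<Sum>K\<in>D. Sup K - Inf K) = measure lebesgue (S :: real set)"
proof -
  have "measure lebesgue K = Sup K - Inf K" if "K \<in> D" for K
    using division_of_Sup_Inf[OF assms that] by (metis content_real measure_completion borel_closed closed_real_atLeastAtMost sets_lborel)
  then show ?thesis
    unfolding content_division[OF assms, symmetric] by simp
qed

text \<open>Bridge from Vitali families, which are disjoint, to the divisions in which absolute
  continuity is phrased.\<close>

lemma division_of_disjoint_intervals:
  fixes D :: "real set set"
  assumes "finite D" and "\<And>K. K \<in> D \<Longrightarrow> \<exists>p q. p \<le> q \<and> K = {p..q}" and "pairwise disjnt D"
  shows "D division_of \<Union>D"
proof (rule division_ofI)
  fix K assume K: "K \<in> D"
  then obtain p q where pq: "p \<le> q" "K = {p..q}"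
    using assms(2) by blast
  then show "K \<noteq> {}" "\<exists>a b. K = cbox a b"
    by (auto intro!: exI[of _ p] exI[of _ q])
  fix L assume L: "L \<in> D" "K \<noteq> L"
  then have "K \<inter> L = {}"
    using assms(3) K by (auto simp: pairwise_def disjnt_def)
  then show "interior K \<inter> interior L = {}"
    using interior_subset by blast
qed (use assms in auto)

lemma sum_length_disjoint:
  fixes D :: "real set set"
  assumes "finite D" and "\<And>K. K \<in> D \<Longrightarrow> \<exists>p q. p \<le> q \<and> K = {p..q}" and "pairwise disjnt D"
  shows "(\<Sum>K\<in>D. Sup K - Inf K) = measure lebesgue (\<Union>D)"
  by (rule sum_length_division[OF division_of_disjoint_intervals[OF assms]])

section \<open>Vitali coverings and Lebesgue's differentiation theorem\<close>

text \<open>Vitali's theorem covers \<open>E\<close> up to a null set by countably many disjoint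
  intervals. Since \<open>E\<close> has finite measure, the parts not covered by the first
  \<open>n\<close> of them decrease to measure zero, so finitely many suffice for the error
  \<open>e\<close>.\<close>

lemma Vitali_finite:
  fixes E U :: "real set"
  assumes E: "E \<in> lmeasurable" and U: "open U" "E \<subseteq> U" and "e > 0"
    and cover: "\<And>x d. x \<in> E \<Longrightarrow> d > 0 \<Longrightarrow> \<exists>p q. p < x \<and> x < q \<and> q - p < d \<and> Q p q"
  obtains D where "finite D" "\<And>K. K \<in> D \<Longrightarrow> \<exists>p q. p < q \<and> K = {p..q} \<and> K \<subseteq> U \<and> Q p q"
    "pairwise disjnt D" "measure lebesgue (E - \<Union>D) < e"
proof -
  define I where "I = {(p, q). p < q \<and> {p..q} \<subseteq> U \<and> Q p q}"
  \<comment> \<open>The covering theorem speaks of balls: an interval, indexed by its pair of end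
    points, is the ball about its midpoint whose radius is half its length.\<close>
  define m where "m = (\<lambda>(p::real, q::real). (p + q) / 2)"
  define r where "r = (\<lambda>(p::real, q::real). (q - p) / 2)"
  have cb: "cball (m i) (r i) = {fst i..snd i}" for i
    by (cases i) (auto simp: m_def r_def cball_eq_atLeastAtMost field_simps)
  have rpos: "0 < r i" if "i \<in> I" for i
    using that by (auto simp: I_def r_def)
  have cov: "\<exists>i. i \<in> I \<and> x \<in> cball (m i) (r i) \<and> r i < d" if x: "x \<in> E" and d: "0 < d" for x d
  proof -
    obtain \<rho> where \<rho>: "\<rho> > 0" "ball x \<rho> \<subseteq> U"
      using U x by (meson openE subsetD)
    obtain p q where pq: "p < x" "x < q" "q - p < min d \<rho>" "Q p q"
      using cover[OF x, of "min d \<rho>"] d \<rho> by auto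
    have "{p..q} \<subseteq> ball x \<rho>"
      using pq by (auto simp: ball_def dist_real_def)
    then have "(p, q) \<in> I"
      using pq \<rho> by (auto simp: I_def)
    moreover have "x \<in> cball (m (p, q)) (r (p, q))"
      unfolding cb using pq by auto
    moreover have "r (p, q) < d"
      using pq by (auto simp: r_def)
    ultimately show ?thesis
      by blast
  qed
  obtain C where C: "countable C" "C \<subseteq> I"
     "pairwise (\<lambda>i j. disjnt (cball (m i) (r i)) (cball (m j) (r j))) C"
     "negligible (E - (\<Union>i \<in> C. cball (m i) (r i)))"
    using Vitali_covering_theorem_cballs[of I r E m, OF rpos cov] by blast
  define A where "A n = E - (\<Union>i \<in> C \<inter> {i. to_nat_on C i < n}. {fst i..snd i})" for n
  have fin: "finite (C \<inter> {i. to_nat_on C i < n})" for n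
    by (rule finite_imageD[where f = "to_nat_on C"])
       (use C(1) in \<open>auto intro: finite_subset[of _ "{..<n}"] inj_on_subset[OF inj_on_to_nat_on]\<close>)
  have Am: "A n \<in> lmeasurable" for n
    unfolding A_def using E fin[of n] by (intro fmeasurable.Diff fmeasurable.finite_UN) auto
  have "(\<lambda>n. measure lebesgue (A n)) \<longlonglongrightarrow> measure lebesgue (\<Inter>n. A n)"
  proof (rule Lim_measure_decseq)
    show "decseq A"
      unfolding A_def decseq_def by auto
    show "emeasure lebesgue (A i) \<noteq> \<infinity>" for i
      using Am[of i] by (metis fmeasurableD2 infinity_ennreal_def)
    show "range A \<subseteq> sets lebesgue"
      using Am by auto
  qed
  moreover have "(\<Inter>n. A n) = E - (\<Union>i \<in> C. cball (m i) (r i))"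
    unfolding A_def cb by auto
  then have "measure lebesgue (\<Inter>n. A n) = 0"
    using C(4) negligible_imp_measure0 by metis
  ultimately have "eventually (\<lambda>n. measure lebesgue (A n) < e) sequentially"
    using \<open>e > 0\<close> order_tendstoD(2) by metis
  then obtain n where n: "measure lebesgue (A n) < e"
    by (auto simp: eventually_sequentially)
  define D where "D = (\<lambda>i. {fst i..snd i}) ` (C \<inter> {i. to_nat_on C i < n})"
  show thesis
  proof (rule that)
    show "finite D"
      unfolding D_def by (rule finite_imageI[OF fin])
    show "\<exists>p q. p < q \<and> K = {p..q} \<and> K \<subseteq> U \<and> Q p q" if K: "K \<in> D" for K
    proof -
      obtain i where i: "i \<in> C" "K = {fst i..snd i}"
        using K unfolding D_def by blast
      with C(2) have "i \<in> I"
        by blast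
      with i(2) show ?thesis
        unfolding I_def by (intro exI[of _ "fst i"] exI[of _ "snd i"]) auto
    qed
    show "pairwise disjnt D"
    proof (rule pairwiseI)
      fix K L assume KL: "K \<in> D" "L \<in> D" "K \<noteq> L"
      then obtain i j where ij: "i \<in> C" "j \<in> C" "K = {fst i..snd i}" "L = {fst j..snd j}"
        unfolding D_def by blast
      with KL(3) have "i \<noteq> j"
        by blast
      with pairwiseD[OF C(3) ij(1,2)] show "disjnt K L"
        unfolding cb ij(3,4) by simp
    qed
    show "measure lebesgue (E - \<Union>D) < e"
      using n by (simp add: A_def D_def)
  qed
qed

text \<open>The point is required to be interior to the intervals: this makes the set a \<open>G\<^sub>\<delta>\<close>, hence
  measurable, whatever \<open>Q\<close> is.\<close>

definition in_short_intervals :: "real \<Rightarrow> real \<Rightarrow> (real \<Rightarrow> real \<Rightarrow> bool) \<Rightarrow> real set" where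
  "in_short_intervals a b Q = {x. \<forall>d>0. \<exists>p q. a \<le> p \<and> p < x \<and> x < q \<and> q \<le> b \<and> q - p < d \<and> Q p q}"

lemma in_short_intervals_subset: "in_short_intervals a b Q \<subseteq> {a<..<b}"
proof
  fix x assume "x \<in> in_short_intervals a b Q"
  then obtain p q where "a \<le> p" "p < x" "x < q" "q \<le> b"
    unfolding in_short_intervals_def using zero_less_one by blast
  then show "x \<in> {a<..<b}"
    by simp
qed

lemma borel_in_short_intervals: "in_short_intervals a b Q \<in> sets borel"
proof -
  have "in_short_intervals a b Q = (\<Inter>n. \<Union>p. \<Union>q. {x. p < x \<and> x < q \<and> a \<le> p \<and> q \<le> b \<and> q - p < inverse (real (Suc n)) \<and> Q p q})"
    (is "_ = (\<Inter>n. ?U n)")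
  proof (intro set_eqI iffI)
    fix x assume x: "x \<in> in_short_intervals a b Q"
    show "x \<in> (\<Inter>n. ?U n)"
    proof
      fix n
      have "inverse (real (Suc n)) > 0"
        by simp
      with x show "x \<in> ?U n"
        unfolding in_short_intervals_def by blast
    qed
  next
    fix x assume x: "x \<in> (\<Inter>n. ?U n)"
    show "x \<in> in_short_intervals a b Q"
      unfolding in_short_intervals_def
    proof (intro CollectI allI impI)
      fix d :: real assume "d > 0"
      then obtain n where n: "inverse (real (Suc n)) < d"
        using reals_Archimedean by blast
      from x obtain p q where "p < x" "x < q" "a \<le> p" "q \<le> b" "q - p < inverse (real (Suc n))" "Q p q"
        by blast
      with n show "\<exists>p q. a \<le> p \<and> p < x \<and> x < q \<and> q \<le> b \<and> q - p < d \<and> Q p q"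
        by (meson less_trans)
    qed
  qed
  moreover have "open (?U n)" for n
  proof (intro open_UN ballI)
    fix p q
    have "{x. p < x \<and> x < q \<and> a \<le> p \<and> q \<le> b \<and> q - p < inverse (real (Suc n)) \<and> Q p q} =
      (if a \<le> p \<and> q \<le> b \<and> q - p < inverse (real (Suc n)) \<and> Q p q then {p<..<q} else {})"
      by auto
    then show "open {x. p < x \<and> x < q \<and> a \<le> p \<and> q \<le> b \<and> q - p < inverse (real (Suc n)) \<and> Q p q}"
      by simp
  qed
  ultimately show ?thesis
    by (simp only:) (intro sets.countable_INT, auto intro: borel_open)
qed

lemma in_short_intervals_lmeasurable:
  assumes "S \<in> sets borel"
  shows "in_short_intervals a b Q \<inter> S \<in> lmeasurable"
proof (rule bounded_set_imp_lmeasurable)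
  show "bounded (in_short_intervals a b Q \<inter> S)"
    by (rule bounded_subset[OF bounded_closed_interval[of a b]]) (use in_short_intervals_subset[of a b Q] in auto)
  show "in_short_intervals a b Q \<inter> S \<in> sets lebesgue"
    using borel_in_short_intervals[of a b Q] assms by (metis sets.Int sets_completionI_sets sets_lborel)
qed

text \<open>As the point lies inside the interval, a short interval stays in any prescribed
  neighbourhood. This permits a second covering within the intervals of a first one.\<close>

lemma in_short_intervalsE:
  assumes x: "x \<in> in_short_intervals a b Q" and V: "open V" "x \<in> V" and "d > 0"
  shows "\<exists>p q. p < x \<and> x < q \<and> q - p < d \<and> {p..q} \<subseteq> V \<inter> {a..b} \<and> Q p q"
proof -
  obtain r where r: "r > 0" "ball x r \<subseteq> V"
    using V by (meson openE)
  then obtain p q where pq: "a \<le> p" "p < x" "x < q" "q \<le> b" "q - p < min d r" "Q p q"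
    using x \<open>d > 0\<close> unfolding in_short_intervals_def by (smt (verit) mem_Collect_eq)
  then have "{p..q} \<subseteq> ball x r"
    by (auto simp: ball_def dist_real_def)
  with pq r show ?thesis
    by (intro exI[of _ p] exI[of _ q]) auto
qed

text \<open>
  If the set had measure \<open>s > 0\<close>, it could be covered up to a small error by disjoint intervals of slope
  less than \<open>-h\<close>, and again inside these by disjoint intervals of slope greater than \<open>h\<close>.  The pieces
  that remain of the former intervals have small total length, but \<open>f\<close> varies on them by more than \<open>h s\<close>.
\<close>

lemma abs_cont_opposite_slopes_negligible:
  fixes f :: "real \<Rightarrow> real"
  assumes f: "abs_cont_on a b f" and "h > 0"
  shows "negligible (in_short_intervals a b (\<lambda>p q. f q - f p < - h * (q - p))
           \<inter> in_short_intervals a b (\<lambda>p q. f q - f p > h * (q - p)))" (is "negligible (?A \<inter> ?B)")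
proof (rule ccontr)
  assume neg: "\<not> negligible (?A \<inter> ?B)"
  define E where "E = ?A \<inter> ?B"
  have E: "E \<in> lmeasurable"
    unfolding E_def by (rule in_short_intervals_lmeasurable[OF borel_in_short_intervals])
  define s where "s = measure lebesgue E"
  have s: "s > 0"
    using neg E negligible_iff_measure0[OF E] unfolding s_def E_def by (simp add: zero_less_measure_iff)
  with \<open>h > 0\<close> have "h * s > 0"
    by simp
  then obtain d where d0: "d > 0"
    and d: "\<forall>D. D division_of \<Union>D \<longrightarrow> \<Union>D \<subseteq> {a..b} \<longrightarrow> (\<Sum>K\<in>D. Sup K - Inf K) < d \<longrightarrow>
       (\<Sum>K\<in>D. norm (f (Sup K) - f (Inf K))) < h * s"
    using abs_cont_onD[OF f] by blast
  \<comment> \<open>The pieces of \<open>D1\<close> outside \<open>D2\<close> will have total length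
    below (s + e) - (s - 2 e) = 3 e < d, so absolute continuity applies to them, and
    \<open>e\<close> is small enough for h (s - e) + h (s - 2 e) to be at least h s.\<close>
  define e where "e = min (d / 4) (s / 4)"
  have e: "e > 0" "3 * e < d" "4 * e \<le> s"
    using d0 s by (auto simp: e_def)
  obtain U0 where U0: "open U0" "E \<subseteq> U0" "U0 - E \<in> lmeasurable" "emeasure lebesgue (U0 - E) < ennreal e"
    using sets_lebesgue_outer_open[OF fmeasurableD[OF E] e(1)] by blast
  define U where "U = U0 \<inter> {a<..<b}"
  have U: "open U" "E \<subseteq> U" "U \<in> lmeasurable"
    using U0 in_short_intervals_subset[of a b] by (auto simp: U_def E_def intro!: bounded_set_imp_lmeasurable)
  have Us: "measure lebesgue U < s + e"
  proof -
    have "measure lebesgue (U0 - E) < e"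
      using U0(3,4) e(1) by (simp add: emeasure_eq_measure2 ennreal_less_iff)
    moreover have "measure lebesgue (U - E) \<le> measure lebesgue (U0 - E)"
      by (rule measure_mono_fmeasurable) (use U U0 E in \<open>auto simp: U_def\<close>)
    moreover have "measure lebesgue (U - E) = measure lebesgue U - s"
      unfolding s_def by (rule measurable_measure_Diff) (use U E in auto)
    ultimately show ?thesis
      by simp
  qed
  obtain D1 where D1: "finite D1"
    "\<And>K. K \<in> D1 \<Longrightarrow> \<exists>p q. p < q \<and> K = {p..q} \<and> K \<subseteq> U \<and> f q - f p < - h * (q - p)"
    "pairwise disjnt D1" "measure lebesgue (E - \<Union>D1) < e"
  proof (rule Vitali_finite[OF E U(1,2) e(1), where Q = "\<lambda>p q. f q - f p < - h * (q - p)"])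
    fix x d :: real assume "x \<in> E" "d > 0"
    then show "\<exists>p q. p < x \<and> x < q \<and> q - p < d \<and> f q - f p < - h * (q - p)"
      using in_short_intervalsE[OF _ open_UNIV UNIV_I, of x a b] unfolding E_def by blast
  qed blast
  have D1I: "\<exists>p q. p \<le> q \<and> K = {p..q}" if "K \<in> D1" for K
    using D1(2)[OF that] less_imp_le by blast
  \<comment> \<open>Only interiors are kept: the second covering then takes place in an open set,
    and each of its intervals can be chosen within one interval of \<open>D1\<close>. The end points
    lost are finitely many.\<close>
  define U' where "U' = (\<Union>K\<in>D1. interior K)"
  have U': "open U'"
    unfolding U'_def by blast
  define E' where "E' = E \<inter> U'"
  have E': "E' \<in> lmeasurable"
    unfolding E'_def using E U' by (simp add: fmeasurable_Int_fmeasurable borel_open)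
  have D1m: "\<Union>D1 \<in> lmeasurable"
    by (rule fmeasurable.finite_Union[OF D1(1)]) (use D1I in fastforce)
  have D1s: "(\<Sum>K\<in>D1. Sup K - Inf K) = measure lebesgue (\<Union>D1)"
    by (rule sum_length_disjoint[OF D1(1) D1I D1(3)])
  have E'_s: "measure lebesgue E' \<ge> s - e"
  proof -
    define F where "F = Inf ` D1 \<union> Sup ` D1"
    have "E \<subseteq> E' \<union> (E - \<Union>D1) \<union> F"
    proof
      fix x assume x: "x \<in> E"
      show "x \<in> E' \<union> (E - \<Union>D1) \<union> F"
      proof (cases "x \<in> \<Union>D1")
        case True
        then obtain K where K: "K \<in> D1" "x \<in> K"
          by blast
        obtain p q where pq: "p < q" "K = {p..q}"
          using D1(2)[OF K(1)] by blast
        then have "p = Inf K" "q = Sup K"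
          by auto
        then have "p \<in> F" "q \<in> F"
          using K(1) by (auto simp: F_def)
        moreover have "interior K \<subseteq> U'" "interior K = {p<..<q}"
          using K(1) pq by (auto simp: U'_def)
        moreover have "x = p \<or> x = q \<or> x \<in> {p<..<q}"
          using K(2) pq by auto
        ultimately show ?thesis
          using x unfolding E'_def by blast
      qed (use x in blast)
    qed
    moreover have Fn: "F \<in> null_sets lebesgue"
      using D1(1) by (simp add: F_def negligible_iff_null_sets[symmetric] negligible_finite)
    ultimately have "s \<le> measure lebesgue (E' \<union> (E - \<Union>D1) \<union> F)"
      unfolding s_def using E E' D1m
      by (intro measure_mono_fmeasurable fmeasurable.Un fmeasurable.Diff) (auto intro: fmeasurableI_null_sets)
    also have "\<dots> \<le> measure lebesgue (E' \<union> (E - \<Union>D1)) + measure lebesgue F"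
      using E E' D1m Fn by (intro measure_Un_le) auto
    also have "measure lebesgue (E' \<union> (E - \<Union>D1)) \<le> measure lebesgue E' + measure lebesgue (E - \<Union>D1)"
      using E E' D1m by (intro measure_Un_le) auto
    also have "measure lebesgue F = 0"
      using Fn by (simp add: measure_eq_0_null_sets)
    finally show ?thesis
      using D1(4) by simp
  qed
  obtain D2 where D2: "finite D2"
    "\<And>J. J \<in> D2 \<Longrightarrow> \<exists>p q. p < q \<and> J = {p..q} \<and> J \<subseteq> U' \<and> f q - f p > h * (q - p) \<and> (\<exists>K\<in>D1. {p..q} \<subseteq> K)"
    "pairwise disjnt D2" "measure lebesgue (E' - \<Union>D2) < e"
  proof (rule Vitali_finite[OF E' U' _ e(1), where Q = "\<lambda>p q. f q - f p > h * (q - p) \<and> (\<exists>K\<in>D1. {p..q} \<subseteq> K)"])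
    show "E' \<subseteq> U'"
      by (simp add: E'_def)
    fix x d :: real assume x: "x \<in> E'" and d: "d > 0"
    then obtain K where K: "K \<in> D1" "x \<in> interior K"
      by (auto simp: E'_def U'_def)
    have "x \<in> ?B"
      using x by (auto simp: E'_def E_def)
    from in_short_intervalsE[OF this open_interior K(2) d] obtain p q where
      "p < x" "x < q" "q - p < d" "{p..q} \<subseteq> interior K \<inter> {a..b}" "f q - f p > h * (q - p)"
      by blast
    then show "\<exists>p q. p < x \<and> x < q \<and> q - p < d \<and> f q - f p > h * (q - p) \<and> (\<exists>K\<in>D1. {p..q} \<subseteq> K)"
      using K(1) interior_subset[of K] by blast
  qed blast
  have D2I: "\<exists>p q. p \<le> q \<and> J = {p..q}" if "J \<in> D2" for J
    using D2(2)[OF that] less_imp_le by blast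
  have D2m: "\<Union>D2 \<in> lmeasurable"
    by (rule fmeasurable.finite_Union[OF D2(1)]) (use D2I in fastforce)
  have D2s: "(\<Sum>K\<in>D2. Sup K - Inf K) = measure lebesgue (\<Union>D2)"
    by (rule sum_length_disjoint[OF D2(1) D2I D2(3)])
  define J where "J K = {J \<in> D2. J \<subseteq> K}" for K
  \<comment> \<open>The intervals of \<open>D2\<close> inside \<open>K\<close> are completed to a
    division of \<open>K\<close>. The added intervals, collected in \<open>LL\<close>, are the gaps
    on which the variation turns out to be large.\<close>
  have "\<exists>q. J K \<subseteq> q \<and> q division_of K" if K: "K \<in> D1" for K
  proof -
    obtain p q where pq: "K = {p..q}"
      using D1I[OF K] by blast
    have "J K division_of \<Union>(J K)"
      using D2(1,3) D2I by (intro division_of_disjoint_intervals) (auto simp: J_def pairwise_def)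
    moreover have "\<Union>(J K) \<subseteq> cbox p q"
      using pq by (auto simp: J_def)
    ultimately show ?thesis
      using partial_division_extend_interval unfolding pq box_real(2)[symmetric] by metis
  qed
  then obtain q where q: "\<And>K. K \<in> D1 \<Longrightarrow> J K \<subseteq> q K" "\<And>K. K \<in> D1 \<Longrightarrow> q K division_of K"
    by metis
  define L where "L K = q K - J K" for K
  define LL where "LL = (\<Union>K\<in>D1. L K)"
  have disj: "M = N" if "M \<in> D1" "N \<in> D1" "K \<subseteq> M" "K \<subseteq> N" "K \<noteq> {}" for K M N
    using pairwiseD[OF D1(3) that(1,2)] that(3-5) unfolding disjnt_def by blast
  have finq: "finite (q K)" if "K \<in> D1" for K
    using q(2)[OF that] by blast
  have Lsub: "M \<subseteq> K" "M \<noteq> {}" if "K \<in> D1" "M \<in> L K" for K M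
    using division_ofD(2,3)[OF q(2)[OF that(1)]] that(2) by (auto simp: L_def)
  have Jsub: "M \<subseteq> K" "M \<noteq> {}" if "M \<in> J K" for K M
    using that D2I[of M] by (auto simp: J_def)
  \<comment> \<open>Stated for every \<open>g\<close>: the identity gives the total length of the
    gaps, and \<open>f\<close> gives its total increment over them.\<close>
  have sums: "(\<Sum>K\<in>LL. g (Sup K) - g (Inf K)) =
      (\<Sum>K\<in>D1. g (Sup K) - g (Inf K)) - (\<Sum>K\<in>D2. g (Sup K) - g (Inf K))" for g :: "real \<Rightarrow> real"
  proof -
    let ?g = "\<lambda>K. g (Sup K) - g (Inf K)"
    have "sum ?g LL = (\<Sum>K\<in>D1. sum ?g (L K))"
      unfolding LL_def
    proof (rule sum.UNION_disjoint[OF D1(1)])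
      show "\<forall>K\<in>D1. finite (L K)"
        using finq by (simp add: L_def)
      show "\<forall>K\<in>D1. \<forall>K'\<in>D1. K \<noteq> K' \<longrightarrow> L K \<inter> L K' = {}"
      proof (intro ballI impI equals0I)
        fix K K' M assume "K \<in> D1" "K' \<in> D1" "K \<noteq> K'" "M \<in> L K \<inter> L K'"
        then show False
          using disj[of K K' M] Lsub[of K M] Lsub[of K' M] by auto
      qed
    qed
    moreover have "sum ?g D2 = (\<Sum>K\<in>D1. sum ?g (J K))"
    proof -
      have "D2 = (\<Union>K\<in>D1. J K)"
        using D2(2) unfolding J_def by blast
      moreover have "sum ?g (\<Union>K\<in>D1. J K) = (\<Sum>K\<in>D1. sum ?g (J K))"
      proof (rule sum.UNION_disjoint[OF D1(1)])
        show "\<forall>K\<in>D1. finite (J K)"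
          using D2(1) by (simp add: J_def)
        show "\<forall>K\<in>D1. \<forall>K'\<in>D1. K \<noteq> K' \<longrightarrow> J K \<inter> J K' = {}"
        proof (intro ballI impI equals0I)
          fix K K' M assume "K \<in> D1" "K' \<in> D1" "K \<noteq> K'" "M \<in> J K \<inter> J K'"
          then show False
            using disj[of K K' M] Jsub[of M K] Jsub[of M K'] by auto
        qed
      qed
      ultimately show ?thesis
        by simp
    qed
    moreover have "(\<Sum>K\<in>D1. sum ?g (L K)) = (\<Sum>K\<in>D1. ?g K - sum ?g (J K))"
    proof (rule sum.cong[OF refl])
      fix K assume K: "K \<in> D1"
      obtain p r where pr: "p \<le> r" "K = {p..r}"
        using D1I[OF K] by blast
      have "sum ?g (q K) = ?g K"
        using additive_division_1[of p r "q K" g] q(2)[OF K] pr by simp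
      moreover have "sum ?g (q K) = sum ?g (L K) + sum ?g (J K)"
        unfolding L_def by (rule sum.subset_diff[OF q(1)[OF K] finq[OF K]])
      ultimately show "sum ?g (L K) = ?g K - sum ?g (J K)"
        by simp
    qed
    ultimately show ?thesis
      by (simp only: sum_subtractf[of ?g])
  qed
  have "LL division_of \<Union>LL"
  proof (rule division_ofI)
    show "finite LL"
      using D1(1) finq by (auto simp: LL_def L_def)
    fix M assume M: "M \<in> LL"
    then obtain K where K: "K \<in> D1" "M \<in> L K"
      by (auto simp: LL_def)
    have MK: "M \<in> q K"
      using K(2) by (simp add: L_def)
    show "M \<noteq> {}" "\<exists>a b. M = cbox a b"
      using division_ofD(3,4)[OF q(2)[OF K(1)] MK] by auto
    fix M' assume M': "M' \<in> LL" "M \<noteq> M'"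
    then obtain K' where K': "K' \<in> D1" "M' \<in> L K'"
      by (auto simp: LL_def)
    have MK': "M' \<in> q K'"
      using K'(2) by (simp add: L_def)
    show "interior M \<inter> interior M' = {}"
    proof (cases "K = K'")
      case True
      then show ?thesis
        using division_ofD(5)[OF q(2)[OF K(1)] MK] MK' M'(2) by blast
    next
      case False
      then have "K \<inter> K' = {}"
        using D1(3) K(1) K'(1) by (auto simp: pairwise_def disjnt_def)
      then show ?thesis
        using Lsub(1)[OF K] Lsub(1)[OF K'] interior_subset by blast
    qed
  qed auto
  moreover have "\<Union>LL \<subseteq> {a..b}"
  proof -
    have "K \<subseteq> {a..b}" if "K \<in> D1" for K
      using D1(2)[OF that] by (auto simp: U_def)
    then show ?thesis
      using Lsub(1) unfolding LL_def by blast
  qed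
  moreover have D2_ge: "measure lebesgue (\<Union>D2) \<ge> s - 2 * e"
  proof -
    have "measure lebesgue E' \<le> measure lebesgue ((E' - \<Union>D2) \<union> \<Union>D2)"
      using E' D2m by (intro measure_mono_fmeasurable) auto
    also have "\<dots> \<le> measure lebesgue (E' - \<Union>D2) + measure lebesgue (\<Union>D2)"
      using E' D2m by (intro measure_Un_le) auto
    finally show ?thesis
      using D2(4) E'_s by simp
  qed
  moreover have "measure lebesgue (\<Union>D1) \<le> measure lebesgue U"
    using D1(2) U(3) D1m by (intro measure_mono_fmeasurable) auto
  ultimately have "(\<Sum>K\<in>LL. norm (f (Sup K) - f (Inf K))) < h * s"
    using d[rule_format, of LL] sums[of "\<lambda>t. t"] D1s D2s Us e by simp
  \<comment> \<open>Over \<open>D1\<close> the function falls by at least h times the length of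
    \<open>D1\<close>, although inside it rises over \<open>D2\<close> by at least h times the
    length of \<open>D2\<close>. The gaps must make up for both, which forces a variation of at
    least h s there.\<close>
  moreover have "(\<Sum>K\<in>LL. norm (f (Sup K) - f (Inf K))) \<ge> - (\<Sum>K\<in>LL. f (Sup K) - f (Inf K))"
    unfolding sum_negf[symmetric] by (intro sum_mono) auto
  moreover have "(\<Sum>K\<in>D1. f (Sup K) - f (Inf K)) \<le> - h * (\<Sum>K\<in>D1. Sup K - Inf K)"
    unfolding sum_distrib_left
  proof (intro sum_mono)
    fix K assume "K \<in> D1"
    from D1(2)[OF this] show "f (Sup K) - f (Inf K) \<le> - h * (Sup K - Inf K)"
      by auto
  qed
  moreover have "(\<Sum>K\<in>D2. f (Sup K) - f (Inf K)) \<ge> h * (\<Sum>K\<in>D2. Sup K - Inf K)"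
    unfolding sum_distrib_left
  proof (intro sum_mono)
    fix K assume "K \<in> D2"
    from D2(2)[OF this] show "f (Sup K) - f (Inf K) \<ge> h * (Sup K - Inf K)"
      by auto
  qed
  moreover have "measure lebesgue (\<Union>D1) \<ge> s - e"
  proof -
    have "s \<le> measure lebesgue ((E - \<Union>D1) \<union> \<Union>D1)"
      unfolding s_def using E D1m by (intro measure_mono_fmeasurable) auto
    also have "\<dots> \<le> measure lebesgue (E - \<Union>D1) + measure lebesgue (\<Union>D1)"
      using E D1m by (intro measure_Un_le) auto
    finally show ?thesis
      using D1(4) by simp
  qed
  then have "h * (\<Sum>K\<in>D1. Sup K - Inf K) \<ge> h * (s - e)"
    using \<open>h > 0\<close> D1s by simp
  moreover have "h * (\<Sum>K\<in>D2. Sup K - Inf K) \<ge> h * (s - 2 * e)"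
    using \<open>h > 0\<close> D2s D2_ge by simp
  moreover have "h * (s - e) + h * (s - 2 * e) \<ge> h * s"
  proof -
    have "h * (s - 3 * e) \<ge> 0"
      using \<open>h > 0\<close> e by simp
    then show ?thesis
      by (simp add: algebra_simps)
  qed
  ultimately show False
    using sums[of f] by linarith
qed

text \<open>In a short window every disjoint family of intervals has total length below the
  \<open>d\<close> that belongs to the error 1. If the exceptional points there had measure
  \<open>s > 0\<close>, disjoint intervals of slope above \<open>n\<close> would cover at least half
  of them and give a variation of at least n s / 2, which exceeds 1 for large
  \<open>n\<close>.\<close>

lemma abs_cont_unbounded_slopes_negligible:
  fixes f :: "real \<Rightarrow> real"
  assumes f: "abs_cont_on a b f"
  shows "negligible (\<Inter>n::nat. in_short_intervals a b (\<lambda>p q. \<bar>f q - f p\<bar> > real n * (q - p)))"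
    (is "negligible ?E")
proof -
  obtain d where d0: "d > 0"
    and d: "\<forall>D. D division_of \<Union>D \<longrightarrow> \<Union>D \<subseteq> {a..b} \<longrightarrow> (\<Sum>K\<in>D. Sup K - Inf K) < d \<longrightarrow>
       (\<Sum>K\<in>D. norm (f (Sup K) - f (Inf K))) < 1"
    using abs_cont_onD[OF f zero_less_one] by blast
  \<comment> \<open>A window of length d / 2 keeps every disjoint family inside it below total
    length \<open>d\<close>.\<close>
  have "negligible (?E \<inter> {x - d/4<..<x + d/4})" for x
  proof (rule ccontr)
    define E where "E = ?E \<inter> {x - d/4<..<x + d/4}"
    assume neg: "\<not> negligible (?E \<inter> {x - d/4<..<x + d/4})"
    define U where "U = {x - d/4<..<x + d/4} \<inter> {a<..<b}"
    have E: "E \<in> lmeasurable"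
    proof -
      \<comment> \<open>The set for n = 0 is split off once more, to exhibit \<open>E\<close> in the
        form for which finite measure is known.\<close>
      have E_eq: "E = in_short_intervals a b (\<lambda>p q. \<bar>f q - f p\<bar> > real 0 * (q - p)) \<inter> (?E \<inter> {x - d/4<..<x + d/4})"
        unfolding E_def by blast
      have S: "?E \<inter> {x - d/4<..<x + d/4} \<in> sets borel"
        by (intro sets.Int sets.countable_INT) (auto intro: borel_in_short_intervals)
      show ?thesis
        by (subst E_eq) (rule in_short_intervals_lmeasurable[OF S])
    qed
    define s where "s = measure lebesgue E"
    have s: "s > 0"
      using neg E negligible_iff_measure0[OF E] unfolding s_def E_def by (simp add: zero_less_measure_iff)
    obtain n :: nat where n: "real n * (s / 2) > 1"
      using ex_less_of_nat_mult[of "s / 2" 1] s by auto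
    have "E \<subseteq> in_short_intervals a b (\<lambda>p q. \<bar>f q - f p\<bar> > real 0 * (q - p))"
      unfolding E_def by blast
    then have "E \<subseteq> {a<..<b}"
      using in_short_intervals_subset by (rule subset_trans)
    then have U: "open U" "E \<subseteq> U"
      by (auto simp: U_def E_def)
    obtain D where D: "finite D"
      "\<And>K. K \<in> D \<Longrightarrow> \<exists>p q. p < q \<and> K = {p..q} \<and> K \<subseteq> U \<and> \<bar>f q - f p\<bar> > real n * (q - p)"
      "pairwise disjnt D" "measure lebesgue (E - \<Union>D) < s / 2"
    proof (rule Vitali_finite[OF E U, where Q = "\<lambda>p q. \<bar>f q - f p\<bar> > real n * (q - p)" and e = "s / 2"])
      fix y d :: real assume y: "y \<in> E" and d: "d > 0"
      have "y \<in> in_short_intervals a b (\<lambda>p q. \<bar>f q - f p\<bar> > real n * (q - p))"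
        using y unfolding E_def by blast
      from in_short_intervalsE[OF this open_UNIV UNIV_I d]
      show "\<exists>p q. p < y \<and> y < q \<and> q - p < d \<and> \<bar>f q - f p\<bar> > real n * (q - p)"
        by blast
    qed (use s in auto)
    have DI: "\<exists>p q. p \<le> q \<and> K = {p..q}" if "K \<in> D" for K
      using D(2)[OF that] less_imp_le by blast
    have Dm: "\<Union>D \<in> lmeasurable"
      by (rule fmeasurable.finite_Union[OF D(1)]) (use DI in fastforce)
    have Ds: "(\<Sum>K\<in>D. Sup K - Inf K) = measure lebesgue (\<Union>D)"
      by (rule sum_length_disjoint[OF D(1) DI D(3)])
    have DU: "\<Union>D \<subseteq> U"
      using D(2) by blast
    have Dab: "\<Union>D \<subseteq> {a..b}"
      by (rule subset_trans[OF DU]) (auto simp: U_def)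
    have "measure lebesgue (\<Union>D) \<le> measure lebesgue {x - d/4<..<x + d/4}"
      using DU Dm by (intro measure_mono_fmeasurable) (auto simp: U_def)
    also have "\<dots> < d"
      using d0 by simp
    finally have "(\<Sum>K\<in>D. norm (f (Sup K) - f (Inf K))) < 1"
      using d[rule_format, of D] division_of_disjoint_intervals[OF D(1) DI D(3)] Ds Dab
      by simp
    moreover have "(\<Sum>K\<in>D. norm (f (Sup K) - f (Inf K))) \<ge> (\<Sum>K\<in>D. real n * (Sup K - Inf K))"
    proof (intro sum_mono)
      fix K assume "K \<in> D"
      from D(2)[OF this] show "real n * (Sup K - Inf K) \<le> norm (f (Sup K) - f (Inf K))"
        by auto
    qed
    moreover have "(\<Sum>K\<in>D. real n * (Sup K - Inf K)) = real n * measure lebesgue (\<Union>D)"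
      unfolding sum_distrib_left[symmetric] Ds ..
    moreover have "measure lebesgue (\<Union>D) \<ge> s / 2"
    proof -
      have "s \<le> measure lebesgue ((E - \<Union>D) \<union> \<Union>D)"
        unfolding s_def using E Dm by (intro measure_mono_fmeasurable) auto
      also have "\<dots> \<le> measure lebesgue (E - \<Union>D) + measure lebesgue (\<Union>D)"
        using E Dm by (intro measure_Un_le) auto
      finally show ?thesis
        using D(4) by simp
    qed
    then have "real n * measure lebesgue (\<Union>D) \<ge> real n * (s / 2)"
      by (rule mult_left_mono) simp
    ultimately show False
      using n by linarith
  qed
  then show ?thesis
    unfolding locally_negligible_alt[of ?E]
    by (intro ballI) (rule_tac x = "?E \<inter> {x - d/4<..<x + d/4}" in exI, use d0 in \<open>auto intro: openin_open_Int\<close>)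
qed

text \<open>Subtracting the linear function whose slope is the mean of \<alpha> and \<beta> makes
  the two slopes opposite.\<close>

lemma abs_cont_two_slopes_negligible:
  fixes f :: "real \<Rightarrow> real"
  assumes f: "abs_cont_on a b f" and "\<alpha> < \<beta>"
  shows "negligible (in_short_intervals a b (\<lambda>p q. f q - f p < \<alpha> * (q - p))
           \<inter> in_short_intervals a b (\<lambda>p q. f q - f p > \<beta> * (q - p)))"
proof -
  define m where "m = (\<alpha> + \<beta>) / 2"
  define h where "h = (\<beta> - \<alpha>) / 2"
  have mh: "\<alpha> = m - h" "\<beta> = m + h" "h > 0"
    using assms(2) by (auto simp: m_def h_def field_simps)
  have "abs_cont_on a b (\<lambda>t. f t + (- m) * t)"
    by (intro abs_cont_on_add[OF f] abs_cont_on_bounded_linear[OF abs_cont_on_ident] bounded_linear_mult_right)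
  from abs_cont_opposite_slopes_negligible[OF this mh(3)] show ?thesis
    unfolding mh(1,2) by (simp add: algebra_simps)
qed

text \<open>Outside \<open>N1\<close> the slopes over short intervals around \<open>x\<close> are
  bounded, and outside \<open>N2\<close> their upper and lower limits cannot be separated by two
  rationals, so they converge. Continuity then allows one end point of the interval to be moved to
  \<open>x\<close>.\<close>

lemma abs_cont_real_differentiable:
  fixes f :: "real \<Rightarrow> real"
  assumes f: "abs_cont_on a b f"
  shows "\<exists>N. negligible N \<and> (\<forall>x\<in>{a<..<b} - N. \<exists>L. (f has_real_derivative L) (at x))"
proof -
  define N1 where "N1 = (\<Inter>n::nat. in_short_intervals a b (\<lambda>p q. \<bar>f q - f p\<bar> > real n * (q - p)))"
  define N2 where "N2 = (\<Union>(\<alpha>, \<beta>)\<in>{(\<alpha>, \<beta>). \<alpha> \<in> \<rat> \<and> \<beta> \<in> \<rat> \<and> \<alpha> < \<beta>}.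
     in_short_intervals a b (\<lambda>p q. f q - f p < \<alpha> * (q - p)) \<inter> in_short_intervals a b (\<lambda>p q. f q - f p > \<beta> * (q - p)))"
  have "countable {(\<alpha>, \<beta>). \<alpha> \<in> (\<rat>::real set) \<and> \<beta> \<in> \<rat> \<and> \<alpha> < \<beta>}"
    by (rule countable_subset[of _ "\<rat> \<times> \<rat>"]) (auto intro: countable_rat)
  then have "negligible N2"
    unfolding N2_def using abs_cont_two_slopes_negligible[OF f]
    by (intro negligible_countable_Union) auto
  then have "negligible (N1 \<union> N2)"
    using abs_cont_unbounded_slopes_negligible[OF f] by (simp add: N1_def)
  moreover have "\<exists>L. (f has_real_derivative L) (at x)" if x: "x \<in> {a<..<b} - (N1 \<union> N2)" for x
  proof -
    have x1: "a < x" "x < b"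
      using x by auto
    have small: "\<exists>p q. a \<le> p \<and> p < x \<and> x < q \<and> q \<le> b \<and> q - p < d" if "d > 0" for d
      using x1 that by (intro exI[of _ "max a (x - d/3)"] exI[of _ "min b (x + d/3)"]) auto
    obtain n where "x \<notin> in_short_intervals a b (\<lambda>p q. \<bar>f q - f p\<bar> > real n * (q - p))"
      using x by (auto simp: N1_def)
    then obtain d1 where d1: "d1 > 0"
      "\<And>p q. a \<le> p \<Longrightarrow> p < x \<Longrightarrow> x < q \<Longrightarrow> q \<le> b \<Longrightarrow> q - p < d1 \<Longrightarrow> \<bar>f q - f p\<bar> \<le> real n * (q - p)"
      unfolding in_short_intervals_def by fastforce
    \<comment> \<open>The eventual upper bounds of the slopes. The infimum of \<open>A\<close> is
      the upper limit of the slopes and the candidate for the derivative.\<close>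
    define A where "A = {r. \<exists>d>0. \<forall>p q. a \<le> p \<longrightarrow> p < x \<longrightarrow> x < q \<longrightarrow> q \<le> b \<longrightarrow> q - p < d \<longrightarrow> f q - f p \<le> r * (q - p)}"
    have "real n \<in> A"
      unfolding A_def using d1 by (intro CollectI exI[of _ d1]) fastforce
    then have Ane: "A \<noteq> {}"
      by blast
    have Abd: "bdd_below A"
    proof (rule bdd_belowI)
      fix r assume "r \<in> A"
      then obtain d where d: "d > 0" "\<forall>p q. a \<le> p \<longrightarrow> p < x \<longrightarrow> x < q \<longrightarrow> q \<le> b \<longrightarrow> q - p < d \<longrightarrow> f q - f p \<le> r * (q - p)"
        unfolding A_def by blast
      obtain p q where pq: "a \<le> p" "p < x" "x < q" "q \<le> b" "q - p < min d d1"
        using small[of "min d d1"] d d1 by auto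
      then have "- real n * (q - p) \<le> r * (q - p)"
        using d(2)[rule_format, of p q] d1(2)[of p q] by auto
      then show "- real n \<le> r"
        by (rule mult_right_le_imp_le) (use pq in simp)
    qed
    define L where "L = Inf A"
    have two: "\<exists>d>0. \<forall>p q. a \<le> p \<longrightarrow> p < x \<longrightarrow> x < q \<longrightarrow> q \<le> b \<longrightarrow> q - p < d \<longrightarrow>
        \<bar>f q - f p - L * (q - p)\<bar> \<le> \<eta> * (q - p)" if \<eta>: "\<eta> > 0" for \<eta>
    proof -
      obtain r where r: "r \<in> A" "r < L + \<eta>"
        using cInf_lessD[OF Ane, of "L + \<eta>"] \<eta> by (auto simp: L_def)
      then obtain d where d: "d > 0" "\<forall>p q. a \<le> p \<longrightarrow> p < x \<longrightarrow> x < q \<longrightarrow> q \<le> b \<longrightarrow> q - p < d \<longrightarrow> f q - f p \<le> r * (q - p)"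
        unfolding A_def by blast
      \<comment> \<open>As \<beta> lies below the infimum of \<open>A\<close>, slopes above \<beta>
        occur over arbitrarily short intervals. Since \<open>x\<close> is not in \<open>N2\<close>,
        slopes below \<alpha> then do not, and \<alpha> > L - \<eta> becomes an eventual lower
        bound.\<close>
      obtain \<beta> where \<beta>: "\<beta> \<in> \<rat>" "L - \<eta> < \<beta>" "\<beta> < L"
        using Rats_dense_in_real[of "L - \<eta>" L] \<eta> by auto
      obtain \<alpha> where \<alpha>: "\<alpha> \<in> \<rat>" "L - \<eta> < \<alpha>" "\<alpha> < \<beta>"
        using Rats_dense_in_real[of "L - \<eta>" \<beta>] \<beta> by auto
      have "\<beta> \<notin> A"
        using cInf_lower[OF _ Abd, of \<beta>] \<beta> by (auto simp: L_def)
      then have "x \<in> in_short_intervals a b (\<lambda>p q. f q - f p > \<beta> * (q - p))"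
        unfolding A_def in_short_intervals_def by (smt (verit) mem_Collect_eq)
      moreover have "x \<notin> N2"
        using x by blast
      ultimately have "x \<notin> in_short_intervals a b (\<lambda>p q. f q - f p < \<alpha> * (q - p))"
        using \<alpha> \<beta> unfolding N2_def by blast
      then obtain d' where d': "d' > 0"
        "\<forall>p q. a \<le> p \<longrightarrow> p < x \<longrightarrow> x < q \<longrightarrow> q \<le> b \<longrightarrow> q - p < d' \<longrightarrow> \<alpha> * (q - p) \<le> f q - f p"
        unfolding in_short_intervals_def by (smt (verit) mem_Collect_eq)
      have "\<bar>f q - f p - L * (q - p)\<bar> \<le> \<eta> * (q - p)"
        if "a \<le> p" "p < x" "x < q" "q \<le> b" "q - p < min d d'" for p q
      proof -
        have "f q - f p \<le> r * (q - p)" "\<alpha> * (q - p) \<le> f q - f p"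
          using d(2)[rule_format, of p q] d'(2)[rule_format, of p q] that by auto
        moreover have "r * (q - p) \<le> (L + \<eta>) * (q - p)" "(L - \<eta>) * (q - p) \<le> \<alpha> * (q - p)"
          using r \<alpha> that by (auto intro!: mult_right_mono)
        ultimately show ?thesis
          by (simp add: abs_le_iff algebra_simps)
      qed
      with d(1) d'(1) show ?thesis
        by (intro exI[of _ "min d d'"]) auto
    qed
    have cont: "isCont f x"
      by (rule continuous_on_interior[OF abs_cont_on_imp_continuous_on[OF f]]) (use x1 in auto)
    then have lim: "(f \<longlongrightarrow> f x) (at x within S)" for S
      using continuous_at_imp_continuous_at_within[OF cont, of S] by (simp add: continuous_within)
    have "(f has_derivative (\<lambda>h. L * h)) (at x)"
      unfolding has_derivative_at_alt
    proof (intro conjI allI impI)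
      show "bounded_linear (\<lambda>h. L * h)"
        by (rule bounded_linear_mult_right)
      fix \<eta> :: real assume "\<eta> > 0"
      then obtain d where d: "d > 0" "\<And>p q. a \<le> p \<Longrightarrow> p < x \<Longrightarrow> x < q \<Longrightarrow> q \<le> b \<Longrightarrow> q - p < d \<Longrightarrow>
          \<bar>f q - f p - L * (q - p)\<bar> \<le> \<eta> * (q - p)"
        using two by meson
      define d' where "d' = min d (min (x - a) (b - x))"
      have "norm (f y - f x - L * (y - x)) \<le> \<eta> * norm (y - x)" if y: "norm (y - x) < d'" for y
      proof -
        consider "y = x" | "x < y" | "y < x"
          by linarith
        then show ?thesis
        proof cases
          case 2
          \<comment> \<open>The estimate is known for intervals from \<open>p\<close> to
            \<open>y\<close> with \<open>p < x\<close>. Letting \<open>p\<close> tend to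
            \<open>x\<close> from the left turns it into one for the difference quotient at
            \<open>x\<close>.\<close>
          have "((\<lambda>p. \<bar>f y - f p - L * (y - p)\<bar> - \<eta> * (y - p)) \<longlongrightarrow> \<bar>f y - f x - L * (y - x)\<bar> - \<eta> * (y - x)) (at_left x)"
            by (intro tendsto_intros lim)
          moreover have "eventually (\<lambda>p. \<bar>f y - f p - L * (y - p)\<bar> - \<eta> * (y - p) \<le> 0) (at_left x)"
            unfolding eventually_at_left_field
            using d(2)[of _ y] 2 y x1 by (intro exI[of _ "max a (y - d)"]) (auto simp: d'_def)
          ultimately have "\<bar>f y - f x - L * (y - x)\<bar> - \<eta> * (y - x) \<le> 0"
            by (intro tendsto_upperbound[of _ _ "at_left x"]) auto
          then show ?thesis
            using 2 by simp
        next
          case 3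
          have "((\<lambda>q. \<bar>f q - f y - L * (q - y)\<bar> - \<eta> * (q - y)) \<longlongrightarrow> \<bar>f x - f y - L * (x - y)\<bar> - \<eta> * (x - y)) (at_right x)"
            by (intro tendsto_intros lim)
          moreover have "eventually (\<lambda>q. \<bar>f q - f y - L * (q - y)\<bar> - \<eta> * (q - y) \<le> 0) (at_right x)"
            unfolding eventually_at_right_field
            using d(2)[of y] 3 y x1 by (intro exI[of _ "min b (y + d)"]) (auto simp: d'_def)
          ultimately have "\<bar>f x - f y - L * (x - y)\<bar> - \<eta> * (x - y) \<le> 0"
            by (intro tendsto_upperbound[of _ _ "at_right x"]) auto
          moreover have "\<bar>f x - f y - L * (x - y)\<bar> = \<bar>f y - f x - L * (y - x)\<bar>"
            by (simp add: algebra_simps abs_minus_commute)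
          ultimately show ?thesis
            using 3 by simp
        qed simp
      qed
      then show "\<exists>d>0. \<forall>y. norm (y - x) < d \<longrightarrow> norm (f y - f x - L * (y - x)) \<le> \<eta> * norm (y - x)"
        using d(1) x1 by (intro exI[of _ d']) (auto simp: d'_def)
    qed
    then show ?thesis
      unfolding has_field_derivative_def by blast
  qed
  ultimately show ?thesis
    by blast
qed

lemma abs_cont_differentiable:
  fixes f :: "real \<Rightarrow> 'a::euclidean_space"
  assumes f: "abs_cont_on a b f"
  shows "\<exists>N. negligible N \<and> (\<forall>x\<in>{a..b} - N. \<exists>D. (f has_vector_derivative D) (at x within {a..b}))"
proof -
  have "\<forall>i. \<exists>N. negligible N \<and> (\<forall>x\<in>{a<..<b} - N. \<exists>L. ((\<lambda>t. f t \<bullet> i) has_real_derivative L) (at x))"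
    by (intro allI abs_cont_real_differentiable abs_cont_on_bounded_linear[OF f] bounded_linear_inner_left)
  from choice[OF this] obtain N where "\<forall>i. negligible (N i) \<and>
      (\<forall>x\<in>{a<..<b} - N i. \<exists>L. ((\<lambda>t. f t \<bullet> i) has_real_derivative L) (at x))" ..
  then have N: "\<And>i. negligible (N i)"
    "\<And>i x. x \<in> {a<..<b} - N i \<Longrightarrow> \<exists>L. ((\<lambda>t. f t \<bullet> i) has_real_derivative L) (at x)"
    by blast+
  let ?N = "(\<Union>i\<in>Basis. N i) \<union> {a, b}"
  have "negligible ?N"
    using N(1) by (intro negligible_Un negligible_countable_Union) (auto intro: countable_finite)
  moreover have "\<exists>D. (f has_vector_derivative D) (at x within {a..b})" if x: "x \<in> {a..b} - ?N" for x
  proof -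
    have "\<exists>L. ((\<lambda>t. f t \<bullet> i) has_real_derivative L) (at x)" if i: "i \<in> Basis" for i
      by (rule N(2)[where i = i]) (use x i in auto)
    then have "\<forall>i\<in>Basis. \<exists>L. ((\<lambda>t. f t \<bullet> i) has_real_derivative L) (at x)"
      by blast
    from bchoice[OF this] obtain L where L: "\<And>i. i \<in> Basis \<Longrightarrow> ((\<lambda>t. f t \<bullet> i) has_real_derivative L i) (at x)"
      by blast
    have "(f has_vector_derivative (\<Sum>i\<in>Basis. L i *\<^sub>R i)) (at x within {a..b})"
      unfolding has_vector_derivative_def
    proof (subst has_derivative_componentwise_within, rule ballI)
      fix i :: 'a assume i: "i \<in> Basis"
      have "((\<lambda>t. f t \<bullet> i) has_derivative (\<lambda>h. L i * h)) (at x within {a..b})"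
        using L[OF i] unfolding has_field_derivative_def by (rule has_derivative_at_withinI)
      moreover have "(\<lambda>h. (h *\<^sub>R (\<Sum>i\<in>Basis. L i *\<^sub>R i)) \<bullet> i) = (\<lambda>h. L i * h)"
        using i by (auto simp: inner_sum_left inner_Basis if_distrib cong: if_cong)
      ultimately show "((\<lambda>t. f t \<bullet> i) has_derivative (\<lambda>h. (h *\<^sub>R (\<Sum>i\<in>Basis. L i *\<^sub>R i)) \<bullet> i)) (at x within {a..b})"
        by simp
    qed
    then show ?thesis
      by blast
  qed
  ultimately show ?thesis
    by blast
qed

section \<open>The integral of the derivative\<close>

lemma negligible_outer_open:
  fixes N :: "real set"
  assumes "negligible N" and "e > 0"
  obtains V where "open V" "N \<subseteq> V" "V \<in> lmeasurable" "measure lebesgue V < e"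
proof -
  have N: "N \<in> null_sets lebesgue"
    using assms(1) by (simp add: negligible_iff_null_sets)
  obtain V where V: "open V" "N \<subseteq> V" "V - N \<in> lmeasurable" "emeasure lebesgue (V - N) < ennreal e"
    using sets_lebesgue_outer_open[OF null_setsD2[OF N] assms(2)] by blast
  have "V = (V - N) \<union> N"
    using V(2) by blast
  then have Vm: "V \<in> lmeasurable"
    using V(3) fmeasurableI_null_sets[OF N] fmeasurable.Un by metis
  have "emeasure lebesgue V = emeasure lebesgue (V - N)"
    using emeasure_Diff_null_set[OF N] Vm by (metis fmeasurableD)
  then have "measure lebesgue V < e"
    using V(4) Vm assms(2) by (metis emeasure_eq_measure2 ennreal_less_iff measure_nonneg)
  with V Vm that show thesis
    by blast
qed

text \<open>Henstock--Kurzweil argument: tags outside \<open>N\<close> are controlled by the derivative, tags in \<open>N\<close> by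
  an open superset of small measure and absolute continuity.\<close>

lemma abs_cont_has_integral:
  fixes f :: "real \<Rightarrow> 'a::euclidean_space"
  assumes f: "abs_cont_on a b f" and ab: "a \<le> b" and N: "negligible N"
    and deriv: "\<And>x. x \<in> {a..b} - N \<Longrightarrow> (f has_vector_derivative f' x) (at x within {a..b})"
  shows "(f' has_integral (f b - f a)) {a..b}"
proof -
  \<comment> \<open>With the integrand set to 0 on \<open>N\<close>, tags in \<open>N\<close>
    contribute only increments of \<open>f\<close>. The change does not affect the integral, as
    \<open>N\<close> is negligible.\<close>
  define g where "g x = (if x \<in> N then 0 else f' x)" for x
  have "(g has_integral (f b - f a)) {a..b}"
    unfolding has_integral_real
  proof (intro allI impI)
    fix e :: real assume e: "e > 0"
    then have e2: "e / 2 > 0"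
      by simp
    obtain d where d0: "d > 0"
      and d: "\<forall>D. D division_of \<Union>D \<longrightarrow> \<Union>D \<subseteq> {a..b} \<longrightarrow> (\<Sum>K\<in>D. Sup K - Inf K) < d \<longrightarrow>
         (\<Sum>K\<in>D. norm (f (Sup K) - f (Inf K))) < e / 2"
      using abs_cont_onD[OF f e2] by blast
    obtain V where V: "open V" "N \<subseteq> V" "V \<in> lmeasurable" "measure lebesgue V < d"
      using negligible_outer_open[OF N d0] by blast
    \<comment> \<open>The errors at tags outside \<open>N\<close> add up to at most e1 (b - a) \<le>
      e / 2. The 1 in the denominator covers a = b.\<close>
    define e1 where "e1 = e / (2 * (b - a + 1))"
    have e1: "e1 > 0" "e1 * (b - a) \<le> e / 2"
      using e ab by (auto simp: e1_def field_simps)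
    have "\<exists>r>0. \<forall>y\<in>{a..b}. norm (y - x) < r \<longrightarrow> norm (f y - f x - (y - x) *\<^sub>R f' x) \<le> e1 * norm (y - x)"
      if "x \<in> {a..b} - N" for x
      using deriv[OF that] e1(1) unfolding has_vector_derivative_def has_derivative_within_alt by blast
    then have "\<forall>x\<in>{a..b} - N. \<exists>r>0. \<forall>y\<in>{a..b}. norm (y - x) < r \<longrightarrow> norm (f y - f x - (y - x) *\<^sub>R f' x) \<le> e1 * norm (y - x)"
      by blast
    from bchoice[OF this] obtain r where r: "\<And>x. x \<in> {a..b} - N \<Longrightarrow> r x > 0"
      "\<And>x y. x \<in> {a..b} - N \<Longrightarrow> y \<in> {a..b} \<Longrightarrow> norm (y - x) < r x \<Longrightarrow> norm (f y - f x - (y - x) *\<^sub>R f' x) \<le> e1 * norm (y - x)"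
      by blast
    define \<gamma> where "\<gamma> x = (if x \<in> N then V else if x \<in> {a..b} then ball x (r x) else UNIV)" for x
    have gauge: "gauge \<gamma>"
      unfolding gauge_def \<gamma>_def using V r(1) by auto
    have bound: "norm ((\<Sum>(x, K)\<in>p. measure lborel K *\<^sub>R g x) - (f b - f a)) < e"
      if p: "p tagged_division_of {a..b}" and fine: "\<gamma> fine p" for p
    proof -
      have pfin: "finite p"
        using p by blast
      have pI: "\<exists>u v. u \<le> v \<and> K = {u..v} \<and> x \<in> {u..v} \<and> {u..v} \<subseteq> {a..b}" if "(x, K) \<in> p" for x K
        using tagged_division_ofD(2,3,4)[OF p that] by force
      define p2 where "p2 = {(x, K) \<in> p. x \<in> N}"
      define p1 where "p1 = p - p2"
      have p2: "p2 \<subseteq> p"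
        by (auto simp: p2_def)
      define h where "h = (\<lambda>(x, K). measure lborel K *\<^sub>R g x - (f (Sup K) - f (Inf K)))"
      have "(\<Sum>(x, K)\<in>p. measure lborel K *\<^sub>R g x) - (f b - f a) = sum h p"
        using additive_tagged_division_1[OF ab p, of f] by (simp add: h_def split_def sum_subtractf)
      also have "\<dots> = sum h p1 + sum h p2"
        unfolding p1_def by (rule sum.subset_diff[OF p2 pfin])
      also have "norm \<dots> \<le> norm (sum h p1) + norm (sum h p2)"
        by (rule norm_triangle_ineq)
      also have "norm (sum h p1) \<le> e / 2"
      proof -
        have "norm (sum h p1) \<le> (\<Sum>(x, K)\<in>p1. e1 * (Sup K - Inf K))"
        proof (rule sum_norm_le, safe)
          fix x K assume xK: "(x, K) \<in> p1"
          then have xKp: "(x, K) \<in> p" and xN: "x \<notin> N"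
            by (auto simp: p1_def p2_def)
          obtain u v where uv: "u \<le> v" "K = {u..v}" "x \<in> {u..v}" "{u..v} \<subseteq> {a..b}"
            using pI[OF xKp] by blast
          have x: "x \<in> {a..b} - N"
            using uv xN by blast
          have "K \<subseteq> ball x (r x)"
            using fine xKp x unfolding fine_def \<gamma>_def by force
          then have ur: "norm (u - x) < r x" "norm (v - x) < r x"
            using uv(1,2) by (auto simp: dist_norm subset_iff norm_minus_commute)
          have "norm (f u - f x - (u - x) *\<^sub>R f' x) \<le> e1 * norm (u - x)"
            by (rule r(2)[OF x _ ur(1)]) (use uv in auto)
          moreover have "norm (f v - f x - (v - x) *\<^sub>R f' x) \<le> e1 * norm (v - x)"
            by (rule r(2)[OF x _ ur(2)]) (use uv in auto)
          \<comment> \<open>Straddle argument: the tag lies between \<open>u\<close> and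
            \<open>v\<close>, so the errors at the two end points, both measured from the tag, add
            up to e1 (v - u).\<close>
          moreover have "norm ((v - u) *\<^sub>R f' x - (f v - f u)) = norm (f u - f x - (u - x) *\<^sub>R f' x - (f v - f x - (v - x) *\<^sub>R f' x))"
            by (auto simp: algebra_simps)
          moreover have "norm (f u - f x - (u - x) *\<^sub>R f' x - (f v - f x - (v - x) *\<^sub>R f' x))
              \<le> norm (f u - f x - (u - x) *\<^sub>R f' x) + norm (f v - f x - (v - x) *\<^sub>R f' x)"
            by (rule norm_triangle_ineq4)
          moreover have "e1 * norm (u - x) + e1 * norm (v - x) = e1 * (v - u)"
            using uv(3) by (simp add: algebra_simps)
          ultimately have "norm ((v - u) *\<^sub>R f' x - (f v - f u)) \<le> e1 * (v - u)"
            by linarith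
          then show "norm (h (x, K)) \<le> e1 * (Sup K - Inf K)"
            using xN uv(1,2) by (simp add: h_def g_def)
        qed
        also have "\<dots> \<le> (\<Sum>(x, K)\<in>p. e1 * (Sup K - Inf K))"
        proof (rule sum_mono2[OF pfin])
          show "0 \<le> (case xK of (x, K) \<Rightarrow> e1 * (Sup K - Inf K))" if "xK \<in> p - p1" for xK
          proof -
            obtain x K where xK: "xK = (x, K)" "(x, K) \<in> p"
              using \<open>xK \<in> p - p1\<close> by (cases xK) auto
            from pI[OF xK(2)] show ?thesis
              using e1(1) by (auto simp: xK(1))
          qed
        qed (auto simp: p1_def)
        also have "\<dots> = e1 * (b - a)"
          using additive_tagged_division_1[OF ab p, of "\<lambda>t. t"] by (simp add: split_def sum_distrib_left[symmetric])
        finally show ?thesis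
          using e1(2) by linarith
      qed
      also have "norm (sum h p2) < e / 2"
      proof -
        have "p2 tagged_partial_division_of {a..b}"
          using tagged_partial_division_subset[OF _ p2] p unfolding tagged_division_of_def by blast
        then have td: "p2 tagged_division_of \<Union>(snd ` p2)"
          by (rule tagged_partial_division_of_Union_self)
        then have div: "(snd ` p2) division_of \<Union>(snd ` p2)"
          by (rule division_of_tagged_division)
        have inV: "\<Union>(snd ` p2) \<subseteq> V"
          using fine unfolding fine_def \<gamma>_def p2_def by fastforce
        have "(\<Sum>K\<in>snd ` p2. Sup K - Inf K) = measure lebesgue (\<Union>(snd ` p2))"
          by (rule sum_length_division[OF div])
        also have "\<dots> \<le> measure lebesgue V"
          using lmeasurable_division[OF div] V(3) inV by (intro measure_mono_fmeasurable) auto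
        finally have len: "(\<Sum>K\<in>snd ` p2. Sup K - Inf K) < d"
          using V(4) by linarith
        have sub: "\<Union>(snd ` p2) \<subseteq> {a..b}"
          using pI p2 by fastforce
        \<comment> \<open>The passage from tagged to untagged sums asks for a function that vanishes
          on degenerate boxes, so the value at the empty set has to be prescribed.\<close>
        define k where "k K = (if K = {} then 0 else norm (f (Sup K) - f (Inf K)))" for K :: "real set"
        have "norm (sum h p2) \<le> (\<Sum>(x, K)\<in>p2. k K)"
        proof (rule sum_norm_le, safe)
          fix x K assume "(x, K) \<in> p2"
          then have "x \<in> N" "K \<noteq> {}"
            using pI[of x K] p2 by (auto simp: p2_def)
          then show "norm (h (x, K)) \<le> k K"
            by (simp add: h_def g_def k_def norm_minus_commute)
        qed
        also have "\<dots> = sum k (snd ` p2)"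
        proof (rule sum.over_tagged_division_lemma[OF td])
          show "k (cbox u v) = 0" if "box u v = {}" for u v
            using that by (auto simp: k_def box_eq_empty)
        qed
        also have "\<dots> = (\<Sum>K\<in>snd ` p2. norm (f (Sup K) - f (Inf K)))"
          using division_ofD(3)[OF div] by (intro sum.cong) (auto simp: k_def)
        also have "\<dots> < e / 2"
          using d[rule_format, OF div sub len] .
        finally show ?thesis .
      qed
      finally show ?thesis
        by simp
    qed
    show "\<exists>\<gamma>. gauge \<gamma> \<and> (\<forall>p. p tagged_division_of {a..b} \<and> \<gamma> fine p \<longrightarrow>
        norm ((\<Sum>(x, K)\<in>p. measure lborel K *\<^sub>R g x) - (f b - f a)) < e)"
      using gauge bound by (intro exI[of _ \<gamma>]) simp
  qed
  then show ?thesis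
    by (rule has_integral_spike[OF N, rotated]) (simp add: g_def)
qed

section \<open>Estimates by the derivative on the interval from 0 to T\<close>

lemma abs_cont_on_subset:
  assumes f: "abs_cont_on a b f" and sub: "a \<le> c" "d \<le> b"
  shows "abs_cont_on c d f"
  unfolding abs_cont_on_def
proof (intro allI impI)
  fix e :: real assume "e > 0"
  from abs_cont_onD[OF f this] obtain \<delta> where \<delta>: "\<delta> > 0"
    "\<forall>D. D division_of \<Union>D \<longrightarrow> \<Union>D \<subseteq> {a..b} \<longrightarrow> (\<Sum>K\<in>D. Sup K - Inf K) < \<delta> \<longrightarrow>
       (\<Sum>K\<in>D. norm (f (Sup K) - f (Inf K))) < e"
    by blast
  have "\<Union>D \<subseteq> {a..b}" if "\<Union>D \<subseteq> {c..d}" for D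
    using that sub by fastforce
  with \<delta> show "\<exists>\<delta>>0. \<forall>D. D division_of \<Union>D \<and> \<Union>D \<subseteq> {c..d} \<and> (\<Sum>K\<in>D. Sup K - Inf K) < \<delta> \<longrightarrow>
       (\<Sum>K\<in>D. norm (f (Sup K) - f (Inf K))) < e"
    by (intro exI[of _ \<delta>]) simp
qed

lemma negligible_AE_LT:
  assumes "negligible N"
  shows "AE t in LT T. t \<notin> N"
proof -
  have "N \<in> null_sets lebesgue"
    using assms by (simp add: negligible_iff_null_sets)
  then have "AE t in lebesgue. t \<notin> N"
    by (rule AE_not_in)
  then show ?thesis
    by (subst AE_restrict_space_iff) auto
qed

text \<open>\<open>ddt\<close> is a choice operator. Where a derivative exists it returns that
  derivative, because derivatives within a nondegenerate interval are unique.\<close>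

lemma abs_cont_ddt:
  fixes x :: "real \<Rightarrow> 'a::euclidean_space"
  assumes x: "abs_cont_on 0 T x" and T: "T > 0"
  shows "\<exists>N. negligible N \<and> (\<forall>t\<in>{0..T} - N. (x has_vector_derivative ddt T x t) (at t within {0..T}))"
proof -
  obtain N where N: "negligible N" "\<forall>t\<in>{0..T} - N. \<exists>D. (x has_vector_derivative D) (at t within {0..T})"
    using abs_cont_differentiable[OF x] by blast
  have "(x has_vector_derivative ddt T x t) (at t within {0..T})" if t: "t \<in> {0..T} - N" for t
  proof -
    obtain D where D: "(x has_vector_derivative D) (at t within {0..T})"
      using N(2) t by blast
    moreover have "ddt T x t = D"
      unfolding ddt_def by (rule vector_derivative_within_closed_interval[OF T _ D]) (use t in blast)
    ultimately show ?thesis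
      by simp
  qed
  with N(1) show ?thesis
    by blast
qed

text \<open>Linearity can be claimed only almost everywhere, since \<open>ddt\<close> is unspecified
  at points without derivative. It is needed because \<open>Y_dist\<close> differentiates the
  difference of two states.\<close>

lemma ddt_lincomb:
  fixes x y :: "real \<Rightarrow> 'a::euclidean_space"
  assumes x: "abs_cont_on 0 T x" and y: "abs_cont_on 0 T y" and T: "T > 0"
  shows "AE t in LT T. ddt T (\<lambda>t. a *\<^sub>R x t + b *\<^sub>R y t) t = a *\<^sub>R ddt T x t + b *\<^sub>R ddt T y t"
proof -
  obtain N where N: "negligible N" "\<forall>t\<in>{0..T} - N. (x has_vector_derivative ddt T x t) (at t within {0..T})"
    using abs_cont_ddt[OF x T] by blast
  obtain M where M: "negligible M" "\<forall>t\<in>{0..T} - M. (y has_vector_derivative ddt T y t) (at t within {0..T})"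
    using abs_cont_ddt[OF y T] by blast
  have eq: "ddt T (\<lambda>t. a *\<^sub>R x t + b *\<^sub>R y t) t = a *\<^sub>R ddt T x t + b *\<^sub>R ddt T y t"
    if t: "t \<in> {0..T}" "t \<notin> N" "t \<notin> M" for t
  proof -
    have "((\<lambda>t. a *\<^sub>R x t + b *\<^sub>R y t) has_vector_derivative (a *\<^sub>R ddt T x t + b *\<^sub>R ddt T y t)) (at t within {0..T})"
      using N(2) M(2) t
      by (intro has_vector_derivative_add bounded_linear.has_vector_derivative[OF bounded_linear_scaleR_right]) auto
    then show ?thesis
      unfolding ddt_def[of T "\<lambda>t. a *\<^sub>R x t + b *\<^sub>R y t"]
      by (rule vector_derivative_within_closed_interval[OF T t(1)])
  qed
  have "AE t in LT T. t \<in> {0..T}"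
    by (rule AE_I2) simp
  with negligible_AE_LT[OF N(1), of T] negligible_AE_LT[OF M(1), of T]
  have "AE t in LT T. t \<in> {0..T} \<and> t \<notin> N \<and> t \<notin> M"
    by simp
  then show ?thesis
    by (rule eventually_mono) (use eq in blast)
qed

lemma abs_cont_norm_diff_le:
  fixes x :: "real \<Rightarrow> 'a::euclidean_space"
  assumes x: "abs_cont_on 0 T x" and T: "T > 0" and int: "integrable (LT T) (ddt T x)"
    and st: "s \<in> {0..T}" "t \<in> {0..T}"
  shows "norm (x t - x s) \<le> integral\<^sup>L (LT T) (\<lambda>t. norm (ddt T x t))"
proof -
  obtain N where N: "negligible N" "\<forall>t\<in>{0..T} - N. (x has_vector_derivative ddt T x t) (at t within {0..T})"
    using abs_cont_ddt[OF x T] by blast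
  have *: "norm (x q - x p) \<le> integral\<^sup>L (LT T) (\<lambda>t. norm (ddt T x t))" if pq: "0 \<le> p" "p \<le> q" "q \<le> T" for p q
  proof -
    have sub: "{p..q} \<subseteq> {0..T}"
      using pq by auto
    have hi: "(ddt T x has_integral (x q - x p)) {p..q}"
    proof (rule abs_cont_has_integral[OF abs_cont_on_subset[OF x pq(1,3)] pq(2) N(1)])
      fix r assume "r \<in> {p..q} - N"
      then have "(x has_vector_derivative ddt T x r) (at r within {0..T})"
        using N(2) sub by blast
      then show "(x has_vector_derivative ddt T x r) (at r within {p..q})"
        by (rule has_vector_derivative_within_subset[OF _ sub])
    qed
    have nint: "integrable (LT T) (\<lambda>t. norm (ddt T x t))"
      using int by (rule integrable_norm)
    have n1: "(\<lambda>t. norm (ddt T x t)) integrable_on {0..T}"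
      by (rule integrable_on_lebesgue_on[OF nint]) simp
    have n2: "(\<lambda>t. norm (ddt T x t)) integrable_on {p..q}"
      using Henstock_Kurzweil_Integration.integrable_subinterval[of _ 0 T p q] n1 sub by simp
    have "norm (x q - x p) = norm (integral {p..q} (ddt T x))"
      using hi by (simp add: integral_unique)
    also have "\<dots> \<le> integral {p..q} (\<lambda>t. norm (ddt T x t))"
      by (rule Henstock_Kurzweil_Integration.integral_norm_bound_integral) (use hi n2 in auto)
    also have "\<dots> \<le> integral {0..T} (\<lambda>t. norm (ddt T x t))"
      by (rule integral_subset_le[OF sub n2 n1]) simp
    also have "\<dots> = integral\<^sup>L (LT T) (\<lambda>t. norm (ddt T x t))"
      by (rule lebesgue_integral_eq_integral[OF nint, symmetric]) simp
    finally show ?thesis .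
  qed
  show ?thesis
    using *[of s t] *[of t s] st by (cases "s \<le> t") (auto simp: norm_minus_commute)
qed

text \<open>The bound of \<bar>x(t)\<bar> by \<bar>x(s)\<bar> plus the integral of \<bar>x'\<bar> is
  averaged over \<open>s\<close>. This is the embedding of W^{1,1} into the continuous functions,
  with an explicit constant.\<close>

lemma abs_cont_norm_le:
  fixes x :: "real \<Rightarrow> 'a::euclidean_space"
  assumes x: "abs_cont_on 0 T x" and T: "T > 0" and int: "integrable (LT T) (ddt T x)"
    and t: "t \<in> {0..T}"
  shows "norm (x t) \<le> integral\<^sup>L (LT T) (\<lambda>t. norm (x t)) / T + integral\<^sup>L (LT T) (\<lambda>t. norm (ddt T x t))"
proof -
  let ?C = "integral\<^sup>L (LT T) (\<lambda>t. norm (ddt T x t))"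
  have meas: "measure (LT T) (space (LT T)) = T"
    using T by (simp add: measure_restrict_space)
  have xint: "integrable (LT T) (\<lambda>s. norm (x s))"
    by (intro continuous_imp_integrable_real continuous_on_norm abs_cont_on_imp_continuous_on[OF x])
  have cint: "integrable (LT T) (\<lambda>s. c)" for c :: real
    by (intro continuous_imp_integrable_real) simp
  have "T * norm (x t) = integral\<^sup>L (LT T) (\<lambda>s. norm (x t))"
    using meas by (simp add: mult.commute)
  also have "\<dots> \<le> integral\<^sup>L (LT T) (\<lambda>s. norm (x s) + ?C)"
  proof (rule integral_mono)
    fix s assume "s \<in> space (LT T)"
    then have "norm (x t - x s) \<le> ?C"
      by (intro abs_cont_norm_diff_le[OF x T int]) (use t in auto)
    then show "norm (x t) \<le> norm (x s) + ?C"
      using norm_triangle_ineq2[of "x t" "x s"] by linarith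
  qed (use xint cint in auto)
  also have "\<dots> = integral\<^sup>L (LT T) (\<lambda>s. norm (x s)) + T * ?C"
    using xint cint[of ?C] meas by simp
  finally show ?thesis
    using T by (simp add: field_simps)
qed

section \<open>Bounded almost everywhere convergence and weak cluster points\<close>

text \<open>The hypotheses of the bounded convergence theorem in one predicate. Unlike convergence
  of integrals, it is preserved by continuous functions of several sequences, so the integrands of
  \<Gamma> can be handled by closure rules.\<close>

definition bdd_AE_tendsto :: "'a measure \<Rightarrow> (nat \<Rightarrow> 'a \<Rightarrow> 'b::euclidean_space) \<Rightarrow> ('a \<Rightarrow> 'b) \<Rightarrow> bool" where
  "bdd_AE_tendsto M F f \<longleftrightarrow> (\<forall>n. F n \<in> borel_measurable M) \<and> f \<in> borel_measurable M \<and>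
     (AE t in M. (\<lambda>n. F n t) \<longlonglongrightarrow> f t) \<and> (\<exists>B. AE t in M. \<forall>n. norm (F n t) \<le> B)"

lemma bdd_AE_tendstoI:
  assumes "\<And>n. F n \<in> borel_measurable M" and "f \<in> borel_measurable M"
    and "AE t in M. (\<lambda>n. F n t) \<longlonglongrightarrow> f t" and "AE t in M. \<forall>n. norm (F n t) \<le> B"
  shows "bdd_AE_tendsto M F f"
  using assms unfolding bdd_AE_tendsto_def by blast

lemma bdd_AE_tendstoD:
  assumes "bdd_AE_tendsto M F f"
  shows "F n \<in> borel_measurable M" and "f \<in> borel_measurable M" and "AE t in M. (\<lambda>n. F n t) \<longlonglongrightarrow> f t"
  using assms unfolding bdd_AE_tendsto_def by auto

lemma bdd_AE_tendstoE:
  assumes "bdd_AE_tendsto M F f"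
  obtains B where "B > 0" "AE t in M. \<forall>n. norm (F n t) \<le> B"
proof -
  obtain B where B: "AE t in M. \<forall>n. norm (F n t) \<le> B"
    using assms unfolding bdd_AE_tendsto_def by blast
  have "AE t in M. \<forall>n. norm (F n t) \<le> max B 1"
    using B by eventually_elim (simp add: le_max_iff_disj)
  then show thesis
    by (intro that[of "max B 1"]) auto
qed

lemma bdd_AE_tendsto_const:
  assumes "f \<in> borel_measurable M" and "AE t in M. norm (f t) \<le> B"
  shows "bdd_AE_tendsto M (\<lambda>n. f) f"
  using assms by (intro bdd_AE_tendstoI[where B = B]) auto

lemma bdd_AE_tendsto_subseq:
  assumes F: "bdd_AE_tendsto M F f" and r: "strict_mono r"
  shows "bdd_AE_tendsto M (\<lambda>n. F (r n)) f"
proof -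
  obtain B where B: "AE t in M. \<forall>n. norm (F n t) \<le> B"
    using bdd_AE_tendstoE[OF F] by blast
  show ?thesis
  proof (rule bdd_AE_tendstoI)
    show "AE t in M. (\<lambda>n. F (r n) t) \<longlonglongrightarrow> f t"
      using bdd_AE_tendstoD(3)[OF F] by eventually_elim (use LIMSEQ_subseq_LIMSEQ[OF _ r] in \<open>auto simp: o_def\<close>)
    show "AE t in M. \<forall>n. norm (F (r n) t) \<le> B"
      using B by eventually_elim auto
  qed (use bdd_AE_tendstoD[OF F] in auto)
qed

lemma bdd_AE_tendsto_limit_bounded:
  assumes F: "bdd_AE_tendsto M F f"
  obtains B where "B > 0" "AE t in M. norm (f t) \<le> B" "AE t in M. \<forall>n. norm (F n t) \<le> B"
proof -
  obtain B where B: "B > 0" "AE t in M. \<forall>n. norm (F n t) \<le> B"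
    using bdd_AE_tendstoE[OF F] .
  have "AE t in M. norm (f t) \<le> B"
    using B(2) bdd_AE_tendstoD(3)[OF F]
    by eventually_elim (rule LIMSEQ_le_const2[OF tendsto_norm], auto)
  with B that show thesis
    by blast
qed

text \<open>A continuous function is bounded on the compact ball that holds all values. Sums,
  differences, inner products and maxima are instances, applied to pairs.\<close>

lemma bdd_AE_tendsto_compose:
  fixes h :: "'b::euclidean_space \<Rightarrow> 'c::euclidean_space"
  assumes F: "bdd_AE_tendsto M F f" and h: "continuous_on UNIV h"
  shows "bdd_AE_tendsto M (\<lambda>n t. h (F n t)) (\<lambda>t. h (f t))"
proof -
  obtain B where B: "AE t in M. \<forall>n. norm (F n t) \<le> B"
    using bdd_AE_tendstoE[OF F] by blast
  have "bounded (h ` cball 0 B)"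
    by (intro compact_imp_bounded compact_continuous_image continuous_on_subset[OF h]) auto
  then obtain C where C: "\<And>x. norm x \<le> B \<Longrightarrow> norm (h x) \<le> C"
    unfolding bounded_iff by force
  have hm: "h \<in> borel_measurable borel"
    using h by (rule borel_measurable_continuous_onI)
  show ?thesis
  proof (rule bdd_AE_tendstoI)
    show "AE t in M. (\<lambda>n. h (F n t)) \<longlonglongrightarrow> h (f t)"
      using bdd_AE_tendstoD(3)[OF F]
      by eventually_elim (use h in \<open>auto simp: continuous_on_eq_continuous_at intro: isCont_tendsto_compose\<close>)
    show "AE t in M. \<forall>n. norm (h (F n t)) \<le> C"
      using B by eventually_elim (use C in auto)
    show "(\<lambda>t. h (F n t)) \<in> borel_measurable M" for n
      using measurable_compose[OF bdd_AE_tendstoD(1)[OF F] hm] .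
    show "(\<lambda>t. h (f t)) \<in> borel_measurable M"
      using measurable_compose[OF bdd_AE_tendstoD(2)[OF F] hm] .
  qed
qed

lemma bdd_AE_tendsto_Pair:
  assumes F: "bdd_AE_tendsto M F f" and G: "bdd_AE_tendsto M G g"
  shows "bdd_AE_tendsto M (\<lambda>n t. (F n t, G n t)) (\<lambda>t. (f t, g t))"
proof -
  obtain B where B: "AE t in M. \<forall>n. norm (F n t) \<le> B"
    using bdd_AE_tendstoE[OF F] by blast
  obtain C where C: "AE t in M. \<forall>n. norm (G n t) \<le> C"
    using bdd_AE_tendstoE[OF G] by blast
  show ?thesis
  proof (rule bdd_AE_tendstoI)
    show "AE t in M. (\<lambda>n. (F n t, G n t)) \<longlonglongrightarrow> (f t, g t)"
      using bdd_AE_tendstoD(3)[OF F] bdd_AE_tendstoD(3)[OF G] by eventually_elim (rule tendsto_Pair)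
    show "AE t in M. \<forall>n. norm (F n t, G n t) \<le> B + C"
      using B C
    proof eventually_elim
      case (elim t)
      show ?case
      proof
        fix n
        have "norm (F n t, G n t) \<le> norm (F n t) + norm (G n t)"
          by (rule norm_Pair_le)
        then show "norm (F n t, G n t) \<le> B + C"
          using elim by (meson add_mono order_trans)
      qed
    qed
  qed (use bdd_AE_tendstoD[OF F] bdd_AE_tendstoD[OF G] in auto)
qed

lemma bdd_AE_tendsto_add:
  assumes "bdd_AE_tendsto M F f" and "bdd_AE_tendsto M G g"
  shows "bdd_AE_tendsto M (\<lambda>n t. F n t + G n t) (\<lambda>t. f t + g t)"
  using bdd_AE_tendsto_compose[OF bdd_AE_tendsto_Pair[OF assms], of "\<lambda>(a, b). a + b"]
  by (simp add: split_def continuous_intros)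

lemma bdd_AE_tendsto_diff:
  assumes "bdd_AE_tendsto M F f" and "bdd_AE_tendsto M G g"
  shows "bdd_AE_tendsto M (\<lambda>n t. F n t - G n t) (\<lambda>t. f t - g t)"
  using bdd_AE_tendsto_compose[OF bdd_AE_tendsto_Pair[OF assms], of "\<lambda>(a, b). a - b"]
  by (simp add: split_def continuous_intros)

lemma bdd_AE_tendsto_inner:
  assumes "bdd_AE_tendsto M F f" and "bdd_AE_tendsto M G g"
  shows "bdd_AE_tendsto M (\<lambda>n t. inner (F n t) (G n t)) (\<lambda>t. inner (f t) (g t))"
  using bdd_AE_tendsto_compose[OF bdd_AE_tendsto_Pair[OF assms], of "\<lambda>(a, b). inner a b"]
  by (simp add: split_def continuous_intros)

lemma bdd_AE_tendsto_max:
  fixes f g :: "'a \<Rightarrow> real"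
  assumes "bdd_AE_tendsto M F f" and "bdd_AE_tendsto M G g"
  shows "bdd_AE_tendsto M (\<lambda>n t. max (F n t) (G n t)) (\<lambda>t. max (f t) (g t))"
  using bdd_AE_tendsto_compose[OF bdd_AE_tendsto_Pair[OF assms], of "\<lambda>(a, b). max a b"]
  by (simp add: split_def continuous_intros)

lemma (in finite_measure) bdd_AE_tendsto_integral:
  fixes f :: "'a \<Rightarrow> real"
  assumes F: "bdd_AE_tendsto M F f"
  shows "(\<lambda>n. integral\<^sup>L M (F n)) \<longlonglongrightarrow> integral\<^sup>L M f"
    and "integrable M f" and "integrable M (F n)"
proof -
  obtain B where B: "AE t in M. norm (f t) \<le> B" "AE t in M. \<forall>n. norm (F n t) \<le> B"
    using bdd_AE_tendsto_limit_bounded[OF F] by blast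
  have Bn: "AE t in M. norm (F n t) \<le> B" for n
    using B(2) by eventually_elim auto
  show "integrable M f"
    by (rule integrable_const_bound[OF B(1) bdd_AE_tendstoD(2)[OF F]])
  show "integrable M (F n)"
    by (rule integrable_const_bound[OF Bn bdd_AE_tendstoD(1)[OF F]])
  show "(\<lambda>n. integral\<^sup>L M (F n)) \<longlonglongrightarrow> integral\<^sup>L M f"
    by (rule integral_dominated_convergence[where w = "\<lambda>_. B"]) (use bdd_AE_tendstoD[OF F] Bn in auto)
qed

text \<open>Midpoints suffice in place of all convex combinations: the parallelogram law is applied to
  midpoints only.\<close>

inductive midpoint_hull :: "(nat \<Rightarrow> 'a \<Rightarrow> 'b::real_vector) \<Rightarrow> nat \<Rightarrow> ('a \<Rightarrow> 'b) \<Rightarrow> bool" for V n where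
  base: "n \<le> j \<Longrightarrow> midpoint_hull V n (V j)"
| mid: "midpoint_hull V n U \<Longrightarrow> midpoint_hull V n W \<Longrightarrow> midpoint_hull V n (\<lambda>t. (1/2) *\<^sub>R (U t + W t))"

lemma midpoint_hull_mono: "midpoint_hull V n U \<Longrightarrow> m \<le> n \<Longrightarrow> midpoint_hull V m U"
  by (induction rule: midpoint_hull.induct) (auto intro: midpoint_hull.intros)

lemma norm_midpoint_le:
  fixes x y :: "'b::real_normed_vector"
  assumes "norm x \<le> B" and "norm y \<le> B"
  shows "norm ((1/2) *\<^sub>R (x + y)) \<le> B"
  using norm_triangle_ineq[of x y] assms by simp

lemma parallelogram_midpoint:
  fixes x y :: "'b::real_inner"
  shows "(norm (x - y))\<^sup>2 = 2 * (norm x)\<^sup>2 + 2 * (norm y)\<^sup>2 - 4 * (norm ((1/2) *\<^sub>R (x + y)))\<^sup>2"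
  by (simp add: power2_norm_eq_inner inner_add_left inner_add_right inner_diff_left inner_diff_right inner_commute power2_eq_square[of "2::real"] algebra_simps)

text \<open>
  A substitute for weak compactness in \<open>L\<^sup>2\<close>: elements of nearly minimal norm in the midpoint hulls of the
  tails form a Cauchy sequence by the parallelogram law, and linear inequalities that hold eventually along
  the sequence are inherited by the hulls.
\<close>

lemma (in finite_measure) bounded_seq_weak_cluster:
  fixes V :: "nat \<Rightarrow> 'a \<Rightarrow> 'b::euclidean_space"
  assumes V: "\<And>j. V j \<in> borel_measurable M" and VB: "\<And>j. AE t in M. norm (V j t) \<le> B"
  obtains U where "U \<in> borel_measurable M" and "AE t in M. norm (U t) \<le> B"
    and "AE t in M. \<forall>b c. eventually (\<lambda>j. inner (V j t) b \<le> c) sequentially \<longrightarrow> inner (U t) b \<le> c"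
    and "\<And>\<psi> c C. \<psi> \<in> borel_measurable M \<Longrightarrow> AE t in M. norm (\<psi> t) \<le> C \<Longrightarrow>
           eventually (\<lambda>j. (\<integral>t. inner (V j t) (\<psi> t) \<partial>M) \<le> c) sequentially \<Longrightarrow> (\<integral>t. inner (U t) (\<psi> t) \<partial>M) \<le> c"
proof -
  have hm: "U \<in> borel_measurable M" and hB: "AE t in M. norm (U t) \<le> B" if "midpoint_hull V n U" for n U
  proof -
    from that have "U \<in> borel_measurable M \<and> (AE t in M. norm (U t) \<le> B)"
    proof (induction rule: midpoint_hull.induct)
      case (base j)
      then show ?case
        using V VB by blast
    next
      case (mid U W)
      have [measurable]: "U \<in> borel_measurable M" "W \<in> borel_measurable M"
        using mid by auto
      have "AE t in M. norm (U t) \<le> B" "AE t in M. norm (W t) \<le> B"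
        using mid by auto
      then have "AE t in M. norm ((1/2) *\<^sub>R (U t + W t)) \<le> B"
        by eventually_elim (rule norm_midpoint_le)
      moreover have "(\<lambda>t. (1/2) *\<^sub>R (U t + W t)) \<in> borel_measurable M"
        by measurable
      ultimately show ?case
        by blast
    qed
    then show "U \<in> borel_measurable M" and "AE t in M. norm (U t) \<le> B"
      by auto
  qed
  have sq: "integrable M (\<lambda>t. (norm (U t))\<^sup>2)" if "midpoint_hull V n U" for n U
  proof (rule integrable_const_bound[where B = "B\<^sup>2"])
    show "AE t in M. norm ((norm (U t))\<^sup>2) \<le> B\<^sup>2"
      using hB[OF that] by eventually_elim (simp add: power_mono)
    show "(\<lambda>t. (norm (U t))\<^sup>2) \<in> borel_measurable M"
      using hm[OF that] by measurable
  qed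
  have int: "integrable M U" if "midpoint_hull V n U" for n U
    using integrable_const_bound[OF hB[OF that] hm[OF that]] .
  define E where "E U = (\<integral>t. (norm (U t))\<^sup>2 \<partial>M)" for U :: "'a \<Rightarrow> 'b"
  define \<mu> where "\<mu> = measure M (space M)"
  have E0: "0 \<le> E U" for U
    unfolding E_def by (rule integral_nonneg_AE) simp
  have EB: "E U \<le> B\<^sup>2 * \<mu>" if "midpoint_hull V n U" for n U
  proof -
    have "E U \<le> (\<integral>t. B\<^sup>2 \<partial>M)"
      unfolding E_def
    proof (rule integral_mono_AE[OF sq[OF that]])
      show "AE t in M. (norm (U t))\<^sup>2 \<le> B\<^sup>2"
        using hB[OF that] by eventually_elim (simp add: power_mono)
    qed simp
    then show ?thesis
      by (simp add: \<mu>_def mult.commute)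
  qed
  \<comment> \<open>The least energy in the hull of the tail from \<open>n\<close> increases with
    \<open>n\<close>, since the hulls shrink, and it is bounded. Its convergence is what makes
    near-minimisers a Cauchy sequence.\<close>
  define d where "d n = Inf (E ` {U. midpoint_hull V n U})" for n
  have bdd: "bdd_below (E ` {U. midpoint_hull V n U})" for n
    using E0 by (intro bdd_belowI[of _ 0]) auto
  have ne: "E ` {U. midpoint_hull V n U} \<noteq> {}" for n
    using midpoint_hull.base[of n n V] by blast
  have d_le: "d n \<le> E U" if "midpoint_hull V n U" for n U
    unfolding d_def using that by (intro cInf_lower[OF _ bdd]) auto
  have "\<exists>U. midpoint_hull V n U \<and> E U < d n + inverse (real (Suc n))" for n
  proof -
    have "Inf (E ` {U. midpoint_hull V n U}) < d n + inverse (real (Suc n))"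
      by (simp add: d_def)
    from cInf_lessD[OF ne this] show ?thesis
      by auto
  qed
  then have "\<forall>n. \<exists>U. midpoint_hull V n U \<and> E U < d n + inverse (real (Suc n))"
    by blast
  from choice[OF this] obtain W where W: "\<And>n. midpoint_hull V n (W n)"
    and WE: "\<And>n. E (W n) < d n + inverse (real (Suc n))"
    by blast
  have "incseq d"
  proof (rule incseq_SucI)
    fix n
    have "E ` {U. midpoint_hull V (Suc n) U} \<subseteq> E ` {U. midpoint_hull V n U}"
      using midpoint_hull_mono[of V "Suc n" _ n] by auto
    then show "d n \<le> d (Suc n)"
      unfolding d_def by (rule cInf_superset_mono[OF ne bdd])
  qed
  moreover have "d n \<le> B\<^sup>2 * \<mu>" for n
    using d_le[OF W[of n]] EB[OF W[of n]] by linarith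
  ultimately obtain D where D: "d \<longlonglongrightarrow> D" "\<And>n. d n \<le> D"
    using incseq_convergent[of d "B\<^sup>2 * \<mu>"] by blast
  \<comment> \<open>For i \<le> j the midpoint of \<open>W i\<close> and \<open>W j\<close> lies in
    the hull of index \<open>i\<close>, so its energy is at least \<open>d i\<close>. The
    parallelogram law then leaves 2 (D - d i) + 4 / (i + 1), which \<open>G i\<close>
    dominates.\<close>
  define G where "G i = 4 * (D - d i + inverse (real (Suc i)))" for i
  have G0: "G \<longlonglongrightarrow> 0"
  proof -
    have "G \<longlonglongrightarrow> 4 * (D - D + 0)"
      unfolding G_def by (intro tendsto_intros D(1) LIMSEQ_inverse_real_of_nat)
    then show ?thesis
      by simp
  qed
  have diff: "E (\<lambda>t. W i t - W j t) \<le> G i" if "i \<le> j" for i j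
  proof -
    have Wj: "midpoint_hull V i (W j)"
      using midpoint_hull_mono[OF W[of j] that] .
    note mid = midpoint_hull.mid[OF W[of i] Wj]
    have "E (\<lambda>t. W i t - W j t) = 2 * E (W i) + 2 * E (W j) - 4 * E (\<lambda>t. (1/2) *\<^sub>R (W i t + W j t))"
      unfolding E_def parallelogram_midpoint
      using sq[OF W[of i]] sq[OF Wj] sq[OF mid] by simp
    also have "\<dots> \<le> 2 * (d i + inverse (real (Suc i))) + 2 * (D + inverse (real (Suc i))) - 4 * d i"
    proof -
      have "inverse (real (Suc j)) \<le> inverse (real (Suc i))"
        using that by (intro le_imp_inverse_le) auto
      then have "E (W j) \<le> D + inverse (real (Suc i))"
        using WE[of j] D(2)[of j] by linarith
      then show ?thesis
        using WE[of i] d_le[OF mid] by argo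
    qed
    also have "\<dots> \<le> G i"
      using D(2)[of i] by (simp add: G_def)
    finally show ?thesis .
  qed
  \<comment> \<open>From L^2 to L^1 on a finite measure space through x \<le> \<delta> + x^2 /
    \<delta>, where \<delta> is fixed before the index \<open>i\<close>.\<close>
  have L1: "(\<integral>t. norm (W i t - W j t) \<partial>M) \<le> \<delta> * \<mu> + G i / \<delta>" if "i \<le> j" "\<delta> > 0" for i j \<delta>
  proof -
    have Wj: "midpoint_hull V i (W j)"
      using midpoint_hull_mono[OF W[of j] that(1)] .
    have s: "integrable M (\<lambda>t. (norm (W i t - W j t))\<^sup>2)"
      unfolding parallelogram_midpoint
      using sq[OF W[of i]] sq[OF Wj] sq[OF midpoint_hull.mid[OF W[of i] Wj]] by simp
    have pt: "x \<le> \<delta> + x\<^sup>2 / \<delta>" if "x \<ge> 0" for x :: real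
    proof (cases "x \<le> \<delta>")
      case True
      have "0 \<le> x\<^sup>2 / \<delta>"
        using \<open>\<delta> > 0\<close> by simp
      then show ?thesis
        using True by linarith
    next
      case False
      then have "x * \<delta> \<le> x * x"
        using that by (intro mult_left_mono) auto
      then have "x \<le> x\<^sup>2 / \<delta>"
        using \<open>\<delta> > 0\<close> by (simp add: field_simps power2_eq_square)
      then show ?thesis
        using \<open>\<delta> > 0\<close> by simp
    qed
    have "(\<integral>t. norm (W i t - W j t) \<partial>M) \<le> (\<integral>t. \<delta> + (norm (W i t - W j t))\<^sup>2 / \<delta> \<partial>M)"
      using int[OF W[of i]] int[OF Wj] s pt by (intro integral_mono) auto
    also have "\<dots> = \<delta> * \<mu> + E (\<lambda>t. W i t - W j t) / \<delta>"
      using s by (simp add: \<mu>_def E_def mult.commute)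
    also have "\<dots> \<le> \<delta> * \<mu> + G i / \<delta>"
      using diff[OF that(1)] that(2) by (simp add: divide_right_mono)
    finally show ?thesis .
  qed
  have cau: "\<exists>N. \<forall>i\<ge>N. \<forall>j\<ge>N. (\<integral>t. norm (W i t - W j t) \<partial>M) < e" if e: "e > 0" for e
  proof -
    \<comment> \<open>The 1 keeps the quotient meaningful on a space of measure zero.\<close>
    define \<delta> where "\<delta> = e / (2 * (\<mu> + 1))"
    have \<mu>0: "\<mu> \<ge> 0"
      by (simp add: \<mu>_def)
    have \<delta>: "\<delta> > 0" "\<delta> * \<mu> < e / 2 + e / 4"
    proof -
      show "\<delta> > 0"
        using e \<mu>0 by (simp add: \<delta>_def)
      have "\<delta> * \<mu> \<le> e / 2"
        using e \<mu>0 by (simp add: \<delta>_def field_simps)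
      then show "\<delta> * \<mu> < e / 2 + e / 4"
        using e by linarith
    qed
    have "\<delta> * (e / 4) > 0"
      using \<delta>(1) e by simp
    then have "eventually (\<lambda>i. G i < \<delta> * (e / 4)) sequentially"
      using order_tendstoD(2)[OF G0] by blast
    then obtain N where N: "\<And>i. i \<ge> N \<Longrightarrow> G i < \<delta> * (e / 4)"
      unfolding eventually_sequentially by blast
    have *: "(\<integral>t. norm (W i t - W j t) \<partial>M) < e" if "N \<le> i" "i \<le> j" for i j
    proof -
      have "G i / \<delta> < e / 4"
        using N[OF that(1)] \<delta>(1) by (simp add: field_simps)
      then show ?thesis
        using L1[OF that(2) \<delta>(1)] \<delta>(2) by linarith
    qed
    have "(\<integral>t. norm (W i t - W j t) \<partial>M) < e" if "N \<le> i" "N \<le> j" for i j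
      using *[of i j] *[of j i] that by (cases "i \<le> j") (auto simp: norm_minus_commute)
    then show ?thesis
      by blast
  qed
  \<comment> \<open>A sequence that is Cauchy in L^1 has a subsequence that is Cauchy almost
    everywhere, so pointwise inequalities reach the limit as well as integrated ones.\<close>
  obtain r where r: "strict_mono r" "AE t in M. Cauchy (\<lambda>i. W (r i) t)"
    using cauchy_L1_AE_cauchy_subseq[of M W] int[OF W] cau by blast
  define U where "U t = lim (\<lambda>i. W (r i) t)" for t
  have Wm: "W i \<in> borel_measurable M" for i
    using hm[OF W] .
  have lim: "AE t in M. (\<lambda>i. W (r i) t) \<longlonglongrightarrow> U t"
    using r(2) by eventually_elim (simp add: U_def Cauchy_convergent_iff convergent_LIMSEQ_iff)
  have Um: "U \<in> borel_measurable M"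
    unfolding U_def using Wm by (intro borel_measurable_lim_metric)
  have "AE t in M. \<forall>i. norm (W (r i) t) \<le> B"
    unfolding AE_all_countable using hB[OF W] by blast
  then have WU: "bdd_AE_tendsto M (\<lambda>i. W (r i)) U"
    using Wm Um lim by (intro bdd_AE_tendstoI) auto
  have ri: "i \<le> r i" for i
    using r(1) by (rule seq_suble)
  show thesis
  proof (rule that[OF Um])
    have "AE t in M. \<forall>i. norm (W (r i) t) \<le> B"
      unfolding AE_all_countable using hB[OF W] by blast
    with lim show "AE t in M. norm (U t) \<le> B"
      by eventually_elim (rule LIMSEQ_le_const2[OF tendsto_norm], auto)
  next
    have ptw: "inner (X t) b \<le> c" if "midpoint_hull V n X" "\<forall>j\<ge>n. inner (V j t) b \<le> c" for n X t b c
      using that by (induction rule: midpoint_hull.induct) (auto simp: inner_add_left)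
    \<comment> \<open>The exceptional null set is the one of the pointwise limit, so it is the same
      for all \<open>b\<close> and \<open>c\<close>.\<close>
    show "AE t in M. \<forall>b c. eventually (\<lambda>j. inner (V j t) b \<le> c) sequentially \<longrightarrow> inner (U t) b \<le> c"
      using lim
    proof eventually_elim
      case (elim t)
      show ?case
      proof (intro allI impI)
        fix b c assume "eventually (\<lambda>j. inner (V j t) b \<le> c) sequentially"
        then obtain n where n: "\<forall>j\<ge>n. inner (V j t) b \<le> c"
          unfolding eventually_sequentially by blast
        show "inner (U t) b \<le> c"
        proof (rule LIMSEQ_le_const2)
          show "(\<lambda>i. inner (W (r i) t) b) \<longlonglongrightarrow> inner (U t) b"
            by (intro tendsto_intros elim)
          have "inner (W (r i) t) b \<le> c" if "n \<le> i" for i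
            by (rule ptw[OF W]) (use n ri[of i] that in auto)
          then show "\<exists>N. \<forall>i\<ge>N. inner (W (r i) t) b \<le> c"
            by blast
        qed
      qed
    qed
  next
    fix \<psi> :: "'a \<Rightarrow> 'b" and c C
    assume \<psi>: "\<psi> \<in> borel_measurable M" "AE t in M. norm (\<psi> t) \<le> C"
      and ev: "eventually (\<lambda>j. (\<integral>t. inner (V j t) (\<psi> t) \<partial>M) \<le> c) sequentially"
    have \<psi>c: "bdd_AE_tendsto M (\<lambda>n. \<psi>) \<psi>"
      by (rule bdd_AE_tendsto_const[OF \<psi>])
    have inti: "integrable M (\<lambda>t. inner (X t) (\<psi> t))" if "midpoint_hull V n X" for n X
      by (rule bdd_AE_tendsto_integral(2)[OF bdd_AE_tendsto_inner[OF bdd_AE_tendsto_const[OF hm[OF that] hB[OF that]] \<psi>c]])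
    have ptw: "(\<integral>t. inner (X t) (\<psi> t) \<partial>M) \<le> c" if "midpoint_hull V n X" "\<forall>j\<ge>n. (\<integral>t. inner (V j t) (\<psi> t) \<partial>M) \<le> c" for n X
      using that
    proof (induction rule: midpoint_hull.induct)
      case (mid X Y)
      have "(\<integral>t. inner ((1/2) *\<^sub>R (X t + Y t)) (\<psi> t) \<partial>M) = ((\<integral>t. inner (X t) (\<psi> t) \<partial>M) + (\<integral>t. inner (Y t) (\<psi> t) \<partial>M)) / 2"
        using inti[OF mid(1)] inti[OF mid(2)] by (simp add: inner_add_left)
      then show ?case
        using mid by simp
    qed auto
    obtain n where n: "\<forall>j\<ge>n. (\<integral>t. inner (V j t) (\<psi> t) \<partial>M) \<le> c"
      using ev unfolding eventually_sequentially by blast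
    show "(\<integral>t. inner (U t) (\<psi> t) \<partial>M) \<le> c"
    proof (rule LIMSEQ_le_const2)
      show "(\<lambda>i. \<integral>t. inner (W (r i) t) (\<psi> t) \<partial>M) \<longlonglongrightarrow> (\<integral>t. inner (U t) (\<psi> t) \<partial>M)"
        by (rule bdd_AE_tendsto_integral(1)[OF bdd_AE_tendsto_inner[OF WU \<psi>c]])
      have "(\<integral>t. inner (W (r i) t) (\<psi> t) \<partial>M) \<le> c" if "n \<le> i" for i
        by (rule ptw[OF W]) (use n ri[of i] that in auto)
      then show "\<exists>N. \<forall>i\<ge>N. (\<integral>t. inner (W (r i) t) (\<psi> t) \<partial>M) \<le> c"
        by blast
    qed
  qed
qed

section \<open>Superposition with Caratheodory functions\<close>

text \<open>Completeness of Lebesgue measure; extension by 0 outside the interval reduces the claim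
  to the whole line.\<close>

lemma borel_measurable_AE_LT:
  fixes f g :: "real \<Rightarrow> 'b::euclidean_space"
  assumes f: "f \<in> borel_measurable (LT T)" and eq: "AE t in LT T. f t = g t"
  shows "g \<in> borel_measurable (LT T)"
proof -
  have "AE t in lebesgue. t \<in> {0..T} \<longrightarrow> f t = g t"
    using eq by (subst (asm) AE_restrict_space_iff) auto
  then have "AE t in lebesgue. (if t \<in> {0..T} then f t else 0) = (if t \<in> {0..T} then g t else 0)"
    by eventually_elim auto
  moreover have "(\<lambda>t. if t \<in> {0..T} then f t else 0) \<in> borel_measurable lebesgue"
    using f by (subst borel_measurable_if) auto
  ultimately have "(\<lambda>t. if t \<in> {0..T} then g t else 0) \<in> borel_measurable lebesgue"
    by (rule borel_measurable_AE[rotated])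
  then show ?thesis
    by (subst (asm) borel_measurable_if) auto
qed

text \<open>For an argument with finitely many values the superposition is glued from measurable
  sections. A general argument is a pointwise limit of such ones, and continuity in the first
  variable passes to the limit outside a null set.\<close>

lemma caratheodory_measurable:
  fixes f :: "'a::euclidean_space \<Rightarrow> real \<Rightarrow> 'b::euclidean_space"
  assumes f: "caratheodory T f" and z: "z \<in> borel_measurable (LT T)"
  shows "(\<lambda>t. f (z t) t) \<in> borel_measurable (LT T)"
proof -
  obtain F where F: "\<And>i. simple_function (LT T) (F i)" "\<And>t. t \<in> space (LT T) \<Longrightarrow> (\<lambda>i. F i t) \<longlonglongrightarrow> z t"
    using borel_measurable_implies_sequence_metric[OF z, of 0] by blast
  have Fm: "(\<lambda>t. f (F i t) t) \<in> borel_measurable (LT T)" for i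
  proof (rule measurable_compose_countable'[where I = "F i ` space (LT T)" and g = "F i" and f = f])
    show "f a \<in> borel_measurable (LT T)" if "a \<in> F i ` space (LT T)" for a
      using f unfolding caratheodory_def by blast
    have fin: "finite (F i ` space (LT T))"
      using F(1)[of i] unfolding simple_function_def by blast
    then show "countable (F i ` space (LT T))"
      by (rule countable_finite)
    show "F i \<in> LT T \<rightarrow>\<^sub>M count_space (F i ` space (LT T))"
      unfolding measurable_count_space_eq2[OF fin] using F(1)[of i] unfolding simple_function_def by blast
  qed
  have "AE t in LT T. continuous_on UNIV (\<lambda>a. f a t)"
    using f unfolding caratheodory_def by blast
  then obtain N where N: "{t \<in> space (LT T). \<not> continuous_on UNIV (\<lambda>a. f a t)} \<subseteq> N" "N \<in> null_sets (LT T)"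
    by (auto elim!: AE_E3 simp: eventually_ae_filter)
  \<comment> \<open>The value 0 on a null set containing all failures of continuity makes the
    approximations converge everywhere.\<close>
  define g where "g t = (if t \<in> N then 0 else f (z t) t)" for t
  have "g \<in> borel_measurable (LT T)"
  proof (rule borel_measurable_LIMSEQ_metric)
    show "(\<lambda>t. if t \<in> N then 0 else f (F i t) t) \<in> borel_measurable (LT T)" for i
      using Fm[of i] N(2) by (intro measurable_If_set) auto
    fix t assume t: "t \<in> space (LT T)"
    show "(\<lambda>i. if t \<in> N then 0 else f (F i t) t) \<longlonglongrightarrow> g t"
    proof (cases "t \<in> N")
      case False
      then have "isCont (\<lambda>a. f a t) (z t)"
        using N(1) t by (auto simp: continuous_on_eq_continuous_at)
      then show ?thesis
        using False isCont_tendsto_compose[OF _ F(2)[OF t]] by (simp add: g_def)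
    qed (simp add: g_def)
  qed
  moreover have "AE t in LT T. g t = f (z t) t"
    using AE_not_in[OF N(2)] by eventually_elim (simp add: g_def)
  ultimately show ?thesis
    by (rule borel_measurable_AE_LT)
qed

lemma bdd_AE_tendsto_caratheodory:
  fixes f :: "'a::euclidean_space \<Rightarrow> real \<Rightarrow> 'b::euclidean_space"
  assumes f: "caratheodory T f" and Z: "bdd_AE_tendsto (LT T) Z z"
    and bd: "\<And>R. R > 0 \<Longrightarrow> \<exists>\<gamma>. AE t in LT T. \<forall>a. norm a \<le> R \<longrightarrow> norm (f a t) \<le> \<gamma>"
  shows "bdd_AE_tendsto (LT T) (\<lambda>n t. f (Z n t) t) (\<lambda>t. f (z t) t)"
proof -
  obtain R where R: "R > 0" "AE t in LT T. \<forall>n. norm (Z n t) \<le> R"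
    using bdd_AE_tendstoE[OF Z] .
  obtain \<gamma> where \<gamma>: "AE t in LT T. \<forall>a. norm a \<le> R \<longrightarrow> norm (f a t) \<le> \<gamma>"
    using bd[OF R(1)] by blast
  show ?thesis
  proof (rule bdd_AE_tendstoI)
    show "AE t in LT T. \<forall>n. norm (f (Z n t) t) \<le> \<gamma>"
      using R(2) \<gamma> by eventually_elim auto
    have "AE t in LT T. continuous_on UNIV (\<lambda>a. f a t)"
      using f unfolding caratheodory_def by blast
    with bdd_AE_tendstoD(3)[OF Z] show "AE t in LT T. (\<lambda>n. f (Z n t) t) \<longlonglongrightarrow> f (z t) t"
    proof eventually_elim
      case (elim t)
      have "isCont (\<lambda>a. f a t) (z t)"
        using elim(2) by (simp add: continuous_on_eq_continuous_at)
      from isCont_tendsto_compose[OF this elim(1)] show ?case .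
    qed
  qed (use bdd_AE_tendstoD[OF Z] in \<open>auto intro: caratheodory_measurable[OF f]\<close>)
qed

section \<open>Limits of subgradient selections\<close>

text \<open>Subtracting the affine minorant given by \<open>v\<close> leaves a function with a
  minimum at \<open>z\<close>, whose derivative vanishes there.\<close>

lemma subdiff_GDERIV:
  assumes "GDERIV f z :> D" and v: "v \<in> subdiff f z"
  shows "v = D"
proof -
  have "((\<lambda>y. f y - inner v (y - z)) has_derivative (\<lambda>h. inner h D - inner v h)) (at z)"
    using assms(1) unfolding gderiv_def by (auto intro!: derivative_eq_intros)
  moreover have "f z - inner v (z - z) \<le> f y - inner v (y - z)" for y
    using v by (simp add: subdiff_def algebra_simps)
  ultimately have "(\<lambda>h. inner h D - inner v h) = (\<lambda>h. 0)"
    by (intro has_derivative_local_min[of "\<lambda>y. f y - inner v (y - z)" _ z] always_eventually) auto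
  then have "inner (D - v) D - inner v (D - v) = 0"
    by meson
  then have "inner (D - v) (D - v) = 0"
    by (simp add: inner_diff_right inner_commute)
  then show ?thesis
    by simp
qed

lemma subdiff_limit:
  assumes f: "isCont f z" and z: "Z \<longlonglongrightarrow> z" and v: "V \<longlonglongrightarrow> v" and sub: "\<And>n. V n \<in> subdiff f (Z n)"
  shows "v \<in> subdiff f z"
  unfolding subdiff_def
proof (intro CollectI allI)
  fix y
  have "(\<lambda>n. f (Z n) + inner (V n) (y - Z n)) \<longlonglongrightarrow> f z + inner v (y - z)"
    by (intro tendsto_intros isCont_tendsto_compose[OF f] z v)
  then show "f z + inner v (y - z) \<le> f y"
    by (rule LIMSEQ_le_const2) (use sub in \<open>auto simp: subdiff_def\<close>)
qed

text \<open>Testing the subgradient inequality one unit away from the base point, in the direction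
  of the subgradient, bounds its norm by the oscillation of \<open>f\<close> on a ball of radius
  larger by 1.\<close>

lemma subdiff_bounded:
  fixes f :: "'a::euclidean_space \<Rightarrow> real"
  assumes f: "continuous_on UNIV f" and Z: "bounded (range Z)" and sub: "\<And>n. V n \<in> subdiff f (Z n)"
  shows "bounded (range V)"
proof -
  obtain R where R: "\<And>n. norm (Z n) \<le> R"
    using Z unfolding bounded_iff by blast
  have "bounded (f ` cball 0 (R + 1))"
    by (intro compact_imp_bounded compact_continuous_image continuous_on_subset[OF f]) auto
  then obtain C where C: "\<And>x. norm x \<le> R + 1 \<Longrightarrow> \<bar>f x\<bar> \<le> C"
    unfolding bounded_iff by force
  have "norm (V n) \<le> 2 * C" for n
  proof -
    have "norm (Z n + sgn (V n)) \<le> R + 1"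
      using norm_triangle_ineq[of "Z n" "sgn (V n)"] R[of n] by (simp add: norm_sgn split: if_splits)
    then have "\<bar>f (Z n + sgn (V n))\<bar> \<le> C" "\<bar>f (Z n)\<bar> \<le> C"
      using C R[of n] by (auto simp: add_increasing2)
    moreover have "f (Z n) + inner (V n) (sgn (V n)) \<le> f (Z n + sgn (V n))"
      using sub[of n] unfolding subdiff_def by (metis (mono_tags, lifting) add_diff_cancel_left' mem_Collect_eq)
    moreover have "inner (V n) (sgn (V n)) = norm (V n)"
      by (cases "V n = 0") (simp_all add: sgn_div_norm dot_square_norm power2_eq_square)
    ultimately show ?thesis
      by linarith
  qed
  then show ?thesis
    unfolding bounded_iff by blast
qed

lemma finite_family_convergent_subseq:
  fixes V :: "'i \<Rightarrow> nat \<Rightarrow> 'a::euclidean_space"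
  assumes "finite I" and "\<And>i. i \<in> I \<Longrightarrow> bounded (range (V i))"
  shows "\<exists>r. strict_mono (r :: nat \<Rightarrow> nat) \<and> (\<forall>i\<in>I. convergent (\<lambda>n. V i (r n)))"
  using assms
proof (induction I rule: finite_induct)
  case empty
  show ?case
    by (intro exI[of _ id]) (simp add: strict_mono_def)
next
  case (insert i I)
  then obtain r where r: "strict_mono r" "\<forall>i\<in>I. convergent (\<lambda>n. V i (r n))"
    by auto
  have "bounded (range (\<lambda>n. V i (r n)))"
    by (rule bounded_subset[of "range (V i)"]) (use insert.prems in auto)
  then obtain l q where q: "strict_mono q" "((\<lambda>n. V i (r n)) \<circ> q) \<longlonglongrightarrow> l"
    using bounded_imp_convergent_subsequence by blast
  have "convergent (\<lambda>n. V j (r (q n)))" if "j \<in> I" for j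
    using convergent_subseq_convergent[of "\<lambda>n. V j (r n)" q] r(2) q(1) that by (simp add: o_def)
  moreover have "convergent (\<lambda>n. V i (r (q n)))"
    using q(2) by (auto simp: o_def convergent_def)
  moreover have "strict_mono (\<lambda>n. r (q n))"
    using strict_mono_o[OF r(1) q(1)] by (simp add: o_def)
  ultimately show ?case
    by (intro exI[of _ "\<lambda>n. r (q n)"]) auto
qed

section \<open>Essentially bounded functions and the spaces X and Y\<close>

lemma in_Linf_bounded:
  assumes "in_Linf T f"
  obtains B where "AE t in LT T. norm (f t) \<le> B"
proof -
  have "f \<in> borel_measurable (LT T)" and lt: "esssup (LT T) (\<lambda>t. ereal (norm (f t))) < \<infinity>"
    using assms by (auto simp: in_Linf_def Linf_norm_def)
  then have *: "AE t in LT T. ereal (norm (f t)) \<le> esssup (LT T) (\<lambda>t. ereal (norm (f t)))"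
    by (intro esssup_AE)
  obtain n :: nat where n: "esssup (LT T) (\<lambda>t. ereal (norm (f t))) < ereal (real n)"
    using lt less_PInf_Ex_of_nat by auto
  from * have "AE t in LT T. norm (f t) \<le> real n"
  proof eventually_elim
    case (elim t)
    then have "ereal (norm (f t)) < ereal (real n)"
      using n by (rule le_less_trans)
    then show ?case
      by simp
  qed
  then show thesis
    by (rule that)
qed

lemma finite_measure_LT: "finite_measure (LT T)"
  by (intro finite_measure_lebesgue_on) auto

text \<open>Essential boundedness is expressed by a constant sequence so that the closure rules for
  bounded convergence serve for integrability as well.\<close>

abbreviation ess_bounded :: "'a measure \<Rightarrow> ('a \<Rightarrow> 'b::euclidean_space) \<Rightarrow> bool" where
  "ess_bounded M f \<equiv> bdd_AE_tendsto M (\<lambda>n. f) f"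

lemma in_Linf_ess_bounded:
  fixes f :: "real \<Rightarrow> 'a::euclidean_space"
  assumes "in_Linf T f"
  shows "ess_bounded (LT T) f"
proof -
  obtain B where "AE t in LT T. norm (f t) \<le> B"
    using in_Linf_bounded[OF assms] .
  then show ?thesis
    using assms by (intro bdd_AE_tendsto_const) (auto simp: in_Linf_def)
qed

lemma continuous_on_ess_bounded:
  fixes f :: "real \<Rightarrow> 'a::euclidean_space"
  assumes "continuous_on {0..T} f"
  shows "ess_bounded (LT T) f"
proof -
  have "bounded (f ` {0..T})"
    by (intro compact_imp_bounded compact_continuous_image assms) auto
  then obtain B where "\<And>t. t \<in> {0..T} \<Longrightarrow> norm (f t) \<le> B"
    unfolding bounded_iff by force
  then have "AE t in LT T. norm (f t) \<le> B"
    by (intro AE_I2) auto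
  moreover have "f \<in> borel_measurable (LT T)"
    by (rule continuous_imp_measurable_on_sets_lebesgue[OF assms]) simp
  ultimately show ?thesis
    by (intro bdd_AE_tendsto_const)
qed

lemma X_spaceD:
  assumes "z \<in> X_space T"
  shows "abs_cont_on 0 T (fst z)" and "ess_bounded (LT T) (ddt T (fst z))"
    and "ess_bounded (LT T) (fst z)" and "ess_bounded (LT T) (snd z)" and "ess_bounded (LT T) (val z)"
proof -
  show ac: "abs_cont_on 0 T (fst z)"
    using assms by (auto simp: X_space_def)
  show "ess_bounded (LT T) (ddt T (fst z))"
    using assms by (intro in_Linf_ess_bounded) (auto simp: X_space_def)
  show x: "ess_bounded (LT T) (fst z)"
    by (intro continuous_on_ess_bounded abs_cont_on_imp_continuous_on[OF ac])
  show u: "ess_bounded (LT T) (snd z)"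
    using assms by (intro in_Linf_ess_bounded) (auto simp: X_space_def)
  show "ess_bounded (LT T) (val z)"
    using bdd_AE_tendsto_Pair[OF x u] by (simp add: val_def[abs_def])
qed

lemma ess_bounded_integrable:
  fixes f :: "real \<Rightarrow> 'b::euclidean_space"
  assumes "ess_bounded (LT T) f"
  shows "integrable (LT T) f"
proof -
  obtain B where "AE t in LT T. norm (f t) \<le> B"
    using bdd_AE_tendsto_limit_bounded[OF assms] by blast
  then show ?thesis
    by (rule finite_measure.integrable_const_bound[OF finite_measure_LT _ bdd_AE_tendstoD(2)[OF assms]])
qed

lemma ess_bounded_const: "ess_bounded M (\<lambda>t. c)"
  by (rule bdd_AE_tendsto_const[where B = "norm c"]) auto

text \<open>\<open>Y_dist\<close> contains the derivative of a difference, which is replaced almost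
  everywhere by the difference of the derivatives. The constant 1 / T + 1 comes from averaging over
  an interval of length T.\<close>

lemma Y_dist_bounds:
  assumes z: "z \<in> X_space T" and w: "w \<in> X_space T" and T: "T > 0"
  shows "t \<in> {0..T} \<Longrightarrow> norm (fst z t - fst w t) \<le> (1 / T + 1) * Y_dist T z w"
    and "integ T (\<lambda>t. norm (ddt T (fst z) t - ddt T (fst w) t)) \<le> Y_dist T z w"
    and "integ T (\<lambda>t. norm (snd z t - snd w t)) \<le> Y_dist T z w"
proof -
  \<comment> \<open>Written with the factors 1 and - 1 of \<open>lincomb\<close>, so that
    \<open>Y_dist\<close> unfolds to this very function.\<close>
  define x where "x t = 1 *\<^sub>R fst z t + (- 1) *\<^sub>R fst w t" for t
  have ac: "abs_cont_on 0 T x"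
    unfolding x_def
    by (intro abs_cont_on_add abs_cont_on_bounded_linear[OF _ bounded_linear_scaleR_right] X_spaceD(1)[OF z] X_spaceD(1)[OF w])
  have x: "x t = fst z t - fst w t" for t
    by (simp add: x_def)
  have dx: "AE t in LT T. ddt T x t = ddt T (fst z) t - ddt T (fst w) t"
    using ddt_lincomb[OF X_spaceD(1)[OF z] X_spaceD(1)[OF w] T, of 1 "- 1"] by (simp add: x_def[abs_def])
  have d: "ess_bounded (LT T) (\<lambda>t. ddt T (fst z) t - ddt T (fst w) t)"
    by (intro bdd_AE_tendsto_diff X_spaceD(2)[OF z] X_spaceD(2)[OF w])
  have dm: "ddt T x \<in> borel_measurable (LT T)"
    using dx by (intro borel_measurable_AE_LT[OF bdd_AE_tendstoD(2)[OF d]]) (auto elim: eventually_mono)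
  have dint: "integrable (LT T) (ddt T x)"
    using integrable_cong_AE[OF dm bdd_AE_tendstoD(2)[OF d] dx] ess_bounded_integrable[OF d] by simp
  have Y: "Y_dist T z w = integ T (\<lambda>t. norm (x t)) + integ T (\<lambda>t. norm (ddt T x t)) + integ T (\<lambda>t. norm (snd z t - snd w t))"
    unfolding Y_dist_def Y_norm_def lincomb_def by (simp add: x_def[abs_def])
  have nn: "0 \<le> integ T (\<lambda>t. norm (x t))" "0 \<le> integ T (\<lambda>t. norm (ddt T x t))" "0 \<le> integ T (\<lambda>t. norm (snd z t - snd w t))"
    by (auto intro: integral_nonneg_AE)
  have deq: "integ T (\<lambda>t. norm (ddt T x t)) = integ T (\<lambda>t. norm (ddt T (fst z) t - ddt T (fst w) t))"
    using dx dm bdd_AE_tendstoD(2)[OF d] by (intro integral_cong_AE) (auto elim: eventually_mono)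
  show "integ T (\<lambda>t. norm (ddt T (fst z) t - ddt T (fst w) t)) \<le> Y_dist T z w"
    using Y nn deq by linarith
  show "integ T (\<lambda>t. norm (snd z t - snd w t)) \<le> Y_dist T z w"
    using Y nn by linarith
  assume t: "t \<in> {0..T}"
  have "norm (fst z t - fst w t) \<le> integ T (\<lambda>t. norm (x t)) / T + integ T (\<lambda>t. norm (ddt T x t))"
    using abs_cont_norm_le[OF ac T dint t] by (simp add: x)
  also have "\<dots> \<le> Y_dist T z w / T + Y_dist T z w"
    using Y nn T by (intro add_mono divide_right_mono) auto
  finally show "norm (fst z t - fst w t) \<le> (1 / T + 1) * Y_dist T z w"
    by (simp add: algebra_simps)
qed

lemma bdd_AE_tendsto_limit_ess_bounded:
  assumes "bdd_AE_tendsto M F f"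
  shows "ess_bounded M f"
proof -
  obtain B where "AE t in M. norm (f t) \<le> B"
    by (rule bdd_AE_tendsto_limit_bounded[OF assms])
  then show ?thesis
    by (rule bdd_AE_tendsto_const[OF bdd_AE_tendstoD(2)[OF assms]])
qed

section \<open>Selections along a boundedly convergent sequence\<close>

lemma data_funs_bounded:
  assumes "data_assumptions P" and "R > 0"
  shows "\<exists>\<gamma>. AE t in LT (hor P). \<forall>a. norm a \<le> R \<longrightarrow>
    (\<forall>f\<in>data_funs P. norm (f a t) \<le> \<gamma> \<and> (\<forall>v\<in>subdiff (\<lambda>a. f a t) a. norm v \<le> \<gamma>))"
proof -
  \<comment> \<open>The data assumption restricts \<bar>x\<bar> + \<bar>u\<bar>, while
    \<open>a\<close> is measured by the norm of the pair. Each component is at most that norm, hence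
    the factor 2.\<close>
  have "2 * R > 0"
    using assms(2) by simp
  then obtain \<gamma> where \<gamma>: "AE t in LT (hor P). \<forall>x u. norm x + norm u \<le> 2 * R \<longrightarrow>
    (\<forall>f\<in>data_funs P. \<bar>f (x, u) t\<bar> \<le> \<gamma> \<and> (\<forall>v\<in>subdiff (\<lambda>a. f a t) (x, u). norm v \<le> \<gamma>))"
    using assms(1) unfolding data_assumptions_def by blast
  have le: "norm (fst a) + norm (snd a) \<le> 2 * R" if "norm a \<le> R" for a :: "(real^'a) \<times> (real^'b)"
    using norm_fst_le[of "fst a" "snd a"] norm_snd_le[of "snd a" "fst a"] that by simp
  show ?thesis
    by (rule exI[of _ \<gamma>], rule eventually_mono[OF \<gamma>]) (metis le prod.collapse real_norm_def)
qed

lemma data_funs_bdd_AE_tendsto: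
  assumes P: "data_assumptions P" and f: "f \<in> data_funs P" and Z: "bdd_AE_tendsto (LT (hor P)) Z z"
  shows "bdd_AE_tendsto (LT (hor P)) (\<lambda>n t. f (Z n t) t) (\<lambda>t. f (z t) t)"
proof (rule bdd_AE_tendsto_caratheodory[OF _ Z])
  show "caratheodory (hor P) f"
    using P f unfolding data_assumptions_def by blast
  fix R :: real assume "R > 0"
  from data_funs_bounded[OF P this] obtain \<gamma> where "AE t in LT (hor P). \<forall>a. norm a \<le> R \<longrightarrow>
    (\<forall>f\<in>data_funs P. norm (f a t) \<le> \<gamma> \<and> (\<forall>v\<in>subdiff (\<lambda>a. f a t) a. norm v \<le> \<gamma>))" ..
  then show "\<exists>\<gamma>. AE t in LT (hor P). \<forall>a. norm a \<le> R \<longrightarrow> norm (f a t) \<le> \<gamma>"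
    using f by (intro exI[of _ \<gamma>]) (auto elim: eventually_mono)
qed

text \<open>One constant serves all indices because the points stay in a common ball almost
  everywhere, and countably many null sets are discarded.\<close>

lemma selections_bounded:
  assumes P: "data_assumptions P" and f: "f \<in> data_funs P" and Z: "bdd_AE_tendsto (LT (hor P)) (\<lambda>k. val (zs k)) z"
    and sel: "\<And>k. subgrad_selection P (zs k) f (vs k)"
  obtains \<gamma> where "AE t in LT (hor P). \<forall>k. norm (vs k t) \<le> \<gamma>"
proof -
  obtain R where R: "R > 0" "AE t in LT (hor P). \<forall>n. norm (val (zs n) t) \<le> R"
    using bdd_AE_tendstoE[OF Z] .
  from data_funs_bounded[OF P R(1)] obtain \<gamma> where \<gamma>: "AE t in LT (hor P). \<forall>a. norm a \<le> R \<longrightarrow>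
    (\<forall>f\<in>data_funs P. norm (f a t) \<le> \<gamma> \<and> (\<forall>v\<in>subdiff (\<lambda>a. f a t) a. norm v \<le> \<gamma>))" ..
  have "AE t in LT (hor P). \<forall>k. vs k t \<in> subdiff (\<lambda>a. f a t) (val (zs k) t)"
    unfolding AE_all_countable using sel by (simp add: subgrad_selection_def)
  with R(2) \<gamma> have "AE t in LT (hor P). \<forall>k. norm (vs k t) \<le> \<gamma>"
    by eventually_elim (use f in blast)
  then show thesis
    by (rule that)
qed

lemma selection_ess_bounded:
  assumes P: "data_assumptions P" and f: "f \<in> data_funs P" and z: "z \<in> X_space (hor P)"
    and sel: "subgrad_selection P z f v"
  shows "ess_bounded (LT (hor P)) v"
proof -
  obtain \<gamma> where "AE t in LT (hor P). \<forall>k::nat. norm (v t) \<le> \<gamma>"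
    using selections_bounded[OF P f X_spaceD(5)[OF z], of "\<lambda>k. v"] sel by blast
  then have "AE t in LT (hor P). norm (v t) \<le> \<gamma>"
    by simp
  then show ?thesis
    using sel by (intro bdd_AE_tendsto_const) (auto simp: subgrad_selection_def)
qed

text \<open>Almost everywhere the subgradients are gradients, so each selection is the gradient
  along the sequence, and continuity of the gradient makes the selections themselves converge. The
  limit is a subgradient by closedness of the subdifferential.\<close>

lemma smooth_selection_limit:
  assumes P: "data_assumptions P" and f: "f \<in> data_funs P"
    and Z: "bdd_AE_tendsto (LT (hor P)) (\<lambda>k. val (zs k)) (val z)"
    and sel: "\<And>k. subgrad_selection P (zs k) f (vs k)"
    and smooth: "smooth_caratheodory (hor P) f"
  shows "\<exists>v. subgrad_selection P z f v \<and> bdd_AE_tendsto (LT (hor P)) vs v"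
proof -
  let ?M = "LT (hor P)"
  obtain D where D: "AE t in ?M. \<forall>z. GDERIV (\<lambda>y. f y t) z :> D z t"
    and D1: "caratheodory (hor P) (\<lambda>z t. fst (D z t))" and D2: "caratheodory (hor P) (\<lambda>z t. snd (D z t))"
    using smooth unfolding smooth_caratheodory_def by blast
  define v where "v t = D (val z t) t" for t
  obtain \<gamma> where \<gamma>: "AE t in ?M. \<forall>k. norm (vs k t) \<le> \<gamma>"
    using selections_bounded[OF P f Z sel] .
  have vsm: "vs k \<in> borel_measurable ?M" for k
    using sel[of k] by (simp add: subgrad_selection_def)
  have vs: "AE t in ?M. \<forall>k. vs k t \<in> subdiff (\<lambda>a. f a t) (val (zs k) t)"
    unfolding AE_all_countable using sel by (simp add: subgrad_selection_def)
  have zm: "val z \<in> borel_measurable ?M"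
    by (rule bdd_AE_tendstoD(2)[OF Z])
  have vm: "v \<in> borel_measurable ?M"
    using borel_measurable_Pair[OF caratheodory_measurable[OF D1 zm] caratheodory_measurable[OF D2 zm]]
    by (simp add: v_def[abs_def])
  have c1: "AE t in ?M. continuous_on UNIV (\<lambda>z. fst (D z t))"
    using D1 unfolding caratheodory_def by blast
  have c2: "AE t in ?M. continuous_on UNIV (\<lambda>z. snd (D z t))"
    using D2 unfolding caratheodory_def by blast
  have lim: "AE t in ?M. (\<lambda>k. vs k t) \<longlonglongrightarrow> v t"
    using D c1 c2 vs bdd_AE_tendstoD(3)[OF Z]
  proof eventually_elim
    case (elim t)
    have eq: "vs k t = D (val (zs k) t) t" for k
      using subdiff_GDERIV elim(1,4) by blast
    have "isCont (\<lambda>z. fst (D z t)) (val z t)" "isCont (\<lambda>z. snd (D z t)) (val z t)"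
      using elim(2,3) continuous_on_eq_continuous_at[OF open_UNIV] by blast+
    from tendsto_Pair[OF isCont_tendsto_compose[OF this(1) elim(5)] isCont_tendsto_compose[OF this(2) elim(5)]]
    show ?case
      by (simp add: eq v_def)
  qed
  have "AE t in ?M. continuous_on UNIV (\<lambda>a. f a t)"
    using P f unfolding data_assumptions_def caratheodory_def by blast
  with lim vs bdd_AE_tendstoD(3)[OF Z] have "AE t in ?M. v t \<in> subdiff (\<lambda>a. f a t) (val z t)"
  proof eventually_elim
    case (elim t)
    have "isCont (\<lambda>a. f a t) (val z t)"
      using elim(4) continuous_on_eq_continuous_at[OF open_UNIV] by blast
    then show ?case
      by (rule subdiff_limit[OF _ elim(3) elim(1)]) (use elim(2) in blast)
  qed
  with vm have "subgrad_selection P z f v"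
    by (simp add: subgrad_selection_def)
  moreover have "bdd_AE_tendsto ?M vs v"
    by (rule bdd_AE_tendstoI[OF vsm vm lim \<gamma>])
  ultimately show ?thesis
    by blast
qed

text \<open>With the base point frozen at its limit, the subgradient inequality at \<open>a\<close>
  is a linear constraint on the subgradient, at the cost of \<gamma> times the distance of the base
  points plus a change of function value. It holds eventually up to any \<eta>, and weak cluster
  points inherit such constraints.\<close>

lemma weak_selection_limit:
  assumes P: "data_assumptions P" and f: "f \<in> data_funs P"
    and Z: "bdd_AE_tendsto (LT (hor P)) (\<lambda>k. val (zs k)) (val z)"
    and sel: "\<And>k. subgrad_selection P (zs k) f (vs k)"
  obtains v where "subgrad_selection P z f v"
    and "\<And>\<psi> c. ess_bounded (LT (hor P)) \<psi> \<Longrightarrow>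
      eventually (\<lambda>k. integ (hor P) (\<lambda>t. inner (vs k t) (\<psi> t)) \<le> c) sequentially \<Longrightarrow>
      integ (hor P) (\<lambda>t. inner (v t) (\<psi> t)) \<le> c"
proof -
  let ?M = "LT (hor P)"
  obtain \<gamma> where \<gamma>: "AE t in ?M. \<forall>k. norm (vs k t) \<le> \<gamma>"
    using selections_bounded[OF P f Z sel] .
  have vsm: "vs k \<in> borel_measurable ?M" for k
    using sel[of k] by (simp add: subgrad_selection_def)
  have vsb: "AE t in ?M. norm (vs k t) \<le> \<gamma>" for k
    using \<gamma> by eventually_elim blast
  have vs: "AE t in ?M. \<forall>k. vs k t \<in> subdiff (\<lambda>a. f a t) (val (zs k) t)"
    unfolding AE_all_countable using sel by (simp add: subgrad_selection_def)
  obtain v where v: "v \<in> borel_measurable ?M" "AE t in ?M. norm (v t) \<le> \<gamma>"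
    "AE t in ?M. \<forall>b c. eventually (\<lambda>j. inner (vs j t) b \<le> c) sequentially \<longrightarrow> inner (v t) b \<le> c"
    and vw: "\<And>\<psi> c C. \<psi> \<in> borel_measurable ?M \<Longrightarrow> AE t in ?M. norm (\<psi> t) \<le> C \<Longrightarrow>
       eventually (\<lambda>j. (\<integral>t. inner (vs j t) (\<psi> t) \<partial>?M) \<le> c) sequentially \<Longrightarrow> (\<integral>t. inner (v t) (\<psi> t) \<partial>?M) \<le> c"
    by (rule finite_measure.bounded_seq_weak_cluster[where V = vs, OF finite_measure_LT vsm vsb]) (rule that)
  have "AE t in ?M. continuous_on UNIV (\<lambda>a. f a t)"
    using P f unfolding data_assumptions_def caratheodory_def by blast
  with \<gamma> vs v(3) bdd_AE_tendstoD(3)[OF Z] have "AE t in ?M. v t \<in> subdiff (\<lambda>a. f a t) (val z t)"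
  proof eventually_elim
    case (elim t)
    let ?z = "\<lambda>k. val (zs k) t"
    have cont: "isCont (\<lambda>a. f a t) (val z t)"
      using elim(5) continuous_on_eq_continuous_at[OF open_UNIV] by blast
    show ?case
      unfolding subdiff_def
    proof (intro CollectI allI)
      fix a
      have lim: "(\<lambda>k. f a t - f (?z k) t + \<gamma> * norm (?z k - val z t)) \<longlonglongrightarrow> f a t - f (val z t) t + \<gamma> * norm (val z t - val z t)"
        by (intro tendsto_intros isCont_tendsto_compose[OF cont] elim(4))
      have le: "inner (vs k t) (a - val z t) \<le> f a t - f (?z k) t + \<gamma> * norm (?z k - val z t)" for k
      proof -
        have "f (?z k) t + inner (vs k t) (a - ?z k) \<le> f a t"
          using elim(2) unfolding subdiff_def by blast
        moreover have "inner (vs k t) (?z k - val z t) \<le> \<gamma> * norm (?z k - val z t)"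
          using norm_cauchy_schwarz[of "vs k t" "?z k - val z t"] elim(1)
          by (meson mult_right_mono norm_ge_zero order_trans)
        moreover have "inner (vs k t) (a - val z t) = inner (vs k t) (a - ?z k) + inner (vs k t) (?z k - val z t)"
          by (simp add: inner_diff_right)
        ultimately show ?thesis
          by linarith
      qed
      have "inner (v t) (a - val z t) \<le> f a t - f (val z t) t + \<eta>" if "\<eta> > 0" for \<eta>
      proof -
        have "eventually (\<lambda>k. f a t - f (?z k) t + \<gamma> * norm (?z k - val z t) < f a t - f (val z t) t + \<eta>) sequentially"
          by (rule order_tendstoD(2)[OF lim]) (use that in simp)
        then have "eventually (\<lambda>k. inner (vs k t) (a - val z t) \<le> f a t - f (val z t) t + \<eta>) sequentially"
          by eventually_elim (use le in \<open>meson less_imp_le order_trans\<close>)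
        then show ?thesis
          using elim(3) by blast
      qed
      then have "inner (v t) (a - val z t) \<le> f a t - f (val z t) t"
        by (rule field_le_epsilon)
      then show "f (val z t) t + inner (v t) (a - val z t) \<le> f a t"
        by simp
    qed
  qed
  with v(1) have sel: "subgrad_selection P z f v"
    by (simp add: subgrad_selection_def)
  show thesis
  proof (rule that[OF sel])
    fix \<psi> c
    assume \<psi>: "ess_bounded ?M \<psi>" and ev: "eventually (\<lambda>k. integ (hor P) (\<lambda>t. inner (vs k t) (\<psi> t)) \<le> c) sequentially"
    obtain C where "AE t in ?M. norm (\<psi> t) \<le> C"
      using bdd_AE_tendsto_limit_bounded[OF \<psi>] by blast
    from vw[OF bdd_AE_tendstoD(2)[OF \<psi>] this ev] show "integ (hor P) (\<lambda>t. inner (v t) (\<psi> t)) \<le> c" .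
  qed
qed

section \<open>Passage to the limit in the majorant\<close>

text \<open>With equal arguments all increments vanish, and the maximum of a number and its negative
  is the absolute value. Thus the majorant is exact at its base point.\<close>

lemma Gam_self: "Gam P z z V = phi P z"
proof -
  have "max (d + h - g) (- d + g - h) = \<bar>d - (g - h)\<bar>" "max (g - h) (h - g) = \<bar>g - h\<bar>" for d g h :: real
    by (auto simp: max_def abs_if)
  then show ?thesis
    by (simp add: Gam_def phi_def Let_def Fc_def endf_def Xi_def)
qed

text \<open>The part of \<open>omega\<close> that does not involve \<open>V\<^sub>0\<close>, along which only weak limits are available.\<close>

definition omega_pointwise_part :: "('n::finite, 'm::finite) ocp \<Rightarrow> ('n, 'm) process \<Rightarrow> (real^'n) \<times> (real^'n) \<Rightarrow> real" where
  "omega_pointwise_part P w v0 = integ (hor P) (\<lambda>t. G0f P (val w t) t) + gf P 0 (ends (hor P) w) - inner v0 (ends (hor P) w)"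

lemma omega_eq:
  assumes P: "data_assumptions P" and w: "w \<in> X_space (hor P)" and v: "ess_bounded (LT (hor P)) (sV0 V)"
  shows "omega P w V = omega_pointwise_part P w (sv V 0) - integ (hor P) (\<lambda>t. inner (sV0 V t) (val w t))"
proof -
  have G: "ess_bounded (LT (hor P)) (\<lambda>t. G0f P (val w t) t)"
    by (rule data_funs_bdd_AE_tendsto[OF P _ X_spaceD(5)[OF w]]) (simp add: data_funs_def)
  show ?thesis
    using ess_bounded_integrable[OF G] ess_bounded_integrable[OF bdd_AE_tendsto_inner[OF v X_spaceD(5)[OF w]]]
    by (simp add: omega_def omega_pointwise_part_def)
qed

lemma endfun_continuous:
  assumes "ocp_structure P" and "i \<le> lE P"
  shows "continuous_on UNIV (gf P i)" and "continuous_on UNIV (hf P i)"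
  using assms unfolding ocp_structure_def by (auto intro: convex_on_continuous)

lemma ix_le_lE: "ocp_structure P \<Longrightarrow> i \<in> ineq_ix P \<Longrightarrow> i \<le> lE P" "i \<in> eq_ix P \<Longrightarrow> i \<le> lE P"
  by (auto simp: ocp_structure_def ineq_ix_def eq_ix_def)

lemma tendsto_endfun:
  assumes "ocp_structure P" and "i \<le> lE P" and b: "b \<longlonglongrightarrow> b0"
  shows "(\<lambda>k. gf P i (b k)) \<longlonglongrightarrow> gf P i b0" and "(\<lambda>k. hf P i (b k)) \<longlonglongrightarrow> hf P i b0"
  using isCont_tendsto_compose[OF _ b] endfun_continuous[OF assms(1,2)]
    continuous_on_eq_continuous_at[OF open_UNIV] by blast+

lemma data_funs_mem:
  "G0f P \<in> data_funs P" "H0f P \<in> data_funs P" "Gf P i \<in> data_funs P" "Hf P i \<in> data_funs P"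
  "s \<in> mixed_ix P \<Longrightarrow> pf P s \<in> data_funs P" "s \<in> mixed_ix P \<Longrightarrow> qf P s \<in> data_funs P"
  by (auto simp: data_funs_def)

lemma bdd_AE_tendsto_component: "bdd_AE_tendsto M F f \<Longrightarrow> bdd_AE_tendsto M (\<lambda>n t. F n t $ i) (\<lambda>t. f t $ i)"
  for f :: "'a \<Rightarrow> real^'n::finite"
  by (rule bdd_AE_tendsto_compose[where h = "\<lambda>v. v $ i"]) (auto intro!: continuous_intros)

lemma bdd_AE_tendsto_uminus: "bdd_AE_tendsto M F f \<Longrightarrow> bdd_AE_tendsto M (\<lambda>n t. - F n t) (\<lambda>t. - f t)"
  by (rule bdd_AE_tendsto_compose[where h = uminus]) (auto intro!: continuous_intros)

lemma bdd_AE_tendsto_abs: "bdd_AE_tendsto M F f \<Longrightarrow> bdd_AE_tendsto M (\<lambda>n t. \<bar>F n t\<bar>) (\<lambda>t. \<bar>f t\<bar>)" for f :: "'a \<Rightarrow> real"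
  by (rule bdd_AE_tendsto_compose[where h = abs]) (auto intro!: continuous_intros)

text \<open>The derivatives converge in L^1 only, everything else boundedly almost everywhere. The
  integrand with the dynamics is Lipschitz in both, so the two errors are estimated separately and
  added.\<close>

lemma phi_tendsto:
  assumes S: "ocp_structure P" and P: "data_assumptions P"
    and zs: "\<And>k. zs k \<in> X_space (hor P)" and z: "z \<in> X_space (hor P)"
    and Z: "bdd_AE_tendsto (LT (hor P)) (\<lambda>k. val (zs k)) (val z)"
    and dd: "(\<lambda>k. integ (hor P) (\<lambda>t. norm (ddt (hor P) (fst (zs k)) t - ddt (hor P) (fst z) t))) \<longlonglongrightarrow> 0"
    and ends: "(\<lambda>k. ends (hor P) (zs k)) \<longlonglongrightarrow> ends (hor P) z"
  shows "(\<lambda>k. phi P (zs k)) \<longlonglongrightarrow> phi P z"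
  unfolding phi_def
proof (intro tendsto_add tendsto_sum)
  let ?M = "LT (hor P)"
  fix i :: 'a
  let ?A = "\<lambda>z t. ddt (hor P) (fst z) t $ i - Fc P i (val z t) t"
  have F: "bdd_AE_tendsto ?M (\<lambda>k t. Fc P i (val (zs k) t) t) (\<lambda>t. Fc P i (val z t) t)"
    unfolding Fc_def by (intro bdd_AE_tendsto_diff data_funs_bdd_AE_tendsto[OF P _ Z] data_funs_mem)
  have FA: "bdd_AE_tendsto ?M (\<lambda>k t. \<bar>Fc P i (val (zs k) t) t - Fc P i (val z t) t\<bar>) (\<lambda>t. \<bar>Fc P i (val z t) t - Fc P i (val z t) t\<bar>)"
    by (intro bdd_AE_tendsto_abs bdd_AE_tendsto_diff F bdd_AE_tendsto_limit_ess_bounded[OF F])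
  have Fw: "ess_bounded ?M (\<lambda>t. Fc P i (val w t) t)" if "w \<in> X_space (hor P)" for w
    unfolding Fc_def by (intro bdd_AE_tendsto_diff data_funs_bdd_AE_tendsto[OF P _ X_spaceD(5)[OF that]] data_funs_mem)
  have A: "ess_bounded ?M (?A w)" if "w \<in> X_space (hor P)" for w
    by (intro bdd_AE_tendsto_diff bdd_AE_tendsto_component X_spaceD(2)[OF that] Fw[OF that])
  let ?b = "\<lambda>k. integ (hor P) (\<lambda>t. norm (ddt (hor P) (fst (zs k)) t - ddt (hor P) (fst z) t))
      + integ (hor P) (\<lambda>t. \<bar>Fc P i (val (zs k) t) t - Fc P i (val z t) t\<bar>)"
  have le: "norm (integ (hor P) (\<lambda>t. \<bar>?A (zs k) t\<bar>) - integ (hor P) (\<lambda>t. \<bar>?A z t\<bar>)) \<le> ?b k" for k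
  proof -
    have i1: "integrable ?M (\<lambda>t. \<bar>?A (zs k) t\<bar>)" "integrable ?M (\<lambda>t. \<bar>?A z t\<bar>)"
      by (intro ess_bounded_integrable bdd_AE_tendsto_abs A zs z)+
    have i2: "integrable ?M (\<lambda>t. norm (ddt (hor P) (fst (zs k)) t - ddt (hor P) (fst z) t))"
      by (intro integrable_norm ess_bounded_integrable bdd_AE_tendsto_diff X_spaceD(2) zs z)
    have i3: "integrable ?M (\<lambda>t. \<bar>Fc P i (val (zs k) t) t - Fc P i (val z t) t\<bar>)"
      by (intro ess_bounded_integrable bdd_AE_tendsto_abs bdd_AE_tendsto_diff Fw zs z)
    have "norm (integ (hor P) (\<lambda>t. \<bar>?A (zs k) t\<bar>) - integ (hor P) (\<lambda>t. \<bar>?A z t\<bar>))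
        = norm (integ (hor P) (\<lambda>t. \<bar>?A (zs k) t\<bar> - \<bar>?A z t\<bar>))"
      using i1 by simp
    also have "\<dots> \<le> integ (hor P) (\<lambda>t. norm (ddt (hor P) (fst (zs k)) t - ddt (hor P) (fst z) t)
        + \<bar>Fc P i (val (zs k) t) t - Fc P i (val z t) t\<bar>)"
    proof (rule Bochner_Integration.integral_norm_bound_integral)
      fix t
      have "\<bar>(ddt (hor P) (fst (zs k)) t - ddt (hor P) (fst z) t) $ i\<bar> \<le> norm (ddt (hor P) (fst (zs k)) t - ddt (hor P) (fst z) t)"
        by (rule component_le_norm_cart)
      then show "norm (\<bar>?A (zs k) t\<bar> - \<bar>?A z t\<bar>) \<le> norm (ddt (hor P) (fst (zs k)) t - ddt (hor P) (fst z) t)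
        + \<bar>Fc P i (val (zs k) t) t - Fc P i (val z t) t\<bar>"
        by simp
    qed (use i1 i2 i3 in auto)
    also have "\<dots> = ?b k"
      using i2 i3 by simp
    finally show ?thesis .
  qed
  have "?b \<longlonglongrightarrow> 0 + integ (hor P) (\<lambda>t. \<bar>Fc P i (val z t) t - Fc P i (val z t) t\<bar>)"
    by (intro tendsto_add dd finite_measure.bdd_AE_tendsto_integral(1)[OF finite_measure_LT FA])
  then have "?b \<longlonglongrightarrow> 0"
    by simp
  then have "(\<lambda>k. integ (hor P) (\<lambda>t. \<bar>?A (zs k) t\<bar>) - integ (hor P) (\<lambda>t. \<bar>?A z t\<bar>)) \<longlonglongrightarrow> 0"
    by (rule Lim_null_comparison[OF always_eventually[OF allI[OF le]]])
  then show "(\<lambda>k. integ (hor P) (\<lambda>t. \<bar>?A (zs k) t\<bar>)) \<longlonglongrightarrow> integ (hor P) (\<lambda>t. \<bar>?A z t\<bar>)"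
    by (rule LIM_zero_cancel)
next
  fix i assume "i \<in> ineq_ix P"
  then show "(\<lambda>k. max 0 (endf P i (ends (hor P) (zs k)))) \<longlonglongrightarrow> max 0 (endf P i (ends (hor P) z))"
    unfolding endf_def by (intro tendsto_intros tendsto_endfun[OF S _ ends] ix_le_lE(1)[OF S])
next
  fix j assume "j \<in> eq_ix P"
  then show "(\<lambda>k. \<bar>endf P j (ends (hor P) (zs k))\<bar>) \<longlonglongrightarrow> \<bar>endf P j (ends (hor P) z)\<bar>"
    unfolding endf_def by (intro tendsto_intros tendsto_endfun[OF S _ ends] ix_le_lE(2))
next
  fix s assume s: "s \<in> mixed_ix P"
  show "(\<lambda>k. integ (hor P) (\<lambda>t. max 0 (Xi P s (val (zs k) t) t))) \<longlonglongrightarrow> integ (hor P) (\<lambda>t. max 0 (Xi P s (val z t) t))"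
    unfolding Xi_def
    by (intro finite_measure.bdd_AE_tendsto_integral(1)[OF finite_measure_LT] bdd_AE_tendsto_max bdd_AE_tendsto_diff ess_bounded_const
         data_funs_bdd_AE_tendsto[OF P _ Z] data_funs_mem s)
qed

text \<open>The competitor \<open>w\<close> stays fixed, so its derivative is a constant sequence,
  and every integrand is a continuous expression in boundedly convergent functions.\<close>

lemma Gam_tendsto:
  assumes S: "ocp_structure P" and P: "data_assumptions P" and w: "w \<in> X_space (hor P)"
    and Z: "bdd_AE_tendsto (LT (hor P)) (\<lambda>k. val (zs k)) (val z)"
    and ends: "(\<lambda>k. ends (hor P) (zs k)) \<longlonglongrightarrow> ends (hor P) z"
    and sV: "\<And>i. bdd_AE_tendsto (LT (hor P)) (\<lambda>k. sV (Vs k) i) (sV V i)"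
    and sW: "\<And>i. bdd_AE_tendsto (LT (hor P)) (\<lambda>k. sW (Vs k) i) (sW V i)"
    and sz: "\<And>s. s \<in> mixed_ix P \<Longrightarrow> bdd_AE_tendsto (LT (hor P)) (\<lambda>k. sz (Vs k) s) (sz V s)"
    and sv: "\<And>i. i \<le> lE P \<Longrightarrow> (\<lambda>k. sv (Vs k) i) \<longlonglongrightarrow> sv V i"
    and sw: "\<And>j. j \<in> eq_ix P \<Longrightarrow> (\<lambda>k. sw (Vs k) j) \<longlonglongrightarrow> sw V j"
  shows "(\<lambda>k. Gam P w (zs k) (Vs k)) \<longlonglongrightarrow> Gam P w z V"
  unfolding Gam_def Let_def
proof (intro tendsto_add tendsto_sum)
  note bi = finite_measure.bdd_AE_tendsto_integral(1)[OF finite_measure_LT]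
  note W = X_spaceD(5)[OF w]
  fix i :: 'a
  show "(\<lambda>k. integ (hor P) (\<lambda>t. max
          (ddt (hor P) (fst w) t $ i + Hf P i (val w t) t - Gf P i (val (zs k) t) t - inner (sW (Vs k) i t) (val w t - val (zs k) t))
          (- (ddt (hor P) (fst w) t $ i) + Gf P i (val w t) t - Hf P i (val (zs k) t) t - inner (sV (Vs k) i t) (val w t - val (zs k) t))))
     \<longlonglongrightarrow> integ (hor P) (\<lambda>t. max
          (ddt (hor P) (fst w) t $ i + Hf P i (val w t) t - Gf P i (val z t) t - inner (sW V i t) (val w t - val z t))
          (- (ddt (hor P) (fst w) t $ i) + Gf P i (val w t) t - Hf P i (val z t) t - inner (sV V i t) (val w t - val z t)))"
    by (intro bi bdd_AE_tendsto_max bdd_AE_tendsto_diff bdd_AE_tendsto_add bdd_AE_tendsto_inner bdd_AE_tendsto_uminus bdd_AE_tendsto_component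
        X_spaceD(2)[OF w] W Z sV sW data_funs_bdd_AE_tendsto[OF P _ Z] data_funs_bdd_AE_tendsto[OF P _ W] data_funs_mem)
next
  fix i assume i: "i \<in> ineq_ix P"
  show "(\<lambda>k. max 0 (gf P i (ends (hor P) w) - hf P i (ends (hor P) (zs k)) - inner (sv (Vs k) i) (ends (hor P) w - ends (hor P) (zs k))))
     \<longlonglongrightarrow> max 0 (gf P i (ends (hor P) w) - hf P i (ends (hor P) z) - inner (sv V i) (ends (hor P) w - ends (hor P) z))"
    by (intro tendsto_intros tendsto_endfun[OF S _ ends] ends sv ix_le_lE(1)[OF S] i)
next
  fix j assume j: "j \<in> eq_ix P"
  show "(\<lambda>k. max (gf P j (ends (hor P) w) - hf P j (ends (hor P) (zs k)) - inner (sv (Vs k) j) (ends (hor P) w - ends (hor P) (zs k)))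
          (hf P j (ends (hor P) w) - gf P j (ends (hor P) (zs k)) - inner (sw (Vs k) j) (ends (hor P) w - ends (hor P) (zs k))))
     \<longlonglongrightarrow> max (gf P j (ends (hor P) w) - hf P j (ends (hor P) z) - inner (sv V j) (ends (hor P) w - ends (hor P) z))
          (hf P j (ends (hor P) w) - gf P j (ends (hor P) z) - inner (sw V j) (ends (hor P) w - ends (hor P) z))"
    by (intro tendsto_intros tendsto_endfun[OF S _ ends] ends sv sw ix_le_lE(2) j)
next
  note bi = finite_measure.bdd_AE_tendsto_integral(1)[OF finite_measure_LT]
  note W = X_spaceD(5)[OF w]
  fix s assume s: "s \<in> mixed_ix P"
  show "(\<lambda>k. integ (hor P) (\<lambda>t. max 0 (pf P s (val w t) t - qf P s (val (zs k) t) t - inner (sz (Vs k) s t) (val w t - val (zs k) t))))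
     \<longlonglongrightarrow> integ (hor P) (\<lambda>t. max 0 (pf P s (val w t) t - qf P s (val z t) t - inner (sz V s t) (val w t - val z t)))"
    by (intro bi bdd_AE_tendsto_max bdd_AE_tendsto_diff bdd_AE_tendsto_inner ess_bounded_const W Z sz
        data_funs_bdd_AE_tendsto[OF P _ Z] data_funs_bdd_AE_tendsto[OF P _ W] data_funs_mem s)
qed

text \<open>The collection \<open>V\<close> must be found before the competitor \<open>w\<close>;
  this is possible because the weak limit of the selections V_0 respects inequalities against all
  bounded test functions at once. The optimality inequality is rearranged so that V_0 is paired with
  w - z, while the remaining terms converge.\<close>

lemma eps_optimal_limit:
  assumes S: "ocp_structure P" and P: "data_assumptions P"
    and zs: "\<And>k. zs k \<in> X_space (hor P)" and z: "z \<in> X_space (hor P)"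
    and Z: "bdd_AE_tendsto (LT (hor P)) (\<lambda>k. val (zs k)) (val z)"
    and dd: "(\<lambda>k. integ (hor P) (\<lambda>t. norm (ddt (hor P) (fst (zs k)) t - ddt (hor P) (fst z) t))) \<longlonglongrightarrow> 0"
    and ends: "(\<lambda>k. ends (hor P) (zs k)) \<longlonglongrightarrow> ends (hor P) z"
    and sub: "\<And>k. subgrads_at P (zs k) (Vs k)"
    and cv: "\<And>i. i \<le> lE P \<Longrightarrow> convergent (\<lambda>k. sv (Vs k) i)"
    and cw: "\<And>j. j \<in> eq_ix P \<Longrightarrow> convergent (\<lambda>k. sw (Vs k) j)"
    and smooth: "\<And>i. smooth_caratheodory (hor P) (Gf P i)" "\<And>i. smooth_caratheodory (hor P) (Hf P i)"
      "\<And>s. s \<in> mixed_ix P \<Longrightarrow> smooth_caratheodory (hor P) (qf P s)"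
    and opt: "\<And>k w. w \<in> X0 P \<Longrightarrow> Qc P c (zs k) (zs k) (Vs k) \<le> Qc P c w (zs k) (Vs k) + e k"
    and e: "\<And>\<eta>. \<eta> > 0 \<Longrightarrow> eventually (\<lambda>k. e k \<le> \<epsilon> + \<eta>) sequentially"
  shows "\<exists>V. subgrads_at P z V \<and> (\<forall>w\<in>X0 P. Qc P c z z V \<le> Qc P c w z V + \<epsilon>)"
proof -
  let ?T = "hor P"
  let ?M = "LT (hor P)"
  have "\<exists>v. subgrad_selection P z (Hf P i) v \<and> bdd_AE_tendsto ?M (\<lambda>k. sV (Vs k) i) v" for i
    by (rule smooth_selection_limit[OF P data_funs_mem(4) Z _ smooth(2)]) (use sub in \<open>simp add: subgrads_at_def\<close>)
  then have "\<forall>i. \<exists>v. subgrad_selection P z (Hf P i) v \<and> bdd_AE_tendsto ?M (\<lambda>k. sV (Vs k) i) v" ..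
  from choice[OF this] obtain vV
    where vV: "\<forall>i. subgrad_selection P z (Hf P i) (vV i) \<and> bdd_AE_tendsto ?M (\<lambda>k. sV (Vs k) i) (vV i)" ..
  have "\<exists>v. subgrad_selection P z (Gf P i) v \<and> bdd_AE_tendsto ?M (\<lambda>k. sW (Vs k) i) v" for i
    by (rule smooth_selection_limit[OF P data_funs_mem(3) Z _ smooth(1)]) (use sub in \<open>simp add: subgrads_at_def\<close>)
  then have "\<forall>i. \<exists>v. subgrad_selection P z (Gf P i) v \<and> bdd_AE_tendsto ?M (\<lambda>k. sW (Vs k) i) v" ..
  from choice[OF this] obtain vW
    where vW: "\<forall>i. subgrad_selection P z (Gf P i) (vW i) \<and> bdd_AE_tendsto ?M (\<lambda>k. sW (Vs k) i) (vW i)" ..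
  have "\<forall>s\<in>mixed_ix P. \<exists>v. subgrad_selection P z (qf P s) v \<and> bdd_AE_tendsto ?M (\<lambda>k. sz (Vs k) s) v"
  proof
    fix s assume s: "s \<in> mixed_ix P"
    show "\<exists>v. subgrad_selection P z (qf P s) v \<and> bdd_AE_tendsto ?M (\<lambda>k. sz (Vs k) s) v"
      by (rule smooth_selection_limit[OF P data_funs_mem(6)[OF s] Z _ smooth(3)[OF s]])
         (use sub s in \<open>simp add: subgrads_at_def\<close>)
  qed
  from bchoice[OF this] obtain vz
    where vz: "\<forall>s\<in>mixed_ix P. subgrad_selection P z (qf P s) (vz s) \<and> bdd_AE_tendsto ?M (\<lambda>k. sz (Vs k) s) (vz s)" ..
  have sel0: "subgrad_selection P (zs k) (H0f P) (sV0 (Vs k))" for k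
    using sub unfolding subgrads_at_def by blast
  obtain v0 where v0: "subgrad_selection P z (H0f P) v0"
    and v0w: "\<And>\<psi> c. ess_bounded ?M \<psi> \<Longrightarrow>
      eventually (\<lambda>k. integ ?T (\<lambda>t. inner (sV0 (Vs k) t) (\<psi> t)) \<le> c) sequentially \<Longrightarrow>
      integ ?T (\<lambda>t. inner (v0 t) (\<psi> t)) \<le> c"
    by (rule weak_selection_limit[where vs = "\<lambda>k. sV0 (Vs k)", OF P data_funs_mem(2) Z sel0]) (rule that)
  define vv where "vv i = lim (\<lambda>k. sv (Vs k) i)" for i
  define ww where "ww j = lim (\<lambda>k. sw (Vs k) j)" for j
  define V where "V = \<lparr>sV0 = v0, sV = vV, sW = vW, sv = vv, sw = ww, sz = vz\<rparr>"
  have lv: "(\<lambda>k. sv (Vs k) i) \<longlonglongrightarrow> sv V i" if "i \<le> lE P" for i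
    using cv[OF that] by (simp add: V_def vv_def convergent_LIMSEQ_iff)
  have lw: "(\<lambda>k. sw (Vs k) j) \<longlonglongrightarrow> sw V j" if "j \<in> eq_ix P" for j
    using cw[OF that] by (simp add: V_def ww_def convergent_LIMSEQ_iff)
  have cont: "isCont (gf P i) b" "isCont (hf P i) b" if "i \<le> lE P" for i b
    using endfun_continuous[OF S that] continuous_on_eq_continuous_at[OF open_UNIV] by blast+
  have VV: "subgrads_at P z V"
    unfolding subgrads_at_def
  proof (intro conjI allI ballI impI)
    show "sv V i \<in> subdiff (hf P i) (ends ?T z)" if "i \<le> lE P" for i
      by (rule subdiff_limit[OF cont(2)[OF that] ends lv[OF that]]) (use sub that in \<open>auto simp: subgrads_at_def\<close>)
    show "sw V j \<in> subdiff (gf P j) (ends ?T z)" if "j \<in> eq_ix P" for j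
      by (rule subdiff_limit[OF cont(1)[OF ix_le_lE(2)[OF that]] ends lw[OF that]]) (use sub that in \<open>auto simp: subgrads_at_def\<close>)
  qed (use v0 vV vW vz in \<open>auto simp: V_def\<close>)
  have v0b: "ess_bounded ?M v0"
    by (rule selection_ess_bounded[OF P data_funs_mem(2) z v0])
  have v0kb: "ess_bounded ?M (sV0 (Vs k))" for k
    by (rule selection_ess_bounded[OF P data_funs_mem(2) zs sel0])
  have "Qc P c z z V \<le> Qc P c w z V + \<epsilon>" if w0: "w \<in> X0 P" for w
  proof -
    have w: "w \<in> X_space ?T"
      using w0 S unfolding ocp_structure_def by blast
    have l0: "(\<lambda>k. sv (Vs k) 0) \<longlonglongrightarrow> sv V 0"
      by (rule lv) simp
    have G: "(\<lambda>k. Gam P w (zs k) (Vs k)) \<longlonglongrightarrow> Gam P w z V"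
      by (rule Gam_tendsto[OF S P w Z ends]) (use vV vW vz lv lw in \<open>auto simp: V_def\<close>)
    have ph: "(\<lambda>k. phi P (zs k)) \<longlonglongrightarrow> phi P z"
      by (rule phi_tendsto[OF S P zs z Z dd ends])
    have ow: "(\<lambda>k. omega_pointwise_part P w (sv (Vs k) 0)) \<longlonglongrightarrow> omega_pointwise_part P w (sv V 0)"
      unfolding omega_pointwise_part_def by (intro tendsto_intros l0)
    have oz: "(\<lambda>k. omega_pointwise_part P (zs k) (sv (Vs k) 0)) \<longlonglongrightarrow> omega_pointwise_part P z (sv V 0)"
      unfolding omega_pointwise_part_def
      by (intro tendsto_intros l0 ends tendsto_endfun[OF S _ ends] le0
          finite_measure.bdd_AE_tendsto_integral(1)[OF finite_measure_LT] data_funs_bdd_AE_tendsto[OF P _ Z] data_funs_mem)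
    obtain \<gamma> where \<gamma>: "AE t in ?M. \<forall>k. norm (sV0 (Vs k) t) \<le> \<gamma>"
      by (rule selections_bounded[where vs = "\<lambda>k. sV0 (Vs k)", OF P data_funs_mem(2) Z sel0]) (rule that)
    have zb: "ess_bounded ?M (val z)" and wb: "ess_bounded ?M (val w)" and zkb: "ess_bounded ?M (val (zs k))" for k
      using X_spaceD(5)[OF z] X_spaceD(5)[OF w] X_spaceD(5)[OF zs] by auto
    \<comment> \<open>A bounded factor times one that tends to 0: this permits replacing the moving
      point by \<open>z\<close> in the pairing with V_0.\<close>
    have err: "(\<lambda>k. integ ?T (\<lambda>t. inner (sV0 (Vs k) t) (val (zs k) t - val z t))) \<longlonglongrightarrow> 0"
    proof -
      have "bdd_AE_tendsto ?M (\<lambda>k t. inner (sV0 (Vs k) t) (val (zs k) t - val z t)) (\<lambda>t. 0)"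
      proof -
        have d: "bdd_AE_tendsto ?M (\<lambda>k t. val (zs k) t - val z t) (\<lambda>t. val z t - val z t)"
          by (intro bdd_AE_tendsto_diff Z zb)
        obtain R where R: "R > 0" "AE t in ?M. \<forall>k. norm (val (zs k) t - val z t) \<le> R"
          using bdd_AE_tendstoE[OF d] .
        have le: "norm (inner a b) \<le> \<gamma> * norm b" if "norm a \<le> \<gamma>" for a b :: "(real^'a) \<times> (real^'b)"
          using Cauchy_Schwarz_ineq2[of a b] that by (simp add: mult_right_mono order_trans)
        show ?thesis
        proof (rule bdd_AE_tendstoI)
          show "(\<lambda>t. inner (sV0 (Vs k) t) (val (zs k) t - val z t)) \<in> borel_measurable ?M" for k
            using bdd_AE_tendstoD(2)[OF bdd_AE_tendsto_inner[OF v0kb[of k] bdd_AE_tendsto_diff[OF zkb[of k] zb]]] .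
          show "AE t in ?M. (\<lambda>k. inner (sV0 (Vs k) t) (val (zs k) t - val z t)) \<longlonglongrightarrow> 0"
            using \<gamma> bdd_AE_tendstoD(3)[OF d]
          proof eventually_elim
            case (elim t)
            have "(\<lambda>k. \<gamma> * norm (val (zs k) t - val z t)) \<longlonglongrightarrow> \<gamma> * norm (val z t - val z t)"
              by (intro tendsto_intros elim(2))
            then have "(\<lambda>k. \<gamma> * norm (val (zs k) t - val z t)) \<longlonglongrightarrow> 0"
              by simp
            then show ?case
              by (rule Lim_null_comparison[rotated]) (use elim(1) le in auto)
          qed
          show "AE t in ?M. \<forall>k. norm (inner (sV0 (Vs k) t) (val (zs k) t - val z t)) \<le> \<bar>\<gamma>\<bar> * R"
            using \<gamma> R(2)
          proof eventually_elim
            case (elim t)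
            show ?case
            proof
              fix k
              have "norm (inner (sV0 (Vs k) t) (val (zs k) t - val z t)) \<le> \<gamma> * norm (val (zs k) t - val z t)"
                using elim(1) le by blast
              also have "\<dots> \<le> \<bar>\<gamma>\<bar> * R"
                using elim(2) by (intro mult_mono) auto
              finally show "norm (inner (sV0 (Vs k) t) (val (zs k) t - val z t)) \<le> \<bar>\<gamma>\<bar> * R" .
            qed
          qed
        qed simp
      qed
      from finite_measure.bdd_AE_tendsto_integral(1)[OF finite_measure_LT this] show ?thesis
        by simp
    qed
    let ?A = "\<lambda>k. omega_pointwise_part P w (sv (Vs k) 0) - omega_pointwise_part P (zs k) (sv (Vs k) 0)
        + c * (Gam P w (zs k) (Vs k) - phi P (zs k)) + integ ?T (\<lambda>t. inner (sV0 (Vs k) t) (val (zs k) t - val z t))"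
    let ?L = "omega_pointwise_part P w (sv V 0) - omega_pointwise_part P z (sv V 0) + c * (Gam P w z V - phi P z)"
    have A: "?A \<longlonglongrightarrow> ?L + 0"
      by (intro tendsto_intros ow oz G ph err)
    \<comment> \<open>The inequality \<open>opt\<close> with the pairing of V_0 and w - z on the
      left; apart from the tolerance \<open>e k\<close>, the right side has a limit.\<close>
    have le: "integ ?T (\<lambda>t. inner (sV0 (Vs k) t) (val w t - val z t)) \<le> ?A k + e k" for k
    proof -
      have i: "integrable ?M (\<lambda>t. inner (sV0 (Vs k) t) (val y t))" if "ess_bounded ?M (val y)" for y
        by (rule ess_bounded_integrable[OF bdd_AE_tendsto_inner[OF v0kb that]])
      have "integ ?T (\<lambda>t. inner (sV0 (Vs k) t) (val w t - val z t)) =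
          integ ?T (\<lambda>t. inner (sV0 (Vs k) t) (val w t)) - integ ?T (\<lambda>t. inner (sV0 (Vs k) t) (val z t))"
        "integ ?T (\<lambda>t. inner (sV0 (Vs k) t) (val (zs k) t - val z t)) =
          integ ?T (\<lambda>t. inner (sV0 (Vs k) t) (val (zs k) t)) - integ ?T (\<lambda>t. inner (sV0 (Vs k) t) (val z t))"
        using i[OF wb] i[OF zb] i[OF zkb] by (simp_all add: inner_diff_right)
      moreover have "omega P (zs k) (Vs k) + c * phi P (zs k) \<le> omega P w (Vs k) + c * Gam P w (zs k) (Vs k) + e k"
        using opt[OF w0, of k] by (simp add: Qc_def Gam_self)
      ultimately show ?thesis
        unfolding omega_eq[OF P w v0kb] omega_eq[OF P zs v0kb] by (simp add: algebra_simps)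
    qed
    \<comment> \<open>The cluster property \<open>v0w\<close> asks for a bound that does not depend
      on \<open>k\<close>. One half of \<eta> absorbs the error of \<open>?A\<close>, the other half
      that of \<open>e\<close>.\<close>
    have "integ ?T (\<lambda>t. inner (v0 t) (val w t - val z t)) \<le> ?L + \<epsilon> + \<eta>" if "\<eta> > 0" for \<eta>
    proof (rule v0w)
      show "ess_bounded ?M (\<lambda>t. val w t - val z t)"
        by (rule bdd_AE_tendsto_diff[OF wb zb])
      have "eventually (\<lambda>k. ?A k < ?L + 0 + \<eta> / 2) sequentially"
        by (rule order_tendstoD(2)[OF A]) (use that in simp)
      moreover have "eventually (\<lambda>k. e k \<le> \<epsilon> + \<eta> / 2) sequentially"
        by (rule e) (use that in simp)
      ultimately show "eventually (\<lambda>k. integ ?T (\<lambda>t. inner (sV0 (Vs k) t) (val w t - val z t)) \<le> ?L + \<epsilon> + \<eta>) sequentially"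
      proof eventually_elim
        case (elim k)
        then show ?case
          using le[of k] by argo
      qed
    qed
    then have "integ ?T (\<lambda>t. inner (v0 t) (val w t - val z t)) \<le> ?L + \<epsilon>"
      by (rule field_le_epsilon)
    moreover have "integ ?T (\<lambda>t. inner (v0 t) (val w t - val z t)) =
        integ ?T (\<lambda>t. inner (v0 t) (val w t)) - integ ?T (\<lambda>t. inner (v0 t) (val z t))"
      using ess_bounded_integrable[OF bdd_AE_tendsto_inner[OF v0b wb]] ess_bounded_integrable[OF bdd_AE_tendsto_inner[OF v0b zb]]
      by (simp add: inner_diff_right)
    moreover have "ess_bounded ?M (sV0 V)" "sV0 V = v0"
      using v0b by (auto simp: V_def)
    ultimately show ?thesis
      unfolding Qc_def Gam_self using omega_eq[OF P w, of V] omega_eq[OF P z, of V]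
      by (simp add: algebra_simps)
  qed
  with VV show ?thesis
    by blast
qed

section \<open>Descent of the penalty function\<close>

text \<open>Replaces the infimum in the extended reals by a comparison with each competitor, the
  form in which limits are taken.\<close>

lemma eps_optimal_iff: "eps_optimal \<epsilon> f S z \<longleftrightarrow> z \<in> S \<and> (\<forall>w\<in>S. f z \<le> f w + \<epsilon>)"
proof
  assume *: "eps_optimal \<epsilon> f S z"
  have "f z \<le> f w + \<epsilon>" if "w \<in> S" for w
  proof -
    have "ereal (f z) \<le> (INF w\<in>S. ereal (f w)) + ereal \<epsilon>"
      using * by (simp add: eps_optimal_def)
    also have "\<dots> \<le> ereal (f w) + ereal \<epsilon>"
      by (intro add_right_mono INF_lower that)
    finally show ?thesis
      by simp
  qed
  with * show "z \<in> S \<and> (\<forall>w\<in>S. f z \<le> f w + \<epsilon>)"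
    by (simp add: eps_optimal_def)
next
  assume *: "z \<in> S \<and> (\<forall>w\<in>S. f z \<le> f w + \<epsilon>)"
  then have "ereal (f z - \<epsilon>) \<le> (INF w\<in>S. ereal (f w))"
    by (intro INF_greatest) (auto simp: diff_le_eq)
  then have "ereal (f z - \<epsilon>) + ereal \<epsilon> \<le> (INF w\<in>S. ereal (f w)) + ereal \<epsilon>"
    by (rule add_right_mono)
  with * show "eps_optimal \<epsilon> f S z"
    by (simp add: eps_optimal_def)
qed

lemma phi_nonneg: "0 \<le> phi P z"
  unfolding phi_def by (intro add_nonneg_nonneg sum_nonneg) (auto intro: integral_nonneg_AE)

lemma feasible_phi:
  assumes "feasible P z"
  shows "phi P z = 0"
proof -
  have "integ (hor P) (\<lambda>t. \<bar>ddt (hor P) (fst z) t $ i - Fc P i (val z t) t\<bar>) = 0" for i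
    by (rule integral_eq_zero_AE) (use assms in \<open>auto simp: feasible_def elim!: eventually_mono\<close>)
  moreover have "integ (hor P) (\<lambda>t. max 0 (Xi P s (val z t) t)) = 0" if "s \<in> mixed_ix P" for s
  proof (rule integral_eq_zero_AE)
    have "AE t in LT (hor P). Xi P s (val z t) t \<le> 0"
      using assms that unfolding feasible_def by blast
    then show "AE t in LT (hor P). max 0 (Xi P s (val z t) t) = 0"
      by eventually_elim simp
  qed
  ultimately show ?thesis
    using assms by (simp add: phi_def feasible_def)
qed

lemma subgrads_at_ess_bounded:
  assumes P: "data_assumptions P" and z: "z \<in> X_space (hor P)" and V: "subgrads_at P z V"
  shows "ess_bounded (LT (hor P)) (sV0 V)" "ess_bounded (LT (hor P)) (sV V i)" "ess_bounded (LT (hor P)) (sW V i)"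
    and "s \<in> mixed_ix P \<Longrightarrow> ess_bounded (LT (hor P)) (sz V s)"
  using V unfolding subgrads_at_def by (auto intro: selection_ess_bounded[OF P _ z] data_funs_mem)

lemma subgrad_selection_AE:
  assumes "subgrad_selection P zb f v"
  shows "AE t in LT (hor P). f (val zb t) t + inner (v t) (a t - val zb t) \<le> f (a t) t"
proof -
  have "AE t in LT (hor P). v t \<in> subdiff (\<lambda>a. f a t) (val zb t)"
    using assms by (simp add: subgrad_selection_def)
  then show ?thesis
    by eventually_elim (unfold subdiff_def, blast)
qed

lemma subdiffD: "v \<in> subdiff f z \<Longrightarrow> f z + inner v (y - z) \<le> f y"
  by (auto simp: subdiff_def)

text \<open>A pointwise comparison. The linearisations of \<open>Gf P i\<close> and
  \<open>Hf P i\<close> at \<open>zb\<close> are minorants, so the first branch of the maximum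
  dominates x' - F and the second one its negative. The end-point and mixed terms follow in the same
  way.\<close>

lemma phi_le_Gam:
  assumes P: "data_assumptions P" and zb: "zb \<in> X_space (hor P)" and w: "w \<in> X_space (hor P)"
    and V: "subgrads_at P zb V" and S: "ocp_structure P"
  shows "phi P w \<le> Gam P w zb V"
  unfolding phi_def Gam_def Let_def
proof (intro add_mono sum_mono)
  let ?T = "hor P"
  note b = bdd_AE_tendsto_max bdd_AE_tendsto_diff bdd_AE_tendsto_add bdd_AE_tendsto_inner bdd_AE_tendsto_uminus bdd_AE_tendsto_abs bdd_AE_tendsto_component ess_bounded_const
    X_spaceD(2)[OF w] X_spaceD(5)[OF w] X_spaceD(5)[OF zb] subgrads_at_ess_bounded[OF P zb V]
    data_funs_bdd_AE_tendsto[OF P _ X_spaceD(5)[OF w]] data_funs_bdd_AE_tendsto[OF P _ X_spaceD(5)[OF zb]] data_funs_mem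
  fix i :: 'a
  show "integ ?T (\<lambda>t. \<bar>ddt ?T (fst w) t $ i - Fc P i (val w t) t\<bar>) \<le> integ ?T (\<lambda>t. max
          (ddt ?T (fst w) t $ i + Hf P i (val w t) t - Gf P i (val zb t) t - inner (sW V i t) (val w t - val zb t))
          (- (ddt ?T (fst w) t $ i) + Gf P i (val w t) t - Hf P i (val zb t) t - inner (sV V i t) (val w t - val zb t)))"
  proof (rule integral_mono_AE)
    show "integrable (LT ?T) (\<lambda>t. \<bar>ddt ?T (fst w) t $ i - Fc P i (val w t) t\<bar>)"
      unfolding Fc_def by (intro ess_bounded_integrable b)
    show "integrable (LT ?T) (\<lambda>t. max
          (ddt ?T (fst w) t $ i + Hf P i (val w t) t - Gf P i (val zb t) t - inner (sW V i t) (val w t - val zb t))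
          (- (ddt ?T (fst w) t $ i) + Gf P i (val w t) t - Hf P i (val zb t) t - inner (sV V i t) (val w t - val zb t)))"
      by (intro ess_bounded_integrable b)
    have "subgrad_selection P zb (Gf P i) (sW V i)" "subgrad_selection P zb (Hf P i) (sV V i)"
      using V unfolding subgrads_at_def by blast+
    from this[THEN subgrad_selection_AE, of "val w"]
    show "AE t in LT ?T. \<bar>ddt ?T (fst w) t $ i - Fc P i (val w t) t\<bar> \<le> max
          (ddt ?T (fst w) t $ i + Hf P i (val w t) t - Gf P i (val zb t) t - inner (sW V i t) (val w t - val zb t))
          (- (ddt ?T (fst w) t $ i) + Gf P i (val w t) t - Hf P i (val zb t) t - inner (sV V i t) (val w t - val zb t))"
      unfolding Fc_def by eventually_elim argo
  qed
next
  fix i assume i: "i \<in> ineq_ix P"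
  then have "sv V i \<in> subdiff (hf P i) (ends (hor P) zb)"
    using V ix_le_lE(1)[OF S] unfolding subgrads_at_def by blast
  from subdiffD[OF this, of "ends (hor P) w"]
  show "max 0 (endf P i (ends (hor P) w)) \<le> max 0 (gf P i (ends (hor P) w) - hf P i (ends (hor P) zb)
      - inner (sv V i) (ends (hor P) w - ends (hor P) zb))"
    unfolding endf_def by argo
next
  fix j assume j: "j \<in> eq_ix P"
  then have "sv V j \<in> subdiff (hf P j) (ends (hor P) zb)" "sw V j \<in> subdiff (gf P j) (ends (hor P) zb)"
    using V ix_le_lE(2) unfolding subgrads_at_def by blast+
  from this[THEN subdiffD, of "ends (hor P) w"]
  show "\<bar>endf P j (ends (hor P) w)\<bar> \<le> max
       (gf P j (ends (hor P) w) - hf P j (ends (hor P) zb) - inner (sv V j) (ends (hor P) w - ends (hor P) zb))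
       (hf P j (ends (hor P) w) - gf P j (ends (hor P) zb) - inner (sw V j) (ends (hor P) w - ends (hor P) zb))"
    unfolding endf_def by argo
next
  let ?T = "hor P"
  note b = bdd_AE_tendsto_max bdd_AE_tendsto_diff bdd_AE_tendsto_inner ess_bounded_const
    X_spaceD(5)[OF w] X_spaceD(5)[OF zb] subgrads_at_ess_bounded[OF P zb V]
    data_funs_bdd_AE_tendsto[OF P _ X_spaceD(5)[OF w]] data_funs_bdd_AE_tendsto[OF P _ X_spaceD(5)[OF zb]] data_funs_mem
  fix s assume s: "s \<in> mixed_ix P"
  show "integ ?T (\<lambda>t. max 0 (Xi P s (val w t) t)) \<le> integ ?T (\<lambda>t. max 0
      (pf P s (val w t) t - qf P s (val zb t) t - inner (sz V s t) (val w t - val zb t)))"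
  proof (rule integral_mono_AE)
    show "integrable (LT ?T) (\<lambda>t. max 0 (Xi P s (val w t) t))"
      unfolding Xi_def by (intro ess_bounded_integrable b s)
    show "integrable (LT ?T) (\<lambda>t. max 0
      (pf P s (val w t) t - qf P s (val zb t) t - inner (sz V s t) (val w t - val zb t)))"
      by (intro ess_bounded_integrable b s)
    have "subgrad_selection P zb (qf P s) (sz V s)"
      using V s unfolding subgrads_at_def by blast
    from subgrad_selection_AE[OF this, of "val w"]
    show "AE t in LT ?T. max 0 (Xi P s (val w t) t) \<le> max 0
      (pf P s (val w t) t - qf P s (val zb t) t - inner (sz V s t) (val w t - val zb t))"
      unfolding Xi_def by eventually_elim argo
  qed
qed

text \<open>In the model, the subtracted functions \<open>H0f P\<close> and \<open>hf P 0\<close>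
  are replaced by affine minorants that touch at \<open>zb\<close>, which can only increase the
  difference.\<close>

lemma Jfun_diff_le:
  assumes P: "data_assumptions P" and zb: "zb \<in> X_space (hor P)" and w: "w \<in> X_space (hor P)"
    and V: "subgrads_at P zb V"
  shows "Jfun P w - Jfun P zb \<le> omega P w V - omega P zb V"
proof -
  let ?T = "hor P"
  note bw = data_funs_bdd_AE_tendsto[OF P _ X_spaceD(5)[OF w]] and bz = data_funs_bdd_AE_tendsto[OF P _ X_spaceD(5)[OF zb]]
  have i: "integrable (LT ?T) (\<lambda>t. G0f P (val w t) t)" "integrable (LT ?T) (\<lambda>t. H0f P (val w t) t)"
    "integrable (LT ?T) (\<lambda>t. G0f P (val zb t) t)" "integrable (LT ?T) (\<lambda>t. H0f P (val zb t) t)"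
    by (intro ess_bounded_integrable bw bz data_funs_mem)+
  note v = subgrads_at_ess_bounded(1)[OF P zb V]
  have j: "integrable (LT ?T) (\<lambda>t. inner (sV0 V t) (val w t))" "integrable (LT ?T) (\<lambda>t. inner (sV0 V t) (val zb t))"
    by (intro ess_bounded_integrable bdd_AE_tendsto_inner v X_spaceD(5)[OF w] X_spaceD(5)[OF zb])+
  have "integ ?T (\<lambda>t. H0f P (val zb t) t + (inner (sV0 V t) (val w t) - inner (sV0 V t) (val zb t))) \<le> integ ?T (\<lambda>t. H0f P (val w t) t)"
  proof (rule integral_mono_AE)
    have "subgrad_selection P zb (H0f P) (sV0 V)"
      using V unfolding subgrads_at_def by blast
    from subgrad_selection_AE[OF this, of "val w"]
    show "AE t in LT ?T. H0f P (val zb t) t + (inner (sV0 V t) (val w t) - inner (sV0 V t) (val zb t)) \<le> H0f P (val w t) t"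
      by (simp add: inner_diff_right)
  qed (use i j in auto)
  then have int: "integ ?T (\<lambda>t. H0f P (val zb t) t) + (integ ?T (\<lambda>t. inner (sV0 V t) (val w t)) - integ ?T (\<lambda>t. inner (sV0 V t) (val zb t)))
      \<le> integ ?T (\<lambda>t. H0f P (val w t) t)"
    using i j by simp
  have "sv V 0 \<in> subdiff (hf P 0) (ends ?T zb)"
    using V unfolding subgrads_at_def by blast
  from subdiffD[OF this, of "ends ?T w"]
  have "hf P 0 (ends ?T zb) + (inner (sv V 0) (ends ?T w) - inner (sv V 0) (ends ?T zb)) \<le> hf P 0 (ends ?T w)"
    by (simp add: inner_diff_right)
  with int show ?thesis
    using i unfolding omega_eq[OF P w v] omega_eq[OF P zb v] by (simp add: Jfun_def F0_def endf_def omega_pointwise_part_def)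
qed

lemma Phi_diff_le:
  assumes P: "data_assumptions P" and S: "ocp_structure P" and zb: "zb \<in> X_space (hor P)" and w: "w \<in> X_space (hor P)"
    and V: "subgrads_at P zb V" and c: "c \<ge> 0"
  shows "Phi P c w - Phi P c zb \<le> Qc P c w zb V - Qc P c zb zb V"
proof -
  have "c * phi P w \<le> c * Gam P w zb V"
    by (intro mult_left_mono phi_le_Gam[OF P zb w V S] c)
  then show ?thesis
    using Jfun_diff_le[OF P zb w V] by (simp add: Phi_def Qc_def Gam_self)
qed

section \<open>Stabilisation of the penalty parameter\<close>

lemma increases_by_last:
  assumes "increases_by \<kappa> cs" and "cs \<noteq> []" and "\<kappa> > 0"
  shows "last cs = hd cs \<or> hd cs + \<kappa> \<le> last cs"
  using assms
proof (induction cs)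
  case (Cons a cs)
  show ?case
  proof (cases cs)
    case (Cons b bs)
    have "a + \<kappa> \<le> b"
      using Cons.prems(1) Cons unfolding increases_by_def by fastforce
    moreover have "increases_by \<kappa> cs"
      using Cons.prems(1) unfolding increases_by_def by fastforce
    then have "last cs = hd cs \<or> hd cs + \<kappa> \<le> last cs"
      using Cons.IH Cons Cons.prems(3) by blast
    ultimately show ?thesis
      using Cons Cons.prems(3) by auto
  qed simp
qed simp

text \<open>The loop of Step 4 starts where that of Steps 1 to 3 ended, so an iteration keeps the
  parameter or raises it by a full increment. That the final value was tried makes the tolerance and
  the decrease condition available for the trial point.\<close>

lemma pen_increase:
  assumes B: "B_STEP_DCA P R" and A: "standing_assumptions P R"
  shows "\<exists>\<kappa>>0. \<forall>k. pen R (Suc k) = pen R k \<or> pen R k + \<kappa> \<le> pen R (Suc k)"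
    and "pen R (Suc k) \<in> tried R k"
proof -
  have s: "steps_1_to_3 P R k" "step_4 P R k" for k
    using B unfolding B_STEP_DCA_def by blast+
  have t1: "trials R k \<noteq> [] \<and> hd (trials R k) = pen R k" for k
    using s(1)[of k] unfolding steps_1_to_3_def while_increase_def Let_def by (auto split: if_splits)
  have t4: "trials4 R k \<noteq> [] \<and> hd (trials4 R k) = last (trials R k) \<and> pen R (Suc k) = last (trials4 R k)" for k
    using s(2)[of k] unfolding step_4_def while_increase_def Let_def by blast
  show "pen R (Suc k) \<in> tried R k"
    using t4[of k] by (simp add: tried_def)
  obtain \<kappa> where \<kappa>: "\<kappa> > 0" "\<And>k. increases_by \<kappa> (trials R k)" "\<And>k. increases_by \<kappa> (trials4 R k)"
    using A unfolding standing_assumptions_def by blast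
  have "pen R (Suc k) = pen R k \<or> pen R k + \<kappa> \<le> pen R (Suc k)" for k
    using increases_by_last[OF \<kappa>(2)[of k] _ \<kappa>(1)] increases_by_last[OF \<kappa>(3)[of k] _ \<kappa>(1)] t1[of k] t4[of k] \<kappa>(1)
    by auto
  with \<kappa>(1) show "\<exists>\<kappa>>0. \<forall>k. pen R (Suc k) = pen R k \<or> pen R k + \<kappa> \<le> pen R (Suc k)"
    by blast
qed

text \<open>A bounded increasing sequence converges, so its increments eventually fall below
  \<kappa> and are then zero.\<close>

lemma eventually_const_of_large_steps:
  fixes p :: "nat \<Rightarrow> real"
  assumes "\<kappa> > 0" and step: "\<And>k. p (Suc k) = p k \<or> p k + \<kappa> \<le> p (Suc k)" and "bounded (range p)"
  shows "\<exists>N. \<forall>k\<ge>N. p k = p N"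
proof -
  have "incseq p"
    by (rule incseq_SucI) (use step assms(1) in \<open>smt (verit)\<close>)
  moreover obtain C where "\<And>k. p k \<le> C"
    using assms(3) unfolding bounded_iff by (metis abs_le_D1 rangeI real_norm_def)
  ultimately obtain L where "p \<longlonglongrightarrow> L"
    using incseq_convergent[of p C] by blast
  then have "(\<lambda>k. p (Suc k) - p k) \<longlonglongrightarrow> L - L"
    by (intro tendsto_diff LIMSEQ_Suc)
  then have "eventually (\<lambda>k. p (Suc k) - p k < \<kappa>) sequentially"
    using order_tendstoD(2)[of _ "L - L" sequentially \<kappa>] assms(1) by simp
  then obtain N where N: "\<And>k. k \<ge> N \<Longrightarrow> p (Suc k) - p k < \<kappa>"
    unfolding eventually_sequentially by blast
  have "p k = p N" if "k \<ge> N" for k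
    using that
  proof (induction k rule: dec_induct)
    case (step k)
    then show ?case
      using assms(2)[of k] N[of k] by auto
  qed simp
  then show ?thesis
    by blast
qed

section \<open>Almost optimality of the iterates\<close>

lemma iterates_almost_eps_optimal:
  assumes S: "ocp_structure P" and P: "data_assumptions P"
    and B: "B_STEP_DCA P R" and A: "standing_assumptions P R"
    and bd: "bounded (range (pen R))" and nu: "summable (nu R)"
  shows "\<exists>N c a. c > 0 \<and> a \<longlonglongrightarrow> (0::real) \<and> (\<forall>k\<ge>N. \<forall>w\<in>X0 P.
      Qc P c (iterate R k) (iterate R k) (subgr R k) \<le> Qc P c w (iterate R k) (subgr R k) + (a k + eps R k))"
    and "iterate R k \<in> X0 P" and "subgrads_at P (iterate R k) (subgr R k)"
proof -
  let ?z = "iterate R" and ?y = "trial_point R"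
  have X0: "?z k \<in> X0 P" for k
  proof (cases k)
    case 0
    then show ?thesis
      using B by (simp add: B_STEP_DCA_def)
  next
    case (Suc j)
    have "?z (Suc j) = line_point R j (jexp R j)"
      using B unfolding B_STEP_DCA_def step_5_def by blast
    then show ?thesis
      using A Suc unfolding standing_assumptions_def by simp
  qed
  then show "iterate R k \<in> X0 P" .
  have sub: "subgrads_at P (?z k) (subgr R k)" for k
    using B unfolding B_STEP_DCA_def by blast
  then show "subgrads_at P (iterate R k) (subgr R k)" .
  have X: "w \<in> X_space (hor P)" if "w \<in> X0 P" for w
    using S that unfolding ocp_structure_def by blast
  obtain \<kappa> where \<kappa>: "\<kappa> > 0" "\<And>k. pen R (Suc k) = pen R k \<or> pen R k + \<kappa> \<le> pen R (Suc k)"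
    using pen_increase(1)[OF B A] by blast
  obtain N where N: "\<And>k. k \<ge> N \<Longrightarrow> pen R k = pen R N"
    using eventually_const_of_large_steps[OF \<kappa> bd] by blast
  define c where "c = pen R N"
  have "pen R 0 \<le> pen R k" for k
    by (induction k) (use \<kappa> in \<open>smt (verit)\<close>)+
  then have c0: "pen R 0 \<le> c" and c: "c > 0"
    using B by (auto simp: c_def B_STEP_DCA_def intro: less_le_trans)
  have cS: "pen R (Suc k) = c" if "k \<ge> N" for k
    using N[of "Suc k"] that by (simp add: c_def)
  \<comment> \<open>The decrease of the model from the iterate to the trial point. It measures how
    far the iterate is from sharing the tolerance of the trial point; for k \<ge> N it is
    nonnegative by the standing assumption, and descent makes it summable.\<close>
  define a where "a k = Q_k P R k c (?z k) - Q_k P R k c (?y k)" for k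
  have y: "eps_optimal (eps R k) (Q_k P R k c) (X0 P) (?y k)" "0 \<le> a k" if "k \<ge> N" for k
    using B A pen_increase(2)[OF B A, of k] cS[OF that]
    unfolding B_STEP_DCA_def standing_assumptions_def trial_point_def a_def by fastforce+
  obtain L where L: "\<And>w. w \<in> X0 P \<Longrightarrow> L \<le> Phi P (pen R 0) w"
    using A unfolding standing_assumptions_def bdd_below_def by blast
  \<comment> \<open>Boundedness below is given for the initial parameter; it carries over to the
    larger \<open>c\<close> because \<phi> is nonnegative.\<close>
  have Lc: "L \<le> Phi P c w" if "w \<in> X0 P" for w
    using L[OF that] mult_right_mono[OF c0 phi_nonneg[of P w]] by (simp add: Phi_def)
  \<comment> \<open>From the iterate to the trial point the majorant makes \<open>Phi\<close> fall
    by at least \<open>a k\<close>. From there the line search lets it rise by at most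
    \<open>nu R k\<close>, since its quadratic term is nonpositive.\<close>
  have step: "Phi P c (?z (Suc k)) \<le> Phi P c (?z k) - a k + nu R k" if k: "k \<ge> N" for k
  proof -
    have "line_search_ok P R k (jexp R k)" "?z (Suc k) = line_point R k (jexp R k)"
      using B unfolding B_STEP_DCA_def step_5_def by blast+
    then have "Phi P c (?z (Suc k)) - Phi P c (?y k)
        \<le> - sigma R * (zeta R ^ jexp R k * alpha_bar R k)\<^sup>2 * L2_norm_sq (hor P) (dir R k) + nu R k"
      using cS[OF k] by (simp add: line_search_ok_def)
    moreover have "0 \<le> L2_norm_sq (hor P) (dir R k)"
      unfolding L2_norm_sq_def by (intro integral_nonneg_AE) simp
    then have "0 \<le> sigma R * (zeta R ^ jexp R k * alpha_bar R k)\<^sup>2 * L2_norm_sq (hor P) (dir R k)"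
      using B by (auto simp: B_STEP_DCA_def)
    moreover have "?y k \<in> X0 P"
      using y(1)[OF k] by (simp add: eps_optimal_iff)
    then have "Phi P c (?y k) - Phi P c (?z k) \<le> - a k"
      using Phi_diff_le[OF P S X[OF X0] X sub less_imp_le[OF c], of "?y k" k] by (simp add: a_def Q_k_def)
    ultimately show ?thesis
      by simp
  qed
  \<comment> \<open>Telescoping begins at \<open>N\<close>, because only from there on is
    \<open>Phi\<close> compared for one and the same parameter.\<close>
  have "(\<Sum>i<n. a (N + i)) \<le> Phi P c (?z N) - L + suminf (\<lambda>i. nu R (N + i))" for n
  proof -
    have "(\<Sum>i<n. a (N + i)) \<le> Phi P c (?z N) - Phi P c (?z (N + n)) + (\<Sum>i<n. nu R (N + i))"
    proof (induction n)
      case (Suc n)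
      then show ?case
        using step[of "N + n"] by simp
    qed simp
    moreover have "summable (\<lambda>i. nu R (N + i))"
      using summable_ignore_initial_segment[OF nu, of N] by (simp add: add.commute)
    then have "(\<Sum>i<n. nu R (N + i)) \<le> suminf (\<lambda>i. nu R (N + i))"
      using B by (intro sum_le_suminf) (auto simp: B_STEP_DCA_def step_5_def intro: less_imp_le)
    ultimately show ?thesis
      using Lc[OF X0[of "N + n"]] by linarith
  qed
  then have "summable (\<lambda>i. a (N + i))"
    using y(2) by (intro summableI_nonneg_bounded) auto
  then have "(\<lambda>i. a (N + i)) \<longlonglongrightarrow> 0"
    by (rule summable_LIMSEQ_zero)
  then have "(\<lambda>i. a (i + N)) \<longlonglongrightarrow> 0"
    by (simp add: add.commute)
  then have a0: "a \<longlonglongrightarrow> 0"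
    by (rule LIMSEQ_offset)
  have "Qc P c (?z k) (?z k) (subgr R k) \<le> Qc P c w (?z k) (subgr R k) + (a k + eps R k)"
    if k: "k \<ge> N" and w: "w \<in> X0 P" for k w
  proof -
    have "Q_k P R k c (?y k) \<le> Q_k P R k c w + eps R k"
      using y(1)[OF k] w by (simp add: eps_optimal_iff)
    then show ?thesis
      by (simp add: a_def Q_k_def)
  qed
  with c a0 show "\<exists>N c a. c > 0 \<and> a \<longlonglongrightarrow> (0::real) \<and> (\<forall>k\<ge>N. \<forall>w\<in>X0 P.
      Qc P c (?z k) (?z k) (subgr R k) \<le> Qc P c w (?z k) (subgr R k) + (a k + eps R k))"
    by blast
qed

section \<open>Subsequences and the limit point\<close>

text \<open>The states converge uniformly, so their end points converge without further selection.
  Subsequences are extracted for almost everywhere convergence of the controls and for the end-point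
  subgradients, which are bounded in finite dimension.\<close>

lemma convergent_subsequence_of_iterates:
  assumes S: "ocp_structure P" and P: "data_assumptions P"
    and X: "\<And>k. zs k \<in> X_space (hor P)" and z: "z \<in> X_space (hor P)"
    and Y: "(\<lambda>k. Y_dist (hor P) (zs k) z) \<longlonglongrightarrow> 0"
    and M: "\<And>k. Linf_norm (hor P) (snd (zs k)) \<le> ereal M"
    and sub: "\<And>k. subgrads_at P (zs k) (Vs k)"
  shows "\<exists>r. strict_mono (r :: nat \<Rightarrow> nat) \<and> bdd_AE_tendsto (LT (hor P)) (\<lambda>k. val (zs (r k))) (val z) \<and>
    (\<lambda>k. integ (hor P) (\<lambda>t. norm (ddt (hor P) (fst (zs (r k))) t - ddt (hor P) (fst z) t))) \<longlonglongrightarrow> 0 \<and>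
    (\<lambda>k. ends (hor P) (zs (r k))) \<longlonglongrightarrow> ends (hor P) z \<and>
    (\<forall>i\<le>lE P. convergent (\<lambda>k. sv (Vs (r k)) i)) \<and> (\<forall>j\<in>eq_ix P. convergent (\<lambda>k. sw (Vs (r k)) j))"
proof -
  let ?T = "hor P"
  let ?M = "LT ?T"
  have T: "?T > 0"
    using S by (simp add: ocp_structure_def)
  note Yb = Y_dist_bounds[OF X z T]
  have xlim: "(\<lambda>k. fst (zs k) t) \<longlonglongrightarrow> fst z t" if t: "t \<in> {0..?T}" for t
  proof -
    have "(\<lambda>k. (1 / ?T + 1) * Y_dist ?T (zs k) z) \<longlonglongrightarrow> (1 / ?T + 1) * 0"
      by (intro tendsto_mult tendsto_const Y)
    then have "(\<lambda>k. (1 / ?T + 1) * Y_dist ?T (zs k) z) \<longlonglongrightarrow> 0"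
      by simp
    then have "(\<lambda>k. fst (zs k) t - fst z t) \<longlonglongrightarrow> 0"
      by (rule Lim_null_comparison[OF always_eventually[OF allI[OF Yb(1)[OF t]]]])
    then show ?thesis
      by (rule LIM_zero_cancel)
  qed
  have ends: "(\<lambda>k. ends ?T (zs k)) \<longlonglongrightarrow> ends ?T z"
    unfolding ends_def using T by (intro tendsto_Pair xlim) auto
  have dd: "(\<lambda>k. integ ?T (\<lambda>t. norm (ddt ?T (fst (zs k)) t - ddt ?T (fst z) t))) \<longlonglongrightarrow> 0"
    by (rule tendsto_sandwich[OF always_eventually always_eventually[OF allI[OF Yb(2)]] tendsto_const Y])
       (auto intro: integral_nonneg_AE)
  have uu: "(\<lambda>k. integ ?T (\<lambda>t. norm (snd (zs k) t - snd z t))) \<longlonglongrightarrow> 0"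
    by (rule tendsto_sandwich[OF always_eventually always_eventually[OF allI[OF Yb(3)]] tendsto_const Y])
       (auto intro: integral_nonneg_AE)
  have "integrable ?M (\<lambda>t. snd (zs k) t - snd z t)" for k
    by (intro ess_bounded_integrable bdd_AE_tendsto_diff X_spaceD(4) X z)
  from tendsto_L1_AE_subseq[of ?M "\<lambda>k t. snd (zs k) t - snd z t", OF this uu]
  obtain r1 where r1: "strict_mono r1" "AE t in ?M. (\<lambda>k. snd (zs (r1 k)) t - snd z t) \<longlonglongrightarrow> 0"
    by blast
  have bx: "bdd_AE_tendsto ?M (\<lambda>k. fst (zs k)) (fst z)"
  proof -
    obtain C where C: "\<And>k. Y_dist ?T (zs k) z \<le> C"
      using convergent_imp_Bseq[OF convergentI[OF Y]] unfolding Bseq_def by (metis abs_le_D1 real_norm_def)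
    obtain D where D: "AE t in ?M. norm (fst z t) \<le> D"
      by (rule bdd_AE_tendsto_limit_bounded[OF X_spaceD(3)[OF z]])
    have t: "AE t in ?M. t \<in> {0..?T}"
      by (rule AE_I2) simp
    show ?thesis
    proof (rule bdd_AE_tendstoI[OF bdd_AE_tendstoD(2)[OF X_spaceD(3)[OF X]] bdd_AE_tendstoD(2)[OF X_spaceD(3)[OF z]]])
      show "AE t in ?M. (\<lambda>k. fst (zs k) t) \<longlonglongrightarrow> fst z t"
        using t by eventually_elim (rule xlim)
      show "AE t in ?M. \<forall>k. norm (fst (zs k) t) \<le> D + (1 / ?T + 1) * C"
        using t D
      proof eventually_elim
        case (elim t)
        show ?case
        proof
          fix k
          have "norm (fst (zs k) t) \<le> norm (fst z t) + norm (fst (zs k) t - fst z t)"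
            by (rule norm_triangle_sub)
          also have "norm (fst (zs k) t - fst z t) \<le> (1 / ?T + 1) * Y_dist ?T (zs k) z"
            by (rule Yb(1)[OF elim(1)])
          also have "\<dots> \<le> (1 / ?T + 1) * C"
            using T C by (intro mult_left_mono) auto
          finally show "norm (fst (zs k) t) \<le> D + (1 / ?T + 1) * C"
            using elim(2) by linarith
        qed
      qed
    qed
  qed
  have um: "AE t in ?M. norm (snd (zs k) t) \<le> M" for k
  proof -
    have [measurable]: "snd (zs k) \<in> borel_measurable ?M"
      by (rule bdd_AE_tendstoD(2)[OF X_spaceD(4)[OF X]])
    have "AE t in ?M. ereal (norm (snd (zs k) t)) \<le> esssup ?M (\<lambda>t. ereal (norm (snd (zs k) t)))"
      by (rule esssup_AE)
    then show ?thesis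
    proof eventually_elim
      case (elim t)
      also have "esssup ?M (\<lambda>t. ereal (norm (snd (zs k) t))) \<le> ereal M"
        using M[of k] by (simp add: Linf_norm_def)
      finally show ?case
        by simp
    qed
  qed
  have bu: "bdd_AE_tendsto ?M (\<lambda>k. snd (zs (r1 k))) (snd z)"
  proof (rule bdd_AE_tendstoI[OF bdd_AE_tendstoD(2)[OF X_spaceD(4)[OF X]] bdd_AE_tendstoD(2)[OF X_spaceD(4)[OF z]]])
    show "AE t in ?M. (\<lambda>k. snd (zs (r1 k)) t) \<longlonglongrightarrow> snd z t"
      using r1(2) by eventually_elim (rule LIM_zero_cancel)
    show "AE t in ?M. \<forall>k. norm (snd (zs (r1 k)) t) \<le> M"
      unfolding AE_all_countable using um by blast
  qed
  have bz: "bdd_AE_tendsto ?M (\<lambda>k. val (zs (r1 k))) (val z)"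
    using bdd_AE_tendsto_Pair[OF bdd_AE_tendsto_subseq[OF bx r1(1)] bu] by (simp add: val_def[abs_def])
  have eb: "bounded (range (\<lambda>k. ends ?T (zs k)))"
    by (rule convergent_imp_bounded[OF ends])
  have sub_range: "bounded (range (\<lambda>k. f (r k)))" if "bounded (range f)" for f :: "nat \<Rightarrow> (real^'a) \<times> (real^'a)" and r
    by (rule bounded_subset[OF that]) auto
  have svb: "bounded (range (\<lambda>k. sv (Vs k) i))" if "i \<in> {..lE P}" for i
    by (rule subdiff_bounded[OF endfun_continuous(2)[OF S] eb, of i]) (use sub that in \<open>auto simp: subgrads_at_def\<close>)
  have "\<exists>r. strict_mono r \<and> (\<forall>i\<in>{..lE P}. convergent (\<lambda>k. sv (Vs (r1 (r k))) i))"
    by (rule finite_family_convergent_subseq[where V = "\<lambda>i k. sv (Vs (r1 k)) i", OF finite_atMost sub_range[OF svb]])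
  then obtain r2 where r2: "strict_mono r2" "\<And>i. i \<in> {..lE P} \<Longrightarrow> convergent (\<lambda>k. sv (Vs (r1 (r2 k))) i)"
    by blast
  have swb: "bounded (range (\<lambda>k. sw (Vs k) j))" if "j \<in> eq_ix P" for j
    by (rule subdiff_bounded[OF endfun_continuous(1)[OF S ix_le_lE(2)[OF that]] eb])
       (use sub that in \<open>auto simp: subgrads_at_def\<close>)
  have "finite (eq_ix P)"
    by (simp add: eq_ix_def)
  then have "\<exists>r. strict_mono r \<and> (\<forall>j\<in>eq_ix P. convergent (\<lambda>k. sw (Vs (r1 (r2 (r k)))) j))"
    by (rule finite_family_convergent_subseq[where V = "\<lambda>j k. sw (Vs (r1 (r2 k))) j",
        OF _ sub_range[OF swb]])
  then obtain r3 where r3: "strict_mono r3" "\<And>j. j \<in> eq_ix P \<Longrightarrow> convergent (\<lambda>k. sw (Vs (r1 (r2 (r3 k)))) j)"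
    by blast
  define r where "r k = r1 (r2 (r3 k))" for k
  have r23: "strict_mono (\<lambda>k. r2 (r3 k))"
    using strict_mono_o[OF r2(1) r3(1)] by (simp add: o_def)
  have r: "strict_mono r"
    using strict_mono_o[OF r1(1) r23] by (simp add: o_def r_def[abs_def])
  have "convergent (\<lambda>k. sv (Vs (r k)) i)" if "i \<le> lE P" for i
    using convergent_subseq_convergent[OF r2(2)[of i] r3(1)] that by (simp add: o_def r_def)
  moreover have "bdd_AE_tendsto ?M (\<lambda>k. val (zs (r k))) (val z)"
    using bdd_AE_tendsto_subseq[OF bz r23] by (simp add: r_def)
  moreover have "(\<lambda>k. integ ?T (\<lambda>t. norm (ddt ?T (fst (zs (r k))) t - ddt ?T (fst z) t))) \<longlonglongrightarrow> 0"
    using LIMSEQ_subseq_LIMSEQ[OF dd r] by (simp add: o_def)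
  moreover have "(\<lambda>k. ends ?T (zs (r k))) \<longlonglongrightarrow> ends ?T z"
    using LIMSEQ_subseq_LIMSEQ[OF ends r] by (simp add: o_def)
  moreover have "convergent (\<lambda>k. sw (Vs (r k)) j)" if "j \<in> eq_ix P" for j
    using r3(2)[OF that] by (simp add: r_def)
  ultimately show ?thesis
    using r by blast
qed

theorem theorem4:
  fixes P :: "('n::finite, 'm::finite) ocp"
    and R :: "('n, 'm) dca_run"
    and eps_star :: real
    and z_star :: "('n, 'm) process"
  assumes "ocp_structure P" and "data_assumptions P"
    and "B_STEP_DCA P R" and "standing_assumptions P R"
    and "bounded (range (pen R))" and "bounded (range (eps R))"
    and "summable (nu R)" and "limsup (\<lambda>k. ereal (eps R k)) = ereal eps_star"
    and "\<exists>M::real. \<forall>k. Linf_norm (hor P) (snd (iterate R k)) \<le> ereal M"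
    and "\<forall>i. smooth_caratheodory (hor P) (Gf P i) \<and> smooth_caratheodory (hor P) (Hf P i)"
    and "\<forall>s\<in>mixed_ix P. smooth_caratheodory (hor P) (qf P s)"
    and "z_star \<in> X_space (hor P)"
    and "Y_limit_point (hor P) (iterate R) z_star"
  shows "gen_critical P eps_star z_star \<and> (feasible P z_star \<longrightarrow> critical P eps_star z_star)"
proof -
  note S = assms(1) and P = assms(2) and z = assms(12)
  note d = iterates_almost_eps_optimal[OF S P assms(3,4,5,7)]
  obtain N c a where c: "c > 0" and a: "a \<longlonglongrightarrow> (0::real)"
    and opt: "\<forall>k\<ge>N. \<forall>w\<in>X0 P. Qc P c (iterate R k) (iterate R k) (subgr R k)
      \<le> Qc P c w (iterate R k) (subgr R k) + (a k + eps R k)"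
    using d(1) by blast
  have X: "w \<in> X_space (hor P)" if "w \<in> X0 P" for w
    using S that unfolding ocp_structure_def by blast
  obtain M :: real where M: "\<And>k. Linf_norm (hor P) (snd (iterate R k)) \<le> ereal M"
    using assms(9) by blast
  obtain r where r: "strict_mono r" and Y: "(\<lambda>k. Y_dist (hor P) (iterate R (r k)) z_star) \<longlonglongrightarrow> 0"
    using assms(13) unfolding Y_limit_point_def by blast
  \<comment> \<open>Closedness in the topology of Y is available for limits that lie in X, as this
    one does.\<close>
  have zX0: "z_star \<in> X0 P"
  proof -
    have "\<exists>w\<in>X0 P. Y_dist (hor P) w z_star < e" if "e > 0" for e
    proof -
      have "eventually (\<lambda>k. Y_dist (hor P) (iterate R (r k)) z_star < e) sequentially"
        using order_tendstoD(2)[OF Y that] .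
      then show ?thesis
        using d(2) by (auto simp: eventually_sequentially)
    qed
    then show ?thesis
      using S z unfolding ocp_structure_def closed_in_X_def by blast
  qed
  \<comment> \<open>Almost optimality is known from index \<open>N\<close> on; since r (k + N) \<ge>
    k + N, the shift makes it hold along the whole subsequence.\<close>
  define q where "q k = r (k + N)" for k
  have q: "strict_mono q"
    using r by (auto simp: q_def strict_mono_def)
  have qN: "N \<le> q k" for k
    using seq_suble[OF r, of "k + N"] by (simp add: q_def)
  have Yq: "(\<lambda>k. Y_dist (hor P) (iterate R (q k)) z_star) \<longlonglongrightarrow> 0"
    using LIMSEQ_ignore_initial_segment[OF Y, of N] by (simp add: q_def)
  obtain p where p: "strict_mono p" and bz: "bdd_AE_tendsto (LT (hor P)) (\<lambda>k. val (iterate R (q (p k)))) (val z_star)"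
    and dd: "(\<lambda>k. integ (hor P) (\<lambda>t. norm (ddt (hor P) (fst (iterate R (q (p k)))) t - ddt (hor P) (fst z_star) t))) \<longlonglongrightarrow> 0"
    and en: "(\<lambda>k. ends (hor P) (iterate R (q (p k)))) \<longlonglongrightarrow> ends (hor P) z_star"
    and cv: "\<forall>i\<le>lE P. convergent (\<lambda>k. sv (subgr R (q (p k))) i)"
    and cw: "\<forall>j\<in>eq_ix P. convergent (\<lambda>k. sw (subgr R (q (p k))) j)"
    using convergent_subsequence_of_iterates[where zs = "\<lambda>k. iterate R (q k)" and Vs = "\<lambda>k. subgr R (q k)", OF S P X[OF d(2)] z Yq M d(3)]
    by blast
  define s where "s k = q (p k)" for k
  have s: "strict_mono s"
    using strict_mono_o[OF q p] by (simp add: o_def s_def[abs_def])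
  \<comment> \<open>An eventual upper bound is inherited by every subsequence, which is why the
    limit superior of the tolerances serves for all limit points at once.\<close>
  have ev: "eventually (\<lambda>k. a (s k) + eps R (s k) \<le> eps_star + \<eta>) sequentially" if "\<eta> > 0" for \<eta>
  proof -
    have "eventually (\<lambda>k. a k < \<eta> / 2) sequentially"
      using order_tendstoD(2)[OF a, of "\<eta> / 2"] that by simp
    moreover have "eventually (\<lambda>k. ereal (eps R k) < ereal (eps_star + \<eta> / 2)) sequentially"
      by (rule Limsup_lessD) (use assms(8) that in simp)
    ultimately have "eventually (\<lambda>k. a k + eps R k \<le> eps_star + \<eta>) sequentially"
    proof eventually_elim
      case (elim k)
      then have "eps R k < eps_star + \<eta> / 2"
        by simp
      then show ?case
        using elim(1) by argo
    qed
    from eventually_subseq[OF s this] show ?thesis .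
  qed
  have "\<exists>V. subgrads_at P z_star V \<and> (\<forall>w\<in>X0 P. Qc P c z_star z_star V \<le> Qc P c w z_star V + eps_star)"
  proof (rule eps_optimal_limit[where zs = "\<lambda>k. iterate R (s k)" and Vs = "\<lambda>k. subgr R (s k)" and e = "\<lambda>k. a (s k) + eps R (s k)", OF S P X[OF d(2)] z])
    show "Qc P c (iterate R (s k)) (iterate R (s k)) (subgr R (s k)) \<le> Qc P c w (iterate R (s k)) (subgr R (s k)) + (a (s k) + eps R (s k))"
      if "w \<in> X0 P" for k w
      using opt qN[of "p k"] that unfolding s_def by blast
  qed (use bz dd en cv cw d(3) assms(10,11) ev in \<open>auto simp: s_def\<close>)
  then obtain V where V: "subgrads_at P z_star V"
    and le: "\<And>w. w \<in> X0 P \<Longrightarrow> Qc P c z_star z_star V \<le> Qc P c w z_star V + eps_star"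
    by blast
  have "gen_critical P eps_star z_star"
    unfolding gen_critical_def gen_critical_for_def eps_optimal_iff using c zX0 V le by blast
  moreover have "critical P eps_star z_star" if feas: "feasible P z_star"
  proof -
    \<comment> \<open>The collection \<open>V\<close> found for the final parameter \<open>c\<close>
      is kept, and \<open>c\<close> itself becomes the threshold required by criticality.\<close>
    have "Qc P c' z_star z_star V \<le> Qc P c' w z_star V + eps_star" if c': "c' \<ge> c" and w: "w \<in> X0 P" for c' w
    proof -
      have "Gam P z_star z_star V = 0"
        by (simp add: Gam_self feasible_phi[OF feas])
      moreover have "0 \<le> Gam P w z_star V"
        using phi_nonneg phi_le_Gam[OF P z X[OF w] V S] by (rule order_trans)
      then have "c * Gam P w z_star V \<le> c' * Gam P w z_star V"
        using c' by (rule mult_right_mono[rotated])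
      ultimately show ?thesis
        using le[OF w] by (simp add: Qc_def)
    qed
    then show ?thesis
      unfolding critical_def eps_optimal_iff using feas V c zX0 by blast
  qed
  ultimately show ?thesis
    by blast
qed

end
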